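(* Let $f$ be a meromorphic function on $\mathbb{C}$ of finite order. If $f$ has three distinct Wilson exceptional values (in $\hat{\mathbb{C}}=\mathbb{C}\cup\{\infty\}$), then either $f\in\ker\mathcal{D}_{\mathrm{W}}$ or $f$ is rational.
   Context: The Wilson operator $\mathcal{D}_{\mathrm{W}}$: for $x\ne0$ and $z$ with $z^2=x$, $$(\mathcal{D}_{\mathrm{W}}f)(x):=\frac{f((z+\frac i2)^2)-f((z-\frac i2)^2)}{2iz},$$ which does not depend on the choice of $z$; at $x=0$ the value is the limit as $x\to0$. $\ker\mathcal{D}_{\mathrm{W}}$ is the set of functions $f$ with $\mathcal{D}_{\mathrm{W}}f\equiv0$. Fix a branch $\sqrt{\cdot}$ of the square root with the imaginary axis (in the plane of $z=\sqrt x$) as branch cut: for $x\notin(-\infty,0]$ the values $\sqrt x$ lie in one fixed open half-plane bounded by the imaginary axis, and $\sqrt{-t^2}=it$ for $t\ge0$. Put $x^\pm:=(\sqrt x\pm\frac i2)^2$, $x^{\pm(0)}:=x$, $x^{\pm(m)}:=(x^{\pm(m-1)})^\pm$ for $m\ge1$, and $x^{--}:=x^{-(2)}$. Let $a\in\hat{\mathbb{C}}$. A meromorphic $f$ has a Wilson $a$-sequence starting at $x_0\in\mathbb{C}$, namely $\{x_0^{+(2p)}\}_{p=0}^\infty$, if for every integer $p\ge0$, $f$ has an $a$-point of multiplicity $m_p>0$ at $x_0^{+(2p)}$, where (1) $0<m_0\le m_1\le m_2\le\cdots$; and (2) in case $x_0^{--}\ne x_0$ (i.e. $x_0\notin[-\frac14,0]$),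 either $f(x_0^{--})\ne a$, or $f(x_0^{--})=a$ with multiplicity $m_{-1}>m_0$. (An $\infty$-point is a pole.) The value $a$ is a Wilson exceptional value of $f$ if all but at most finitely many $a$-points of $f$ are in its Wilson $a$-sequences. The order of $f$ is $\limsup_{r\to\infty}\frac{\ln^+T(r,f)}{\ln r}$, with $T$ the Nevanlinna characteristic. *)

theory Defs
  imports "HOL-Complex_Analysis.Complex_Analysis"
begin

text \<open>
  Meromorphic functions on the plane are functions \<open>f\<close> with \<open>f nicely_meromorphic_on UNIV\<close>:
  removable singularities are removed, and the (irrelevant) value of \<open>f\<close> at a pole is \<open>0\<close>.
\<close>

datatype riemann_sphere = Fin complex | Infty

subsection \<open>The Wilson operator\<close>

text \<open>
  The quotient is even in \<open>z\<close>, so the choice of \<open>csqrt\<close> is immaterial (see \<open>wilson_op_eq\<close>).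
  If \<open>f\<close> is meromorphic, then so is \<open>wilson_quot f\<close>, but the quotient of values is meaningless at
  \<open>x = 0\<close> and where \<open>f\<close> has a pole at one of the two points; \<open>remove_sings\<close> takes the limit there,
  with value \<open>0\<close> at genuine poles of the result.
\<close>

definition wilson_quot :: "(complex \<Rightarrow> complex) \<Rightarrow> complex \<Rightarrow> complex" where
  "wilson_quot f x = (let z = csqrt x in
     (f ((z + \<i>/2)^2) - f ((z - \<i>/2)^2)) / (2 * \<i> * z))"

definition wilson_op :: "(complex \<Rightarrow> complex) \<Rightarrow> complex \<Rightarrow> complex" where
  "wilson_op f = remove_sings (wilson_quot f)"

definition wilson_kernel :: "(complex \<Rightarrow> complex) set" where
  "wilson_kernel = {f. f nicely_meromorphic_on UNIV \<and> (\<forall>x. wilson_op f x = 0)}"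

lemma wilson_quot_eq:
  assumes "z^2 = x"
  shows   "wilson_quot f x = (f ((z + \<i>/2)^2) - f ((z - \<i>/2)^2)) / (2 * \<i> * z)"
proof -
  have "(csqrt x)^2 = z^2" using assms by simp
  then have "csqrt x = z \<or> csqrt x = -z" by (metis power2_eq_iff)
  moreover have "(- z + \<i>/2)^2 = (z - \<i>/2)^2" "(- z - \<i>/2)^2 = (z + \<i>/2)^2"
    by (simp_all add: power2_eq_square algebra_simps)
  moreover have "(B - A) / (2 * \<i> * (-z)) = (A - B) / (2 * \<i> * z)" for A B
    by (metis minus_diff_eq minus_divide_divide mult_minus_right)
  ultimately show ?thesis
    unfolding wilson_quot_def Let_def by metis
qed

lemma wilson_op_eq:
  assumes "x \<noteq> 0" "z^2 = x" "f analytic_on {(z + \<i>/2)^2, (z - \<i>/2)^2}"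
  shows   "wilson_op f x = (f ((z + \<i>/2)^2) - f ((z - \<i>/2)^2)) / (2 * \<i> * z)"
proof -
  define h where "h = (\<lambda>z. (f ((z + \<i>/2)^2) - f ((z - \<i>/2)^2)) / (2 * \<i> * z))"
  define r where "r = (\<lambda>w. z * csqrt (w / x))"
  have z: "z \<noteq> 0" using assms by auto
  have r2: "(r w)^2 = w" for w
    using assms by (simp add: r_def power_mult_distrib)
  have rx: "r x = z" using assms by (simp add: r_def)
  have contf: "isCont f ((z + \<i>/2)^2)" "isCont f ((z - \<i>/2)^2)"
    using assms(3) analytic_on_subset analytic_at_imp_isCont by blast+
  have "isCont (\<lambda>z. f ((z + \<i>/2)^2)) z"
    by (rule isCont_o2[where g = f]) (intro continuous_intros contf)+
  moreover have "isCont (\<lambda>z. f ((z - \<i>/2)^2)) z"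
    by (rule isCont_o2[where g = f]) (intro continuous_intros contf)+
  ultimately have "isCont h z"
    unfolding h_def using z by (intro continuous_intros) auto
  moreover have "isCont r x"
  proof -
    have "isCont csqrt (x / x)"
      using assms(1) by (intro continuous_at_csqrt) auto
    then have "isCont (\<lambda>w. csqrt (w / x)) x"
      by (rule isCont_o2[where g = csqrt, rotated]) (use assms(1) in \<open>intro continuous_intros, auto\<close>)
    then show ?thesis unfolding r_def by (intro continuous_intros)
  qed
  ultimately have "isCont (\<lambda>w. h (r w)) x"
    unfolding rx[symmetric] by (rule isCont_o2[rotated])
  moreover have "wilson_quot f = (\<lambda>w. h (r w))"
    using wilson_quot_eq[OF r2] by (auto simp: h_def)
  ultimately have "wilson_quot f \<midarrow>x\<rightarrow> h z"
    using rx by (simp add: isCont_def)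
  then show ?thesis
    unfolding wilson_op_def h_def by (rule remove_sings_eqI)
qed

lemma wilson_op_0:
  assumes "f analytic_on {-1/4}"
  shows   "wilson_quot f \<midarrow>0\<rightarrow> wilson_op f 0"
proof -
  define g where "g = (\<lambda>z. f ((z + \<i>/2)^2))"
  have sq: "(\<i>/2)^2 = (-1/4 :: complex)" by (simp add: power2_eq_square)
  have "f field_differentiable at ((\<i>/2)^2)"
    using assms analytic_on_imp_differentiable_at unfolding sq by blast
  then obtain D where D: "(f has_field_derivative D) (at ((0 + \<i>/2)^2))"
    by (auto simp: field_differentiable_def)
  have "(g has_field_derivative D * \<i>) (at 0)"
    unfolding g_def by (rule DERIV_chain2[where f = f and g = "\<lambda>z. (z + \<i>/2)^2" and x = 0, OF D]) (auto intro!: derivative_eq_intros)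
  then have 1: "((\<lambda>z. (g z - g 0) / z) \<longlongrightarrow> D * \<i>) (at 0)"
    by (simp add: has_field_derivative_iff)
  have "filterlim uminus (at (0::complex)) (at 0)"
    by (rule filterlim_atI) (auto intro!: tendsto_eq_intros simp: eventually_at_filter)
  from filterlim_compose[OF 1 this]
  have 2: "((\<lambda>z. (g (-z) - g 0) / (-z)) \<longlongrightarrow> D * \<i>) (at 0)" .
  have "((\<lambda>z. ((g z - g 0) / z + (g (-z) - g 0) / (-z)) / (2 * \<i>))
          \<longlongrightarrow> (D * \<i> + D * \<i>) / (2 * \<i>)) (at 0)"
    by (intro tendsto_intros 1 2) auto
  moreover have "filterlim csqrt (at 0) (at 0)"
  proof (rule filterlim_atI)
    have "((\<lambda>x::complex. sqrt (norm x)) \<longlongrightarrow> sqrt (norm (0::complex))) (at 0)"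
      by (intro tendsto_real_sqrt tendsto_norm tendsto_ident_at)
    then have "((\<lambda>x. norm (csqrt x)) \<longlongrightarrow> 0) (at 0)"
      by (simp add: norm_csqrt)
    then show "(csqrt \<longlongrightarrow> 0) (at 0)"
      by (rule tendsto_norm_zero_cancel)
  qed (auto simp: eventually_at_filter)
  ultimately have L: "((\<lambda>x. ((g (csqrt x) - g 0) / csqrt x + (g (- csqrt x) - g 0) / (- csqrt x)) / (2 * \<i>))
          \<longlongrightarrow> (D * \<i> + D * \<i>) / (2 * \<i>)) (at 0)"
    by (rule filterlim_compose)
  have m: "(- w + \<i>/2)^2 = (w - \<i>/2)^2" for w
    by (simp add: power2_eq_square algebra_simps)
  have "wilson_quot f \<midarrow>0\<rightarrow> (D * \<i> + D * \<i>) / (2 * \<i>)"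
  proof (rule Lim_transform_eventually[OF L])
    show "\<forall>\<^sub>F x in at 0. ((g (csqrt x) - g 0) / csqrt x
            + (g (- csqrt x) - g 0) / (- csqrt x)) / (2 * \<i>) = wilson_quot f x"
      unfolding eventually_at_filter
    proof (intro always_eventually allI impI)
      fix x :: complex assume "x \<noteq> 0"
      then have "csqrt x \<noteq> 0" by simp
      then show "((g (csqrt x) - g 0) / csqrt x
            + (g (- csqrt x) - g 0) / (- csqrt x)) / (2 * \<i>) = wilson_quot f x"
        unfolding wilson_quot_def Let_def g_def m by (simp add: field_simps)
    qed
  qed
  then show ?thesis
    unfolding wilson_op_def by (metis remove_sings_eqI)
qed

subsection \<open>Points where a value is taken\<close>

fun a_point :: "(complex \<Rightarrow> complex) \<Rightarrow> riemann_sphere \<Rightarrow> complex \<Rightarrow> bool" where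
  "a_point f (Fin c) x \<longleftrightarrow> \<not> is_pole f x \<and> f x = c"
| "a_point f Infty x \<longleftrightarrow> is_pole f x"

text \<open>Only meaningful at points satisfying \<open>a_point f a\<close>, for \<open>f\<close> not identically equal to \<open>a\<close>.\<close>

fun a_mult :: "(complex \<Rightarrow> complex) \<Rightarrow> riemann_sphere \<Rightarrow> complex \<Rightarrow> nat" where
  "a_mult f (Fin c) x = nat (zorder (\<lambda>w. f w - c) x)"
| "a_mult f Infty x = nat (- zorder f x)"

subsection \<open>Wilson exceptional values\<close>

text \<open>
  Either half-plane is allowed as the range of the branch off the cut; \<open>csqrt\<close> is the branch
  for the right half-plane.
\<close>

definition wilson_branch :: "(complex \<Rightarrow> complex) \<Rightarrow> bool" where
  "wilson_branch s \<longleftrightarrow>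
     (\<forall>x. (s x)^2 = x) \<and>
     ((\<forall>x. x \<notin> \<real>\<^sub>\<le>\<^sub>0 \<longrightarrow> Re (s x) > 0) \<or> (\<forall>x. x \<notin> \<real>\<^sub>\<le>\<^sub>0 \<longrightarrow> Re (s x) < 0)) \<and>
     (\<forall>t::real. t \<ge> 0 \<longrightarrow> s (- of_real (t^2)) = \<i> * of_real t)"

lemma wilson_branch_csqrt: "wilson_branch csqrt"
proof -
  have "csqrt (- of_real (t^2)) = \<i> * of_real t" if "t \<ge> 0" for t :: real
    using that by (intro csqrt_unique) (auto simp: power_mult_distrib)
  moreover have "Re (csqrt x) > 0" if "x \<notin> \<real>\<^sub>\<le>\<^sub>0" for x
  proof (rule ccontr)
    assume "\<not> Re (csqrt x) > 0"
    then have "Re (csqrt x) = 0" using Re_csqrt[of x] by linarith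
    then have "Re ((csqrt x)^2) \<le> 0" "Im ((csqrt x)^2) = 0"
      by (simp_all only: Re_power2 Im_power2) auto
    then show False using that by (simp add: complex_nonpos_Reals_iff)
  qed
  ultimately show ?thesis by (simp add: wilson_branch_def)
qed

definition wplus :: "(complex \<Rightarrow> complex) \<Rightarrow> complex \<Rightarrow> complex" where
  "wplus s x = (s x + \<i>/2)^2"

definition wminus :: "(complex \<Rightarrow> complex) \<Rightarrow> complex \<Rightarrow> complex" where
  "wminus s x = (s x - \<i>/2)^2"

definition wilson_sequence ::
    "(complex \<Rightarrow> complex) \<Rightarrow> (complex \<Rightarrow> complex) \<Rightarrow> riemann_sphere \<Rightarrow> complex \<Rightarrow> bool" where
  "wilson_sequence s f a x0 \<longleftrightarrow>
     (\<exists>m :: nat \<Rightarrow> nat.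
        (\<forall>p. a_point f a ((wplus s ^^ (2*p)) x0) \<and> a_mult f a ((wplus s ^^ (2*p)) x0) = m p) \<and>
        0 < m 0 \<and> (\<forall>p. m p \<le> m (Suc p)) \<and>
        ((wminus s ^^ 2) x0 \<noteq> x0 \<longrightarrow>
           \<not> a_point f a ((wminus s ^^ 2) x0) \<or>
           a_point f a ((wminus s ^^ 2) x0) \<and> a_mult f a ((wminus s ^^ 2) x0) > m 0))"

definition wilson_exceptional ::
    "(complex \<Rightarrow> complex) \<Rightarrow> (complex \<Rightarrow> complex) \<Rightarrow> riemann_sphere \<Rightarrow> bool" where
  "wilson_exceptional s f a \<longleftrightarrow>
     finite {x. a_point f a x \<and> \<not> (\<exists>x0 p. wilson_sequence s f a x0 \<and> x = (wplus s ^^ (2*p)) x0)}"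

subsection \<open>Nevanlinna characteristic and order\<close>

definition ln_plus :: "real \<Rightarrow> real" where
  "ln_plus x = ln (max 1 x)"

definition proximity :: "(complex \<Rightarrow> complex) \<Rightarrow> real \<Rightarrow> real" where
  "proximity f r =
     1 / (2 * pi) * integral {0..2*pi} (\<lambda>\<theta>. ln_plus (norm (f (of_real r * cis \<theta>))))"

definition pole_count :: "(complex \<Rightarrow> complex) \<Rightarrow> real \<Rightarrow> nat" where
  "pole_count f t = (\<Sum>x | norm x \<le> t \<and> a_point f Infty x. a_mult f Infty x)"

definition pole_counting :: "(complex \<Rightarrow> complex) \<Rightarrow> real \<Rightarrow> real" where
  "pole_counting f r =
     integral {0..r} (\<lambda>t. (real (pole_count f t) - real (pole_count f 0)) / t)
     + real (pole_count f 0) * ln r"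

definition nevanlinna_char :: "(complex \<Rightarrow> complex) \<Rightarrow> real \<Rightarrow> real" where
  "nevanlinna_char f r = proximity f r + pole_counting f r"

definition nevanlinna_order :: "(complex \<Rightarrow> complex) \<Rightarrow> ereal" where
  "nevanlinna_order f = Limsup at_top (\<lambda>r. ereal (ln_plus (nevanlinna_char f r) / ln r))"

subsection \<open>Rational functions\<close>

definition rational_function :: "(complex \<Rightarrow> complex) \<Rightarrow> bool" where
  "rational_function f \<longleftrightarrow>
     (\<exists>p q :: complex poly. q \<noteq> 0 \<and> (\<forall>x. poly q x \<noteq> 0 \<longrightarrow> f x = poly p x / poly q x))"

end

theory Submission
  imports Defs
begin

text \<open>
  Put \<open>g z = f (z\<^sup>2)\<close>. The Wilson operator becomes the difference
  \<open>D z = g (z + \<i>/2) - g (z - \<i>/2)\<close>, and a Wilson sequence becomes an arithmetic progression with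
  step \<open>\<i>\<close> along which the multiplicities do not decrease. If \<open>D\<close> does not vanish identically, it
  has a zero of order at least the smaller of the two multiplicities wherever both \<open>z \<plusminus> \<i>/2\<close> are
  points of the same finite exceptional value, so up to small errors the zeros of \<open>D\<close> count all these
  points; similarly a pole of \<open>D\<close> costs at most the larger of two multiplicities of poles.
  Jensen's formula together with the estimate of the logarithmic difference
  \<open>(g (z \<plusminus> \<i>/2) - a) / (g z - a)\<close> then gives, as in the second main theorem,
  \<open>T(r) \<le> o(T(r)) + O(ln r)\<close>. For finite order the error term is controlled along a sequence of radii
  on which \<open>T\<close> grows at most geometrically, so \<open>T(r) = O(ln r)\<close> for arbitrarily large \<open>r\<close>, and \<open>f\<close>
  is rational.
\<close>

subsection \<open>Circle means\<close>

text \<open>The difficulty is that the multiplicities at z + i/2 and z - i/2 differ. Their sum is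
  maximum plus minimum; the minimum is what the order of D sees, while the maxima must be charged
  only once to the counting function. This is the purpose of \<open>displaced\<close>: the maximum
  is dominated by the multiplicity at an injectively chosen neighbour of z. Upward sequences on one
  half-plane and downward ones on the other have to be combined without a collision. Infinity is not
  symmetric to the finite values, because D inherits poles from both neighbours. With q finite
  values the balance tolerates q - 1 copies of the poles. Three finite values leave room for both
  neighbours; if infinity is one of the three values, q = 2 and the poles must be displaced too.
  Circles through zeros or poles are avoided by choosing radii outside a countable set, so the
  functions whose means are compared are continuous on their circles. Every error then takes the
  form of a characteristic at a somewhat larger radius divided by ln r.\<close>

definition cmean :: "(complex \<Rightarrow> real) \<Rightarrow> real \<Rightarrow> real" where
  "cmean \<phi> r = 1 / (2*pi) * integral {0..2*pi} (\<lambda>\<theta>. \<phi> (of_real r * cis \<theta>))"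

definition circ_int :: "(complex \<Rightarrow> real) \<Rightarrow> real \<Rightarrow> bool" where
  "circ_int \<phi> r \<longleftrightarrow> (\<lambda>\<theta>. \<phi> (of_real r * cis \<theta>)) integrable_on {0..2*pi}"

lemma circ_int_continuous:
  assumes "continuous_on (sphere 0 r) \<phi>" "r \<ge> 0"
  shows "circ_int \<phi> r"
  unfolding circ_int_def
proof (rule integrable_continuous_real)
  show "continuous_on {0..2*pi} (\<lambda>\<theta>. \<phi> (of_real r * cis \<theta>))"
    by (rule continuous_on_compose2[OF assms(1)])
       (use assms(2) in \<open>auto intro!: continuous_intros simp: norm_mult\<close>)
qed

lemma circ_int_add: "circ_int \<phi> r \<Longrightarrow> circ_int \<psi> r \<Longrightarrow> circ_int (\<lambda>z. \<phi> z + \<psi> z) r"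
  unfolding circ_int_def by (rule integrable_add)

lemma circ_int_diff: "circ_int \<phi> r \<Longrightarrow> circ_int \<psi> r \<Longrightarrow> circ_int (\<lambda>z. \<phi> z - \<psi> z) r"
  unfolding circ_int_def by (rule integrable_diff)

lemma circ_int_cmult: "circ_int \<phi> r \<Longrightarrow> circ_int (\<lambda>z. c * \<phi> z) r"
  unfolding circ_int_def using integrable_cmul[where c = c] by fastforce

lemma circ_int_const: "circ_int (\<lambda>z. c) r"
  unfolding circ_int_def by (simp add: integrable_const_ivl)

lemma circ_int_sum: "finite S \<Longrightarrow> (\<And>a. a \<in> S \<Longrightarrow> circ_int (\<phi> a) r) \<Longrightarrow> circ_int (\<lambda>z. \<Sum>a\<in>S. \<phi> a z) r"
  unfolding circ_int_def by (rule integrable_sum)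

lemmas circ_int_intros = circ_int_add circ_int_diff circ_int_cmult circ_int_const circ_int_sum

lemma cmean_add:
  "circ_int \<phi> r \<Longrightarrow> circ_int \<psi> r \<Longrightarrow> cmean (\<lambda>z. \<phi> z + \<psi> z) r = cmean \<phi> r + cmean \<psi> r"
  unfolding circ_int_def cmean_def by (simp add: integral_add algebra_simps add_divide_distrib)

lemma cmean_diff:
  "circ_int \<phi> r \<Longrightarrow> circ_int \<psi> r \<Longrightarrow> cmean (\<lambda>z. \<phi> z - \<psi> z) r = cmean \<phi> r - cmean \<psi> r"
  unfolding circ_int_def cmean_def by (simp add: integral_diff algebra_simps diff_divide_distrib)

lemma cmean_cmult: "cmean (\<lambda>z. c * \<phi> z) r = c * cmean \<phi> r"
  unfolding cmean_def by simp

lemma cmean_const: "cmean (\<lambda>z. c) r = c"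
  unfolding cmean_def by simp

lemma cmean_sum:
  "finite S \<Longrightarrow> (\<And>a. a \<in> S \<Longrightarrow> circ_int (\<phi> a) r) \<Longrightarrow> cmean (\<lambda>z. \<Sum>a\<in>S. \<phi> a z) r = (\<Sum>a\<in>S. cmean (\<phi> a) r)"
  unfolding circ_int_def cmean_def by (simp add: integral_sum sum_distrib_left sum_divide_distrib)

lemma cmean_mono:
  assumes "circ_int \<phi> r" "circ_int \<psi> r" "\<And>z. norm z = r \<Longrightarrow> \<phi> z \<le> \<psi> z" "r \<ge> 0"
  shows "cmean \<phi> r \<le> cmean \<psi> r"
proof -
  have "integral {0..2*pi} (\<lambda>\<theta>. \<phi> (of_real r * cis \<theta>)) \<le> integral {0..2*pi} (\<lambda>\<theta>. \<psi> (of_real r * cis \<theta>))"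
    by (rule integral_le) (use assms in \<open>auto simp: circ_int_def norm_mult\<close>)
  then show ?thesis unfolding cmean_def by (simp add: divide_right_mono)
qed

lemma cmean_cong: "(\<And>z. norm z = r \<Longrightarrow> \<phi> z = \<psi> z) \<Longrightarrow> r \<ge> 0 \<Longrightarrow> cmean \<phi> r = cmean \<psi> r"
  unfolding cmean_def by (simp add: norm_mult)

lemma cmean_nonneg:
  assumes "\<And>z. norm z = r \<Longrightarrow> 0 \<le> \<phi> z" "r \<ge> 0"
  shows "0 \<le> cmean \<phi> r"
proof (cases "circ_int \<phi> r")
  case True
  then have "0 \<le> integral {0..2*pi} (\<lambda>\<theta>. \<phi> (of_real r * cis \<theta>))"
    by (intro integral_nonneg) (use assms in \<open>auto simp: circ_int_def norm_mult\<close>)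
  then show ?thesis by (simp add: cmean_def)
next
  \<comment> \<open>The integral of a function that is not integrable is 0 by convention.\<close>
  case False
  then show ?thesis by (simp add: cmean_def circ_int_def not_integrable_integral)
qed

section \<open>Cauchy's formula and mean values on circles about 0\<close>

lemma circle_integral_holomorphic:
  fixes h :: "complex \<Rightarrow> complex" and z :: complex
  assumes "h holomorphic_on ball 0 R0" "0 < R" "R < R0" "norm z < R"
  shows "((\<lambda>\<theta>. h (of_real R * cis \<theta>) * (of_real R * cis \<theta>) / (of_real R * cis \<theta> - z)^2)
            has_integral (2 * pi * deriv h z)) {0..2*pi}"
proof -
  have "continuous_on (cball 0 R) h" "h holomorphic_on ball 0 R"
    using assms by (auto intro: holomorphic_on_subset intro!: holomorphic_on_imp_continuous_on)
  then have "((\<lambda>u. h u / (u - z) ^ Suc 1) has_contour_integral ((2*pi*\<i>) / fact 1 * (deriv ^^ 1) h z)) (circlepath 0 R)"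
    by (rule Cauchy_has_contour_integral_higher_derivative_circlepath) (use assms in auto)
  then have "((\<lambda>t. h (of_real R * cis t) / (of_real R * cis t - z)^2 * R * \<i> * cis t) has_integral (2*pi*\<i> * deriv h z)) {0..2*pi}"
    unfolding circlepath_def
    by (subst (asm) has_contour_integral_part_circlepath_iff) (auto simp: power2_eq_square)
  \<comment> \<open>Multiplication by -i removes the i of du = i u dt and leaves an integral over
    the angle.\<close>
  then have "((\<lambda>t. (-\<i>) * (h (of_real R * cis t) / (of_real R * cis t - z)^2 * R * \<i> * cis t)) has_integral (-\<i> * (2*pi*\<i> * deriv h z))) {0..2*pi}"
    by (rule has_integral_mult_right)
  then show ?thesis by (simp add: mult_ac)
qed

lemma circle_mean_value:
  fixes h :: "complex \<Rightarrow> complex"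
  assumes "h holomorphic_on ball 0 R0" "0 < R" "R < R0"
  shows "((\<lambda>\<theta>. h (of_real R * cis \<theta>)) has_integral (2 * pi * h 0)) {0..2*pi}"
proof -
  have "continuous_on (cball 0 R) h" "h holomorphic_on ball 0 R"
    using assms by (auto intro: holomorphic_on_subset intro!: holomorphic_on_imp_continuous_on)
  then have "((\<lambda>u. h u / (u - 0)) has_contour_integral (2*pi*\<i> * h 0)) (circlepath 0 R)"
    using Cauchy_integral_circlepath[of 0 R h 0] assms by simp
  then have "((\<lambda>t. h (of_real R * cis t) / (of_real R * cis t) * R * \<i> * cis t) has_integral (2*pi*\<i> * h 0)) {0..2*pi}"
    unfolding circlepath_def
    by (subst (asm) has_contour_integral_part_circlepath_iff) (auto simp: power2_eq_square)
  then have "((\<lambda>t. (-\<i>) * (h (of_real R * cis t) / (of_real R * cis t) * R * \<i> * cis t)) has_integral (-\<i> * (2*pi*\<i> * h 0))) {0..2*pi}"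
    by (rule has_integral_mult_right)
  moreover have "(-\<i>) * (h (of_real R * cis t) / (of_real R * cis t) * R * \<i> * cis t) = h (of_real R * cis t)" for t
    using assms(2) by (simp add: field_simps)
  ultimately have "((\<lambda>t. h (of_real R * cis t)) has_integral (-\<i> * (2*pi*\<i> * h 0))) {0..2*pi}"
    by (simp only:)
  then show ?thesis by (simp add: algebra_simps)
qed

lemma cmean_Re_holomorphic:
  fixes h :: "complex \<Rightarrow> complex"
  assumes "h holomorphic_on ball 0 R0" "0 < R" "R < R0"
  shows "cmean (\<lambda>z. Re (h z)) R = Re (h 0)"
proof -
  have "((\<lambda>\<theta>. Re (h (of_real R * cis \<theta>))) has_integral Re (2 * pi * h 0)) {0..2*pi}"
    by (rule has_integral_Re[OF circle_mean_value[OF assms]])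
  then have "integral {0..2*pi} (\<lambda>\<theta>. Re (h (of_real R * cis \<theta>))) = 2*pi*Re (h 0)"
    by (simp add: integral_unique)
  then show ?thesis unfolding cmean_def by simp
qed

text \<open>
  Cauchy's formula for the derivative involves all of \<open>h\<close>; on the circle the conjugate of the
  Cauchy kernel is holomorphic inside, so \<open>h\<close> may be replaced by twice its real part.
\<close>

lemma norm_deriv_le_cmean_Re:
  fixes h :: "complex \<Rightarrow> complex" and z :: complex
  assumes "h holomorphic_on ball 0 R0" "0 < R" "R < R0" "norm z < R"
  shows "norm (deriv h z) \<le> 2 * R / (R - norm z)^2 * cmean (\<lambda>z. \<bar>Re (h z)\<bar>) R"
proof -
  define u where "u = (\<lambda>\<theta>. of_real R * cis \<theta>)"
  define K where "K = (\<lambda>\<theta>. u \<theta> / (u \<theta> - z)^2)"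
  have nu: "norm (u \<theta>) = R" for \<theta> using assms by (simp add: u_def norm_mult)
  have 1: "((\<lambda>\<theta>. h (u \<theta>) * K \<theta>) has_integral (2*pi*deriv h z)) {0..2*pi}"
    using circle_integral_holomorphic[OF assms] by (simp add: u_def K_def)
  \<comment> \<open>On the circle cnj u = R^2 / u, so the conjugate of \<open>K\<close> equals w R^2
    / (R^2 - cnj z w)^2 there. Its only singularity has norm R^2 / norm z > R, and for z = 0 there
    is none; below \<open>R1\<close> it stays holomorphic.\<close>
  define R1 where "R1 = (if z = 0 then R0 else min R0 (R^2 / norm z))"
  have R1: "R < R1" "R1 \<le> R0"
    using assms by (auto simp: R1_def field_simps power2_eq_square)
  define k where "k = (\<lambda>w::complex. h w * (w * R^2 / (R^2 - cnj z * w)^2))"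
  have nz: "of_real (R^2) - cnj z * w \<noteq> 0" if "norm w < R1" for w :: complex
  proof
    assume "of_real (R^2) - cnj z * w = 0"
    then have "norm (cnj z * w) = norm (of_real (R^2) :: complex)" by simp
    then have "norm z * norm w = R^2" by (simp only: norm_mult norm_of_real complex_mod_cnj) simp
    then show False using that assms
      by (auto simp: R1_def field_simps split: if_splits)
  qed
  have "k holomorphic_on ball 0 R1"
    unfolding k_def using nz R1 by (intro holomorphic_intros holomorphic_on_subset[OF assms(1)]) auto
  then have "((\<lambda>\<theta>. k (u \<theta>)) has_integral (2 * pi * k 0)) {0..2*pi}"
    unfolding u_def by (rule circle_mean_value) (use assms R1 in auto)
  \<comment> \<open>The mean vanishes because the factor w gives k 0 = 0.\<close>
  then have "((\<lambda>\<theta>. cnj (k (u \<theta>))) has_integral 0) {0..2*pi}"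
    using has_integral_cnj[of "\<lambda>\<theta>. k (u \<theta>)" 0] by (simp add: k_def o_def)
  moreover have "cnj (k (u \<theta>)) = cnj (h (u \<theta>)) * K \<theta>" for \<theta>
  proof -
    have uu: "u \<theta> * cnj (u \<theta>) = R^2" using nu[of \<theta>] by (simp add: complex_norm_square[symmetric])
    have "u \<theta> \<noteq> 0" "u \<theta> \<noteq> z" using nu[of \<theta>] assms by auto
    moreover have "of_real (R^2) - z * cnj (u \<theta>) \<noteq> 0"
      using nz[of "u \<theta>"] nu[of \<theta>] R1 by (metis complex_cnj_cnj complex_cnj_complex_of_real complex_cnj_diff complex_cnj_mult complex_cnj_zero)
    moreover have "of_real (R^2) - z * cnj (u \<theta>) = cnj (u \<theta>) * (u \<theta> - z)"
      using uu by (simp add: algebra_simps)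
    ultimately have nz': "cnj (u \<theta>) \<noteq> 0" "u \<theta> - z \<noteq> 0" 
      and eq: "(of_real R)^2 - z * cnj (u \<theta>) = cnj (u \<theta>) * (u \<theta> - z)" by auto
    have "cnj (u \<theta>) * (of_real R)^2 / ((of_real R)^2 - z * cnj (u \<theta>))^2
            = cnj (u \<theta>) * (u \<theta> * cnj (u \<theta>)) / (cnj (u \<theta>) * (u \<theta> - z))^2"
      by (simp only: eq uu of_real_power)
    also have "\<dots> = K \<theta>" using nz' unfolding K_def
      by (simp add: power_mult_distrib) (simp add: power2_eq_square)
    finally have "cnj (u \<theta>) * (of_real R)^2 / ((of_real R)^2 - z * cnj (u \<theta>))^2 = K \<theta>" .
    moreover have "cnj (k (u \<theta>)) = cnj (h (u \<theta>)) * (cnj (u \<theta>) * (of_real R)^2 / ((of_real R)^2 - z * cnj (u \<theta>))^2)"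
      by (simp add: k_def)
    ultimately show ?thesis by (simp only:)
  qed
  ultimately have "((\<lambda>\<theta>. cnj (h (u \<theta>)) * K \<theta>) has_integral 0) {0..2*pi}" by simp
  from has_integral_add[OF 1 this]
  have 2: "((\<lambda>\<theta>. (h (u \<theta>) + cnj (h (u \<theta>))) * K \<theta>) has_integral (2*pi*deriv h z)) {0..2*pi}"
    by (simp add: algebra_simps)
  then have int: "integral {0..2*pi} (\<lambda>\<theta>. (h (u \<theta>) + cnj (h (u \<theta>))) * K \<theta>) = 2*pi*deriv h z"
    by (rule integral_unique)
  define B where "B = 2 * R / (R - norm z)^2"
  have "continuous_on (sphere 0 R) (\<lambda>z. \<bar>Re (h z)\<bar>)"
    using assms by (intro continuous_intros holomorphic_on_imp_continuous_on[OF holomorphic_on_subset[OF assms(1)]]) auto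
  then have "circ_int (\<lambda>z. \<bar>Re (h z)\<bar>) R" using assms by (intro circ_int_continuous) auto
  then have ci: "(\<lambda>\<theta>. B * \<bar>Re (h (u \<theta>))\<bar>) integrable_on {0..2*pi}"
    using circ_int_cmult by (auto simp: circ_int_def u_def)
  have nK: "norm (K \<theta>) \<le> R / (R - norm z)^2" for \<theta>
  proof -
    have "R - norm z \<le> norm (u \<theta> - z)" using norm_triangle_ineq2[of "u \<theta>" z] nu by simp
    then have "(R - norm z)^2 \<le> norm (u \<theta> - z)^2" using assms by (intro power_mono) auto
    then show ?thesis unfolding K_def using assms
      by (simp add: norm_divide norm_power nu frac_le)
  qed
  have "norm (2*pi*deriv h z) \<le> integral {0..2*pi} (\<lambda>\<theta>. B * \<bar>Re (h (u \<theta>))\<bar>)"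
    unfolding int[symmetric]
  proof (rule integral_norm_bound_integral)
    show "(\<lambda>\<theta>. (h (u \<theta>) + cnj (h (u \<theta>))) * K \<theta>) integrable_on {0..2*pi}" using 2 by blast
    fix \<theta> :: real
    have "norm ((h (u \<theta>) + cnj (h (u \<theta>))) * K \<theta>) = 2 * \<bar>Re (h (u \<theta>))\<bar> * norm (K \<theta>)"
      by (simp add: norm_mult complex_add_cnj)
    also have "\<dots> \<le> 2 * \<bar>Re (h (u \<theta>))\<bar> * (R / (R - norm z)^2)" by (intro mult_left_mono nK) auto
    finally show "norm ((h (u \<theta>) + cnj (h (u \<theta>))) * K \<theta>) \<le> B * \<bar>Re (h (u \<theta>))\<bar>" by (simp add: B_def mult_ac)
  qed (rule ci)
  also have "\<dots> = 2*pi * (B * cmean (\<lambda>z. \<bar>Re (h z)\<bar>) R)"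
    unfolding cmean_def u_def by simp
  finally have "norm (deriv h z) \<le> B * cmean (\<lambda>z. \<bar>Re (h z)\<bar>) R" by (simp add: norm_mult)
  then show ?thesis by (simp add: B_def)
qed

section \<open>Circle means of the logarithm of a linear factor\<close>

lemma cmean_ln_norm_one_minus:
  assumes "norm c * R < 1" "R > 0"
  shows "cmean (\<lambda>z. ln (norm (1 - c * z))) R = 0"
proof -
  define R0 where "R0 = (if c = 0 then R + 1 else 1 / norm c)"
  have R0: "R < R0" using assms by (auto simp: R0_def field_simps)
  have lt: "norm (c * z) < 1" if "z \<in> ball 0 R0" for z
    using that by (auto simp: R0_def norm_mult field_simps split: if_splits)
  \<comment> \<open>A positive real part keeps 1 - c z in the domain of the principal logarithm,
    whose value at z = 0 is 0.\<close>
  have "Re (1 - c * z) > 0" if "z \<in> ball 0 R0" for z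
    using lt[OF that] abs_Re_le_cmod[of "c * z"] by simp
  then have "(\<lambda>z. Ln (1 - c * z)) holomorphic_on ball 0 R0"
    by (intro holomorphic_intros) (fastforce simp: complex_nonpos_Reals_iff)
  from cmean_Re_holomorphic[OF this assms(2) R0] have "cmean (\<lambda>z. Re (Ln (1 - c * z))) R = 0" by simp
  moreover have "cmean (\<lambda>z. Re (Ln (1 - c * z))) R = cmean (\<lambda>z. ln (norm (1 - c * z))) R"
  proof (rule cmean_cong)
    fix z :: complex assume "norm z = R"
    then have "norm (c * z) < 1" using assms by (simp add: norm_mult)
    then have "1 - c * z \<noteq> 0" by auto
    then show "Re (Ln (1 - c * z)) = ln (norm (1 - c * z))" by simp
  qed (use assms in auto)
  ultimately show ?thesis by simp
qed

lemma circ_int_ln_norm: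
  assumes "norm a \<noteq> r" "r \<ge> 0"
  shows "circ_int (\<lambda>z. ln (norm (z - a))) r"
  using assms by (intro circ_int_continuous continuous_intros) auto

text \<open>Jensen's formula for one linear factor. If a lies outside the circle, -a is factored
  out. If it lies inside, a is reflected in the circle: for norm z = r one has norm (z - a) = r norm
  (1 - cnj a z / r^2), and the new factor has no zero in the disc.\<close>

lemma cmean_ln_norm:
  assumes "norm a \<noteq> r" "r > 0"
  shows "cmean (\<lambda>z. ln (norm (z - a))) r = ln (max r (norm a))"
proof (cases "norm a < r")
  case True
  have 0: "norm (cnj a / r^2) * r < 1" using True assms
    by (simp add: norm_divide norm_power norm_mult power2_eq_square)
  have c: "circ_int (\<lambda>z. ln (norm (1 - cnj a / r^2 * z))) r"
    using 0 assms
  proof (intro circ_int_continuous continuous_intros ballI)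
    fix z :: complex assume "z \<in> sphere 0 r"
    then have "norm (cnj a / r^2 * z) < 1" using 0 by (simp only: norm_mult mem_sphere_0)
    then show "norm (1 - cnj a / r^2 * z) \<noteq> 0" by auto
  qed auto
  have "cmean (\<lambda>z. ln (norm (z - a))) r = cmean (\<lambda>z. ln r + ln (norm (1 - cnj a / r^2 * z))) r"
  proof (rule cmean_cong)
    fix z :: complex assume z: "norm z = r"
    have "norm (cnj a / r^2 * z) < 1" using z 0 by (simp only: norm_mult)
    then have "1 - cnj a / r^2 * z \<noteq> 0" by auto
    moreover have "norm (z - a) = r * norm (1 - cnj a / r^2 * z)"
    proof -
      have "z * cnj z = r^2" using z by (simp add: complex_norm_square[symmetric])
      then have "cnj z * (z - a) = r^2 - a * cnj z" by (simp add: algebra_simps)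
      also have "\<dots> = r^2 * cnj (1 - cnj a / r^2 * z)" using assms by (simp add: field_simps)
      finally have "cnj z * (z - a) = r^2 * cnj (1 - cnj a / r^2 * z)" .
      then have "norm (cnj z * (z - a)) = norm (r^2 * cnj (1 - cnj a / r^2 * z))" by simp
      then have "r * norm (z - a) = r^2 * norm (1 - cnj a / r^2 * z)"
        by (simp only: norm_mult complex_mod_cnj z norm_power norm_of_real) simp
      then show ?thesis using assms by (simp add: power2_eq_square)
    qed
    ultimately show "ln (norm (z - a)) = ln r + ln (norm (1 - cnj a / r^2 * z))"
      using assms by (simp add: ln_mult)
  qed (use assms in auto)
  also have "\<dots> = cmean (\<lambda>z. ln r) r + cmean (\<lambda>z. ln (norm (1 - cnj a / r^2 * z))) r"
    by (rule cmean_add[OF circ_int_const c])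
  also have "\<dots> = ln r" unfolding cmean_ln_norm_one_minus[OF 0 assms(2)] cmean_const by simp
  finally show ?thesis using True by simp
next
  case False
  then have a: "norm a > r" "a \<noteq> 0" using assms by auto
  have 0: "norm (1 / a) * r < 1" using a assms by (simp add: norm_divide)
  have c: "circ_int (\<lambda>z. ln (norm (1 - 1 / a * z))) r"
    using a assms by (intro circ_int_continuous continuous_intros) auto
  have "cmean (\<lambda>z. ln (norm (z - a))) r = cmean (\<lambda>z. ln (norm a) + ln (norm (1 - 1 / a * z))) r"
  proof (rule cmean_cong)
    fix z :: complex assume z: "norm z = r"
    then have "z \<noteq> a" using a by auto
    then have "1 - 1 / a * z \<noteq> 0" using a by auto
    moreover have "z - a = (- a) * (1 - 1 / a * z)" using a by (simp add: field_simps)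
    then have "norm (z - a) = norm a * norm (1 - 1 / a * z)" by (metis norm_mult norm_minus_cancel)
    ultimately show "ln (norm (z - a)) = ln (norm a) + ln (norm (1 - 1 / a * z))"
      using a by (simp add: ln_mult)
  qed (use assms in auto)
  also have "\<dots> = cmean (\<lambda>z. ln (norm a)) r + cmean (\<lambda>z. ln (norm (1 - 1 / a * z))) r"
    by (rule cmean_add[OF circ_int_const c])
  also have "\<dots> = ln (norm a)" unfolding cmean_ln_norm_one_minus[OF 0 assms(2)] cmean_const by simp
  finally show ?thesis using a by simp
qed


section \<open>A bound for logarithmic singularities, uniform in their position\<close>

lemma has_integral_inv_sqrt_abs:
  assumes "A \<ge> 0"
  shows "((\<lambda>t. 1 / sqrt \<bar>t\<bar>) has_integral 4 * sqrt A) {-A..A}"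
proof -
  have 1: "((\<lambda>t. 1 / sqrt \<bar>t\<bar>) has_integral (2 * sqrt A - 2 * sqrt 0)) {0..A}"
  proof (rule fundamental_theorem_of_calculus_interior)
    fix x assume "x \<in> {0<..<A}"
    then have x: "x > 0" by simp
    then have "((\<lambda>t. 2 * sqrt t) has_real_derivative 1 / sqrt \<bar>x\<bar>) (at x)"
      by (auto intro!: derivative_eq_intros simp: field_simps)
    then show "((\<lambda>t. 2 * sqrt t) has_vector_derivative 1 / sqrt \<bar>x\<bar>) (at x)"
      by (simp add: has_real_derivative_iff_has_vector_derivative)
  qed (use assms in \<open>auto intro!: continuous_intros\<close>)
  then have "((\<lambda>t. 1 / sqrt \<bar>-t\<bar>) has_integral (2 * sqrt A - 2 * sqrt 0)) {-A..-0}"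
    by (subst has_integral_reflect_real)
  then have "((\<lambda>t. 1 / sqrt \<bar>t\<bar>) has_integral (2 * sqrt A)) {-A..0}" by simp
  from has_integral_combine[OF _ _ this 1] assms show ?thesis by simp
qed

lemma integral_inv_sqrt_abs_diff_le:
  assumes "\<bar>\<beta>\<bar> \<le> 4 * pi"
  shows "(\<lambda>t. 1 / sqrt \<bar>t - \<beta>\<bar>) integrable_on {0..2*pi}"
    and "integral {0..2*pi} (\<lambda>t. 1 / sqrt \<bar>t - \<beta>\<bar>) \<le> 4 * sqrt (6*pi)"
proof -
  \<comment> \<open>For t in [0, 2 pi] and |\<beta>| \<le> 4 pi the difference t - \<beta> lies in
    [-6 pi, 6 pi].\<close>
  define A where "A = 6 * pi"
  have "((\<lambda>t. 1 / sqrt \<bar>t\<bar>) has_integral 4 * sqrt A) (cbox (-A) A)"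
    using has_integral_inv_sqrt_abs[of A] by (simp add: A_def)
  from has_integral_affinity'[OF this, of 1 "-\<beta>"]
  have 1: "((\<lambda>t. 1 / sqrt \<bar>t - \<beta>\<bar>) has_integral 4 * sqrt A) {\<beta> - A..\<beta> + A}"
    by (simp add: algebra_simps)
  have sub: "{0..2*pi} \<subseteq> {\<beta> - A..\<beta> + A}" using assms by (auto simp: A_def)
  show 2: "(\<lambda>t. 1 / sqrt \<bar>t - \<beta>\<bar>) integrable_on {0..2*pi}"
    using integrable_on_subinterval[OF _ sub] 1 by blast
  show "integral {0..2*pi} (\<lambda>t. 1 / sqrt \<bar>t - \<beta>\<bar>) \<le> 4 * sqrt (6*pi)"
    using integral_subset_le[OF sub 2] 1 by (auto simp: A_def integral_unique has_integral_integrable)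
qed

lemma half_abs_le_abs_sin:
  assumes "\<bar>x\<bar> \<le> pi / 2"
  shows "\<bar>x\<bar> / 2 \<le> \<bar>sin x :: real\<bar>"
proof -
  have "\<bar>sin x - x\<bar> \<le> \<bar>x\<bar> ^ 3 / 6"
    using Maclaurin_sin_bound[of x 3] by (simp add: numeral_eq_Suc sin_coeff_def fact_numeral field_simps)
  \<comment> \<open>The cubic remainder |x|^3 / 6 is at most |x| / 2 once x^2 \<le> 3, and pi / 2
    \<le> 1.7 gives this.\<close>
  moreover have "\<bar>x\<bar>^2 \<le> 3"
  proof -
    have "\<bar>x\<bar> \<le> 1.7" using assms pi_less_4 pi_approx by simp
    then have "\<bar>x\<bar>^2 \<le> 1.7^2" by (intro power_mono) auto
    then show ?thesis by (simp add: power2_eq_square)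
  qed
  then have "\<bar>x\<bar> * \<bar>x\<bar>^2 \<le> \<bar>x\<bar> * 3" by (intro mult_left_mono) auto
  ultimately have "\<bar>sin x - x\<bar> \<le> \<bar>x\<bar> / 2" by (simp add: power3_eq_cube power2_eq_square mult_ac)
  then show ?thesis by linarith
qed

text \<open>The sine is comparable to the distance from its nearest zero k pi. For |x| \<le> 2 pi
  only five zeros can be nearest; summing over all of them removes the dependence of k on x.\<close>

lemma inv_sqrt_abs_sin_le:
  assumes "\<bar>x\<bar> \<le> 2 * pi"
  shows "1 / sqrt \<bar>sin x\<bar> \<le> (\<Sum>k\<in>{-2..2::int}. sqrt 2 * (1 / sqrt \<bar>x - k * pi\<bar>))"
proof -
  define k where "k = round (x / pi)"
  have 1: "\<bar>k - x / pi\<bar> \<le> 1/2" unfolding k_def by (rule of_int_round_abs_le)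
  have "\<bar>x / pi\<bar> \<le> 2" using assms by (simp add: field_simps)
  then have "\<bar>real_of_int k\<bar> < 3" using 1 by linarith
  then have k: "k \<in> {-2..2}" by auto
  have "\<bar>x - k * pi\<bar> = pi * \<bar>k - x / pi\<bar>" by (simp add: abs_mult[symmetric] field_simps flip: abs_minus_commute)
  also have "\<dots> \<le> pi * (1/2)" using 1 by (intro mult_left_mono) auto
  finally have 2: "\<bar>x - k * pi\<bar> / 2 \<le> \<bar>sin (x - k * pi)\<bar>" by (intro half_abs_le_abs_sin) simp
  have "sin (x - k * pi) = sin x * cos (k * pi)"
    by (simp add: sin_diff sin_int_times_real mult.commute)
  then have "\<bar>sin (x - k * pi)\<bar> \<le> \<bar>sin x\<bar>" by (simp add: abs_mult mult_left_le)
  then have 3: "\<bar>x - k * pi\<bar> / 2 \<le> \<bar>sin x\<bar>" using 2 by simp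
  have "1 / sqrt \<bar>sin x\<bar> \<le> sqrt 2 * (1 / sqrt \<bar>x - k * pi\<bar>)"
  proof (cases "x - k * pi = 0")
    case True
    then have "x = k * pi" by simp
    then have "sin x = 0" by (simp add: sin_int_times_real mult.commute)
    then show ?thesis by simp
  next
    case False
    then have "1 / sqrt \<bar>sin x\<bar> \<le> 1 / sqrt (\<bar>x - k * pi\<bar> / 2)" using 3
      by (intro divide_left_mono real_sqrt_le_mono) auto
    also have "\<dots> = sqrt 2 * (1 / sqrt \<bar>x - k * pi\<bar>)" by (simp add: real_sqrt_divide)
    finally show ?thesis .
  qed
  also have "\<dots> \<le> (\<Sum>k\<in>{-2..2::int}. sqrt 2 * (1 / sqrt \<bar>x - k * pi\<bar>))"
    by (rule member_le_sum[of k "{-2..2}" "\<lambda>k. sqrt 2 * (1 / sqrt \<bar>x - k * pi\<bar>)"]) (use k in auto)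
  finally show ?thesis .
qed

lemma ln_one_plus_le_sqrt:
  assumes "x \<ge> (0::real)"
  shows "ln (1 + x) \<le> 2 * sqrt x"
proof -
  have "1 + x \<le> (1 + sqrt x)^2" using assms by (simp add: power2_eq_square algebra_simps)
  then have "ln (1 + x) \<le> ln ((1 + sqrt x)^2)" using assms by (subst ln_le_cancel_iff) (auto intro!: zero_less_power add_pos_nonneg)
  also have "\<dots> = 2 * ln (1 + sqrt x)" using assms by (subst ln_realpow) (auto intro: add_pos_nonneg)
  also have "\<dots> \<le> 2 * sqrt x" using ln_add_one_self_le_self[of "sqrt x"] assms by simp
  finally show ?thesis .
qed

text \<open>Rotation by -\<alpha> makes the second point real, and then the imaginary part of the
  difference is a lower bound.\<close>

lemma abs_sin_le_norm_diff:
  assumes "r \<ge> 0"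
  shows "r * \<bar>sin (\<theta> - \<alpha>)\<bar> \<le> norm (of_real r * cis \<theta> - of_real \<rho> * cis \<alpha>)"
proof -
  have "norm (of_real r * cis \<theta> - of_real \<rho> * cis \<alpha>)
      = norm (cis (-\<alpha>) * (of_real r * cis \<theta> - of_real \<rho> * cis \<alpha>))" by (simp add: norm_mult)
  also have "cis (-\<alpha>) * (of_real r * cis \<theta> - of_real \<rho> * cis \<alpha>)
      = of_real r * (cis (-\<alpha>) * cis \<theta>) - of_real \<rho> * (cis (-\<alpha>) * cis \<alpha>)"
    by (simp only: algebra_simps)
  also have "\<dots> = of_real r * cis (\<theta> - \<alpha>) - of_real \<rho>" by (simp only: cis_mult) simp
  also have "norm \<dots> \<ge> \<bar>Im (of_real r * cis (\<theta> - \<alpha>) - of_real \<rho>)\<bar>" by (rule abs_Im_le_cmod)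
  finally show ?thesis using assms by (simp add: abs_mult)
qed

lemma circ_int_ln_inverse_dist:
  assumes "norm a \<noteq> r" "r > 0"
  shows "circ_int (\<lambda>z. ln (1 + (1/2) / norm (z - a))) r"
  using assms by (intro circ_int_continuous continuous_intros) (auto simp: add_nonneg_eq_0_iff)

text \<open>Five zeros of the sine, each with coefficient 2 / sqrt r and integral at most 4 sqrt (6
  pi), give 40 sqrt (6 pi) / sqrt r; division by 2 pi leaves this constant.\<close>

definition log_const :: real where "log_const = 20 * sqrt (6*pi) / pi"

text \<open>The bound is insensitive to how close a is to the circle: the logarithm is dominated by
  a square root of the inverse distance, that distance is at least r |sin (\<theta> - \<alpha>)|,
  and an inverse square root is integrable. The decay in r is what makes each zero or pole cheap in
  the logarithmic difference.\<close>

lemma cmean_ln_inverse_dist_le: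
  assumes "norm a \<noteq> r" "r > 0"
  shows "cmean (\<lambda>z. ln (1 + (1/2) / norm (z - a))) r \<le> log_const / sqrt r"
proof -
  obtain \<rho> \<alpha> where a: "a = of_real \<rho> * cis \<alpha>" and \<alpha>: "0 \<le> \<alpha>" "\<alpha> < 2*pi"
  proof
    show "a = of_real (norm a) * cis (Arg2pi a)" using Arg2pi_eq[of a] by (simp add: cis_conv_exp)
    show "0 \<le> Arg2pi a" "Arg2pi a < 2*pi" by (auto simp: Arg2pi_ge_0 Arg2pi_lt_2pi)
  qed
  define F where "F = (\<lambda>\<theta>. ln (1 + (1/2) / norm (of_real r * cis \<theta> - a)))"
  define N where "N = {\<theta>\<in>{0..2*pi}. sin (\<theta> - \<alpha>) = 0}"
  \<comment> \<open>At a zero of the sine one summand of \<open>G\<close> is 1 / 0 = 0, so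
    \<open>G\<close> may fail to dominate there. These finitely many angles are masked by 0.\<close>
  define F' where "F' = (\<lambda>\<theta>. if \<theta> \<in> N then 0 else F \<theta>)"
  define G where "G = (\<lambda>\<theta>. \<Sum>k\<in>{-2..2::int}. 2 / sqrt r * (1 / sqrt \<bar>\<theta> - (\<alpha> + k * pi)\<bar>))"
  have "N \<subseteq> (\<lambda>k::int. \<alpha> + k * pi) ` {-2..2}"
  proof
    fix \<theta> assume "\<theta> \<in> N"
    then have \<theta>: "0 \<le> \<theta>" "\<theta> \<le> 2*pi" "sin (\<theta> - \<alpha>) = 0" by (auto simp: N_def)
    then obtain k :: int where k: "\<theta> - \<alpha> = k * pi" by (metis sin_zero_iff_int2)
    have "\<bar>\<theta> - \<alpha>\<bar> \<le> 2 * pi" using \<theta> \<alpha> by linarith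
    then have "\<bar>k * pi\<bar> \<le> 2 * pi" by (simp only: k)
    then have "\<bar>real_of_int k\<bar> \<le> 2" by (simp add: abs_mult)
    then have "k \<in> {-2..2}" by auto
    moreover have "\<theta> = \<alpha> + k * pi" using k by simp
    ultimately show "\<theta> \<in> (\<lambda>k::int. \<alpha> + k * pi) ` {-2..2}" by blast
  qed
  then have N: "finite N" by (rule finite_subset) auto
  have F: "F integrable_on {0..2*pi}" using circ_int_ln_inverse_dist[OF assms] by (simp add: circ_int_def F_def)
  have Feq: "integral {0..2*pi} F' = integral {0..2*pi} F"
    by (rule integral_spike[of N]) (use N in \<open>auto simp: F'_def negligible_finite\<close>)
  have F': "F' integrable_on {0..2*pi}"
    by (rule integrable_spike_finite[OF N _ F]) (auto simp: F'_def)
  have \<beta>: "\<bar>\<alpha> + k * pi\<bar> \<le> 4 * pi" if "k \<in> {-2..2::int}" for k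
  proof -
    have "\<bar>k * pi\<bar> \<le> 2 * pi" using that by (auto simp: abs_mult)
    then show ?thesis using \<alpha> by linarith
  qed
  have G: "G integrable_on {0..2*pi}" unfolding G_def
    by (intro integrable_sum integrable_on_mult_right integral_inv_sqrt_abs_diff_le \<beta>) auto
  have "integral {0..2*pi} F' \<le> integral {0..2*pi} G"
  proof (rule integral_le[OF F' G])
    fix \<theta> assume \<theta>: "\<theta> \<in> {0..2*pi}"
    show "F' \<theta> \<le> G \<theta>"
    proof (cases "\<theta> \<in> N")
      case True
      then show ?thesis using assms by (auto simp: F'_def G_def intro!: sum_nonneg)
    next
      case False
      then have s: "sin (\<theta> - \<alpha>) \<noteq> 0" using \<theta> by (auto simp: N_def)
      define d where "d = norm (of_real r * cis \<theta> - a)"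
      have d: "r * \<bar>sin (\<theta> - \<alpha>)\<bar> \<le> d" unfolding d_def a by (rule abs_sin_le_norm_diff) (use assms in auto)
      have p: "r * \<bar>sin (\<theta> - \<alpha>)\<bar> > 0" using s assms by simp
      then have d0: "d > 0" using d by linarith
      have "F' \<theta> = ln (1 + (1/2) / d)" using False by (simp add: F'_def F_def d_def)
      also have "\<dots> \<le> 2 * sqrt ((1/2) / d)" using d0 by (intro ln_one_plus_le_sqrt) auto
      also have "\<dots> \<le> 2 * sqrt ((1/2) / (r * \<bar>sin (\<theta> - \<alpha>)\<bar>))"
        using d p d0 by (intro mult_left_mono real_sqrt_le_mono divide_left_mono) auto
      also have "\<dots> = 2 / (sqrt 2 * sqrt r) * (1 / sqrt \<bar>sin (\<theta> - \<alpha>)\<bar>)"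
        by (simp add: real_sqrt_divide real_sqrt_mult)
      also have "\<dots> \<le> 2 / (sqrt 2 * sqrt r) * (\<Sum>k\<in>{-2..2::int}. sqrt 2 * (1 / sqrt \<bar>\<theta> - \<alpha> - k * pi\<bar>))"
        using \<theta> \<alpha> assms by (intro mult_left_mono inv_sqrt_abs_sin_le) auto
      also have "\<dots> = G \<theta>" unfolding G_def sum_distrib_left
        by (intro sum.cong refl) (simp add: algebra_simps)
      finally show ?thesis .
    qed
  qed
  also have "integral {0..2*pi} G = (\<Sum>k\<in>{-2..2::int}. 2 / sqrt r * integral {0..2*pi} (\<lambda>\<theta>. 1 / sqrt \<bar>\<theta> - (\<alpha> + k * pi)\<bar>))"
    unfolding G_def
  proof (subst integral_sum)
    show "(\<lambda>\<theta>. 2 / sqrt r * (1 / sqrt \<bar>\<theta> - (\<alpha> + k * pi)\<bar>)) integrable_on {0..2*pi}"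
      if "k \<in> {-2..2::int}" for k
      by (intro integrable_on_mult_right integral_inv_sqrt_abs_diff_le \<beta> that)
  qed (simp_all only: integral_mult_right finite_atLeastAtMost_int)
  also have "\<dots> \<le> (\<Sum>k\<in>{-2..2::int}. 2 / sqrt r * (4 * sqrt (6*pi)))"
    using assms by (intro sum_mono mult_left_mono integral_inv_sqrt_abs_diff_le \<beta>) auto
  also have "\<dots> = 40 * sqrt (6*pi) / sqrt r" by simp
  finally have "integral {0..2*pi} F \<le> 40 * sqrt (6*pi) / sqrt r" using Feq by simp
  then have "1 / (2*pi) * integral {0..2*pi} F \<le> 1 / (2*pi) * (40 * sqrt (6*pi) / sqrt r)"
    by (intro mult_left_mono) auto
  then show ?thesis unfolding cmean_def F_def log_const_def by (simp add: field_simps)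
qed

subsection \<open>Meromorphic functions and their divisors\<close>

definition mero_nz :: "(complex \<Rightarrow> complex) \<Rightarrow> bool" where
  "mero_nz h \<longleftrightarrow> h meromorphic_on UNIV \<and> eventually (\<lambda>z. h z \<noteq> 0) (cosparse UNIV)"

text \<open>Stronger than having order 0: a meromorphic function may carry a wrong value at a
  removable singularity, and such a point is not regular.\<close>

definition regular_at :: "(complex \<Rightarrow> complex) \<Rightarrow> complex \<Rightarrow> bool" where
  "regular_at h z \<longleftrightarrow> h analytic_on {z} \<and> h z \<noteq> 0"

definition good_radius :: "(complex \<Rightarrow> complex) \<Rightarrow> real \<Rightarrow> bool" where
  "good_radius h r \<longleftrightarrow> (\<forall>z. norm z = r \<longrightarrow> regular_at h z)"

definition zord :: "(complex \<Rightarrow> complex) \<Rightarrow> complex \<Rightarrow> real" where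
  "zord h z = real_of_int (zorder h z)"

definition locfin :: "(complex \<Rightarrow> real) \<Rightarrow> bool" where
  "locfin M \<longleftrightarrow> (\<forall>R. finite {z. norm z \<le> R \<and> M z \<noteq> 0})"

lemma finite_eventually_notin:
  fixes T :: "complex set"
  assumes "finite T"
  shows "eventually (\<lambda>w. w \<notin> T) (at z)"
  using eventually_not_in_cosparse[OF finite_imp_sparse[OF assms, of UNIV]]
  by (auto simp: eventually_cosparse_open_eq)

lemma mero_nz_meromorphic: "mero_nz h \<Longrightarrow> h meromorphic_on A"
  by (auto simp: mero_nz_def intro: meromorphic_on_subset)

lemma mero_nz_eventually: "mero_nz h \<Longrightarrow> eventually (\<lambda>w. h w \<noteq> 0) (at z)"
  unfolding mero_nz_def by (auto simp: eventually_cosparse_open_eq)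

lemma mero_nz_frequently: "mero_nz h \<Longrightarrow> frequently (\<lambda>w. h w \<noteq> 0) (at z)"
  by (simp add: mero_nz_eventually eventually_frequently)

lemma mero_nz_iff_frequently:
  assumes "h meromorphic_on UNIV"
  shows "mero_nz h \<longleftrightarrow> (\<exists>z. frequently (\<lambda>w. h w \<noteq> 0) (at z))"
proof
  assume "\<exists>z. frequently (\<lambda>w. h w \<noteq> 0) (at z)"
  then obtain z where "frequently (\<lambda>w. h w \<noteq> 0) (at z)" by blast
  then have "\<not> eventually (\<lambda>w. h w = 0) (cosparse UNIV)"
    by (auto simp: eventually_cosparse_open_eq frequently_def)
  then show "mero_nz h"
    using meromorphic_imp_constant_or_avoid[OF assms, of 0] assms by (auto simp: mero_nz_def)
qed (use mero_nz_frequently in blast)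

lemma mero_nz_regular: "mero_nz h \<Longrightarrow> eventually (regular_at h) (cosparse UNIV)"
  unfolding mero_nz_def regular_at_def
  by (auto intro: eventually_conj meromorphic_on_imp_analytic_cosparse)

lemma zorder_regular: "regular_at h z \<Longrightarrow> zorder h z = 0"
  unfolding regular_at_def by (auto intro: zorder_eq_0I)

lemma mero_nz_finite_singular:
  assumes "mero_nz h"
  shows "finite {z. norm z \<le> R \<and> \<not> regular_at h z}"
proof -
  have "{z. \<not> regular_at h z} sparse_in UNIV"
    using mero_nz_regular[OF assms] by (simp add: eventually_cosparse)
  then have "finite (cball 0 R \<inter> {z. \<not> regular_at h z})"
    by (intro sparse_in_compact_finite) (auto intro: sparse_in_subset)
  then show ?thesis by (rule finite_subset[rotated]) auto
qed

lemma locfin_zord: "mero_nz h \<Longrightarrow> locfin (zord h)"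
  unfolding locfin_def zord_def
proof
  fix R assume "mero_nz h"
  show "finite {z. norm z \<le> R \<and> real_of_int (zorder h z) \<noteq> 0}"
    by (rule finite_subset[OF _ mero_nz_finite_singular[OF \<open>mero_nz h\<close>, of R]]) (auto simp: zorder_regular)
qed

text \<open>Each function fails to be regular only at countably many points, hence has countably
  many bad radii, while an interval is uncountable.\<close>

lemma good_radius_exists:
  assumes "finite H" "\<And>h. h \<in> H \<Longrightarrow> mero_nz h" "a < b"
  shows "\<exists>r. a < r \<and> r < b \<and> (\<forall>h\<in>H. good_radius h r)"
proof -
  have "countable {r. \<not> good_radius h r}" if "h \<in> H" for h
  proof -
    have "{z. \<not> regular_at h z} sparse_in UNIV"
      using mero_nz_regular[OF assms(2)[OF that]] by (simp add: eventually_cosparse)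
    from sparse_imp_countable[OF _ this] have "countable {z. \<not> regular_at h z}" by simp
    then have "countable (norm ` {z. \<not> regular_at h z})" by (rule countable_image)
    then show ?thesis by (rule countable_subset[rotated]) (auto simp: good_radius_def)
  qed
  then have "countable (\<Union>h\<in>H. {r. \<not> good_radius h r})" using assms(1) by (intro countable_UN) (auto intro: countable_finite)
  then have "\<not> {a<..<b} \<subseteq> (\<Union>h\<in>H. {r. \<not> good_radius h r})"
    using uncountable_open_interval[of a b] assms(3) countable_subset by blast
  then show ?thesis by auto
qed

lemma good_radius_continuous: "good_radius h r \<Longrightarrow> continuous_on (sphere 0 r) h"
  unfolding good_radius_def regular_at_def
  by (intro continuous_at_imp_continuous_on ballI analytic_at_imp_isCont) auto

lemma good_radius_nz: "good_radius h r \<Longrightarrow> norm z = r \<Longrightarrow> h z \<noteq> 0"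
  unfolding good_radius_def regular_at_def by auto

lemma circ_int_abs_ln_norm:
  assumes "good_radius h r" "r \<ge> 0"
  shows "circ_int (\<lambda>z. ln (norm (h z))) r" "circ_int (\<lambda>z. \<bar>ln (norm (h z))\<bar>) r"
  using assms by (auto intro!: circ_int_continuous continuous_intros good_radius_continuous dest: good_radius_nz)

lemma continuous_on_ln_plus:
  assumes "continuous_on A f"
  shows "continuous_on A (\<lambda>x. ln_plus (f x))"
  unfolding ln_plus_def using assms by (intro continuous_intros) (auto simp: max_def)

lemma circ_int_ln_plus:
  assumes "continuous_on (sphere 0 r) h" "r \<ge> 0"
  shows "circ_int (\<lambda>z. ln_plus (norm (h z))) r"
  using assms by (auto intro!: circ_int_continuous continuous_on_ln_plus continuous_intros)

lemma zorder_0_remove_sings: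
  assumes "h meromorphic_on {z}" "frequently (\<lambda>w. h w \<noteq> 0) (at z)" "zorder h z = 0"
  shows "remove_sings h analytic_on {z}" "remove_sings h z \<noteq> 0"
proof -
  have 1: "isolated_singularity_at h z" "not_essential h z"
    using assms(1) by (auto simp: meromorphic_at_iff)
  have "\<not> is_pole h z" using isolated_pole_imp_neg_zorder[OF 1(1)] assms(3) by auto
  then obtain c where c: "h \<midarrow>z\<rightarrow> c" using 1(2) by (auto simp: not_essential_def)
  then show 2: "remove_sings h analytic_on {z}" by (rule remove_sings_analytic_at[OF 1(1)])
  have "frequently (\<lambda>w. remove_sings h w \<noteq> 0) (at z)"
    using frequently_eventually_frequently[OF assms(2) eventually_remove_sings_eq_at[OF 1(1)]]
    by (rule frequently_elim1) auto
  moreover have "zorder (remove_sings h) z = 0" using assms(3) 1(1) by simp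
  ultimately show "remove_sings h z \<noteq> 0" using zorder_eq_0_iff[OF 2] by simp
qed

section \<open>Factorization over the zeros and poles in a convex domain\<close>

lemma zorder_linear_powi:
  assumes "\<kappa> > 0"
  shows "zorder (\<lambda>w. ((w - a) / of_real \<kappa>) powi n) z = (if z = a then n else 0)"
proof (cases "z = a")
  case True
  show ?thesis
  proof (cases "n = 0")
    case False
    have "zorder (\<lambda>w. ((w - a) / of_real \<kappa>) powi n) a = n"
      by (rule zorder_eqI[of UNIV _ "\<lambda>w. (1 / of_real \<kappa>) powi n"])
         (use assms in \<open>auto simp: power_int_divide_distrib\<close>)
    then show ?thesis using True by simp
  qed (use True in auto)
next
  case False
  then have "zorder (\<lambda>w. ((w - a) / of_real \<kappa>) powi n) z = 0"
    using assms by (intro zorder_eq_0I analytic_intros) auto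
  then show ?thesis using False by simp
qed

text \<open>Dividing by linear factors with the orders of h leaves order 0 throughout A. The
  extended quotient has no zeros on the convex set A and therefore has a holomorphic logarithm. The
  scales \<open>\<kappa>\<close> let each application normalise the factors: truncated logarithms in
  Jensen's formula, nonpositive ones in the logarithmic difference.\<close>

lemma mero_factorization:
  assumes h: "mero_nz h" and A: "convex A" "open A" "A \<noteq> {}"
    and S: "S = {a\<in>A. zorder h a \<noteq> 0}" "finite S" and \<kappa>: "\<And>a. \<kappa> a > (0::real)"
  obtains L where "L holomorphic_on A"
    "\<And>z. z \<in> A \<Longrightarrow> regular_at h z \<Longrightarrow>
       h z = exp (L z) * (\<Prod>a\<in>S. ((z - a) / of_real (\<kappa> a)) powi zorder h a)"
proof -
  define P where "P = (\<lambda>z. \<Prod>a\<in>S. ((z - a) / of_real (\<kappa> a)) powi zorder h a)"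
  define k where "k = (\<lambda>z. h z / P z)"
  have Pm: "P meromorphic_on B" for B unfolding P_def by (intro meromorphic_intros)
  have evP: "eventually (\<lambda>w. P w \<noteq> 0) (at z)" for z
  proof -
    have "eventually (\<lambda>w. w \<notin> S) (at z)"
      using S(2) by (rule finite_eventually_notin)
    then show ?thesis by eventually_elim (use S(2) \<kappa> in \<open>auto simp: P_def less_imp_neq[symmetric]\<close>)
  qed
  have zP: "zorder P z = (\<Sum>a\<in>S. if z = a then zorder h a else 0)" for z
  proof -
    have "zorder P z = (\<Sum>a\<in>S. zorder (\<lambda>w. ((w - a) / of_real (\<kappa> a)) powi zorder h a) z)"
      unfolding P_def
      by (rule zorder_prod) (use evP[of z] \<kappa> in \<open>auto simp: P_def less_imp_neq[symmetric] intro!: meromorphic_intros\<close>)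
    also have "\<dots> = (\<Sum>a\<in>S. if z = a then zorder h a else 0)"
      by (intro sum.cong refl zorder_linear_powi \<kappa>)
    finally show ?thesis .
  qed
  have km: "k meromorphic_on {z}" for z
    unfolding k_def by (intro meromorphic_intros mero_nz_meromorphic h Pm)
  have evk: "frequently (\<lambda>w. k w \<noteq> 0) (at z)" for z
  proof -
    have "eventually (\<lambda>w. k w \<noteq> 0) (at z)"
      using evP[of z] mero_nz_eventually[OF h, of z] by eventually_elim (auto simp: k_def)
    then show ?thesis by (simp add: eventually_frequently)
  qed
  have zk: "zorder k z = 0" if "z \<in> A" for z
  proof -
    have "zorder k z = zorder h z - zorder P z"
      unfolding k_def using evP[of z]
      by (intro zorder_divide[OF mero_nz_meromorphic[OF h] mero_nz_frequently[OF h] Pm]) (simp add: eventually_frequently)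
    moreover have "zorder P z = zorder h z"
      unfolding zP using S that by (cases "z \<in> S") (auto simp: sum.delta)
    ultimately show ?thesis by simp
  qed
  \<comment> \<open>At the points of \<open>S\<close>, and wherever h has a wrong value,
    \<open>k\<close> itself need not be analytic.\<close>
  define K where "K = remove_sings k"
  have K: "K analytic_on {z}" "K z \<noteq> 0" if "z \<in> A" for z
    unfolding K_def using zorder_0_remove_sings[OF km evk zk[OF that]] by auto
  then have "K analytic_on A" using analytic_on_analytic_at by blast
  then have "K holomorphic_on A" by (rule analytic_imp_holomorphic)
  moreover obtain z0 where "z0 \<in> A" using A by auto
  ultimately obtain L where L: "L holomorphic_on A" "\<And>x. x \<in> A \<Longrightarrow> exp (L x) = K x"
    using holomorphic_logarithm_exists[OF A(1,2)] K(2) by metis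
  show ?thesis
  proof
    show "L holomorphic_on A" by fact
    fix z assume z: "z \<in> A" "regular_at h z"
    then have "z \<notin> S" using S zorder_regular by auto
    then have P: "P analytic_on {z}" "P z \<noteq> 0"
      unfolding P_def using S(2) \<kappa> by (auto intro!: analytic_intros simp: less_imp_neq[symmetric])
    then have "k analytic_on {z}" unfolding k_def using z by (intro analytic_intros) (auto simp: regular_at_def)
    then have "K z = k z" unfolding K_def by simp
    then show "h z = exp (L z) * (\<Prod>a\<in>S. ((z - a) / of_real (\<kappa> a)) powi zorder h a)"
      using L(2)[OF z(1)] P by (simp add: k_def P_def)
  qed
qed

lemma ln_power_int:
  assumes "x > (0::real)"
  shows "ln (x powi n) = of_int n * ln x"
proof (cases "n \<ge> 0")
  case True
  then show ?thesis using assms by (simp add: power_int_def ln_realpow)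
next
  case False
  then show ?thesis using assms by (simp add: power_int_def ln_realpow ln_inverse)
qed

lemma mero_ln_norm_factorization:
  assumes h: "mero_nz h" and R: "R > 0" and \<kappa>: "\<And>a. \<kappa> a > (0::real)"
  obtains L where "L holomorphic_on ball 0 R"
    "\<And>z. norm z < R \<Longrightarrow> regular_at h z \<Longrightarrow>
       ln (norm (h z)) = Re (L z) + (\<Sum>a | norm a < R \<and> zord h a \<noteq> 0. zord h a * (ln (norm (z - a)) - ln (\<kappa> a)))"
proof -
  define S where "S = {a\<in>ball 0 R. zorder h a \<noteq> 0}"
  have S: "S = {a. norm a < R \<and> zord h a \<noteq> 0}" by (auto simp: S_def zord_def)
  have fin: "finite S"
    using locfin_zord[OF h] unfolding locfin_def S by (rule allE[of _ R]) (erule finite_subset[rotated], auto)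
  obtain L where L: "L holomorphic_on ball 0 R"
    "\<And>z. z \<in> ball 0 R \<Longrightarrow> regular_at h z \<Longrightarrow>
       h z = exp (L z) * (\<Prod>a\<in>S. ((z - a) / of_real (\<kappa> a)) powi zorder h a)"
  proof (rule mero_factorization[OF h convex_ball open_ball _ S_def fin, of \<kappa>])
  qed (use R \<kappa> in auto)
  show ?thesis
  proof
    show "L holomorphic_on ball 0 R" by fact
    fix z :: complex assume z: "norm z < R" "regular_at h z"
    then have "z \<notin> S" using zorder_regular by (auto simp: S_def)
    then have nz: "norm (z - a) > 0" if "a \<in> S" for a using that by auto
    have \<kappa>': "\<kappa> a \<noteq> 0" for a using \<kappa>[of a] by simp
    have "ln (norm (h z)) = ln (exp (Re (L z)) * (\<Prod>a\<in>S. (norm (z - a) / \<kappa> a) powi zorder h a))"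
      using L(2)[of z] z \<kappa> by (simp add: norm_mult prod_norm[symmetric] norm_power_int norm_divide less_imp_le)
    also have "\<dots> = Re (L z) + ln (\<Prod>a\<in>S. (norm (z - a) / \<kappa> a) powi zorder h a)"
      using nz \<kappa> \<kappa>' by (subst ln_mult_pos) (auto intro!: prod_pos zero_less_power_int divide_pos_pos)
    also have "ln (\<Prod>a\<in>S. (norm (z - a) / \<kappa> a) powi zorder h a) = (\<Sum>a\<in>S. ln ((norm (z - a) / \<kappa> a) powi zorder h a))"
      using nz \<kappa> \<kappa>' by (intro ln_prod fin) (auto intro!: zero_less_power_int divide_pos_pos)
    also have "\<dots> = (\<Sum>a\<in>S. zord h a * (ln (norm (z - a)) - ln (\<kappa> a)))"
    proof (intro sum.cong refl)
      fix a assume "a \<in> S"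
      then show "ln ((norm (z - a) / \<kappa> a) powi zorder h a) = zord h a * (ln (norm (z - a)) - ln (\<kappa> a))"
        using nz[of a] \<kappa>[of a] \<kappa>'[of a] by (auto simp: ln_power_int ln_div zord_def del: zero_less_norm_iff)
    qed
    finally show "ln (norm (h z)) = Re (L z) + (\<Sum>a | norm a < R \<and> zord h a \<noteq> 0. zord h a * (ln (norm (z - a)) - ln (\<kappa> a)))"
      by (simp add: S)
  qed
qed

subsection \<open>Counting functions and Jensen's formula\<close>

text \<open>
  Truncating \<open>norm z\<close> from below by 1 changes the classical integrated counting function only by
  a bounded amount and makes zeros and poles at the origin harmless.
\<close>

definition lam :: "real \<Rightarrow> complex \<Rightarrow> real" where
  "lam r z = max 0 (ln (r / max 1 (norm z)))"

definition ncount :: "(complex \<Rightarrow> real) \<Rightarrow> real \<Rightarrow> real" where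
  "ncount M r = (\<Sum>z | norm z < r \<and> M z \<noteq> 0. M z)"

definition Ncount :: "(complex \<Rightarrow> real) \<Rightarrow> real \<Rightarrow> real" where
  "Ncount M r = (\<Sum>z | norm z < r \<and> M z \<noteq> 0. M z * lam r z)"

lemma lam_nonneg: "lam r z \<ge> 0" by (simp add: lam_def)

lemma lam_eq_0:
  assumes "r \<le> norm z" "r > 0"
  shows "lam r z = 0"
proof -
  have "r / max 1 (norm z) \<le> 1" using assms by simp
  then have "ln (r / max 1 (norm z)) \<le> 0" using assms by (subst ln_le_zero_iff) (auto intro!: divide_pos_pos)
  then show ?thesis by (simp add: lam_def)
qed

lemma lam_eq: 
  assumes "norm z \<le> r" "r \<ge> 1"
  shows "lam r z = ln r - ln (max 1 (norm z))"
proof -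
  have "r / max 1 (norm z) \<ge> 1" using assms by simp
  then have "ln (r / max 1 (norm z)) \<ge> 0" by (rule ln_ge_zero)
  moreover have "ln (r / max 1 (norm z)) = ln r - ln (max 1 (norm z))" using assms by (subst ln_div) auto
  ultimately show ?thesis by (simp add: lam_def)
qed

lemma lam_le_ln: "r \<ge> 1 \<Longrightarrow> lam r z \<le> ln r"
  by (cases "norm z \<le> r") (auto simp: lam_eq lam_eq_0)

lemma locfin_finite: "locfin M \<Longrightarrow> finite {z. norm z < r \<and> M z \<noteq> 0}"
  unfolding locfin_def by (erule allE[of _ r]) (erule finite_subset[rotated], auto)

lemma locfin_comb:
  assumes "locfin M" "locfin N" "\<And>z. M z = 0 \<Longrightarrow> N z = 0 \<Longrightarrow> K z = 0"
  shows "locfin K"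
  unfolding locfin_def
proof
  fix R
  have "finite ({z. norm z \<le> R \<and> M z \<noteq> 0} \<union> {z. norm z \<le> R \<and> N z \<noteq> 0})"
    using assms(1,2) by (auto simp: locfin_def)
  then show "finite {z. norm z \<le> R \<and> K z \<noteq> 0}" by (rule finite_subset[rotated]) (use assms(3) in auto)
qed

text \<open>The weights vanish from r on, so several counting functions can be expanded over one
  common index set.\<close>

lemma Ncount_superset:
  assumes "finite S" "{z. norm z < r \<and> M z \<noteq> 0} \<subseteq> S" "r > 0"
  shows "Ncount M r = (\<Sum>z\<in>S. M z * lam r z)"
  unfolding Ncount_def
  by (rule sum.mono_neutral_left) (use assms in \<open>auto intro!: lam_eq_0\<close>)

lemma Ncount_add:
  assumes "locfin M" "locfin N" "r > 0"
  shows "Ncount (\<lambda>z. M z + N z) r = Ncount M r + Ncount N r"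
proof -
  let ?S = "{z. norm z < r \<and> M z \<noteq> 0} \<union> {z. norm z < r \<and> N z \<noteq> 0}"
  have f: "finite ?S" using assms by (auto intro: locfin_finite)
  have e: "Ncount K r = (\<Sum>z\<in>?S. K z * lam r z)" if "{z. norm z < r \<and> K z \<noteq> 0} \<subseteq> ?S" for K
    by (rule Ncount_superset[OF f that assms(3)])
  have "Ncount (\<lambda>z. M z + N z) r = (\<Sum>z\<in>?S. (M z + N z) * lam r z)" by (rule e) auto
  also have "\<dots> = (\<Sum>z\<in>?S. M z * lam r z) + (\<Sum>z\<in>?S. N z * lam r z)"
    by (simp only: distrib_right sum.distrib)
  also have "(\<Sum>z\<in>?S. M z * lam r z) = Ncount M r" by (rule e[symmetric]) auto
  also have "(\<Sum>z\<in>?S. N z * lam r z) = Ncount N r" by (rule e[symmetric]) auto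
  finally show ?thesis .
qed

lemma Ncount_cmult: "Ncount (\<lambda>z. c * M z) r = c * Ncount M r"
  unfolding Ncount_def by (cases "c = 0") (simp_all add: sum_distrib_left mult.assoc)

lemma Ncount_sum:
  assumes "finite I" "\<And>i. i \<in> I \<Longrightarrow> locfin (M i)" "r > 0"
  shows "Ncount (\<lambda>z. \<Sum>i\<in>I. M i z) r = (\<Sum>i\<in>I. Ncount (M i) r)" "locfin (\<lambda>z. \<Sum>i\<in>I. M i z)"
proof -
  have "Ncount (\<lambda>z. \<Sum>i\<in>I. M i z) r = (\<Sum>i\<in>I. Ncount (M i) r) \<and> locfin (\<lambda>z. \<Sum>i\<in>I. M i z)"
    using assms
  proof (induction I)
    case empty
    then show ?case by (simp add: Ncount_def locfin_def)
  next
    case (insert i I)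
    then have IH: "Ncount (\<lambda>z. \<Sum>i\<in>I. M i z) r = (\<Sum>i\<in>I. Ncount (M i) r)" "locfin (\<lambda>z. \<Sum>i\<in>I. M i z)"
      and i: "locfin (M i)" by auto
    have "locfin (\<lambda>z. M i z + (\<Sum>i\<in>I. M i z))" by (rule locfin_comb[OF i IH(2)]) simp
    moreover have "Ncount (\<lambda>z. M i z + (\<Sum>i\<in>I. M i z)) r = Ncount (M i) r + Ncount (\<lambda>z. \<Sum>i\<in>I. M i z) r"
      by (rule Ncount_add[OF i IH(2) assms(3)])
    ultimately show ?case using insert.hyps IH(1) by simp
  qed
  then show "Ncount (\<lambda>z. \<Sum>i\<in>I. M i z) r = (\<Sum>i\<in>I. Ncount (M i) r)" "locfin (\<lambda>z. \<Sum>i\<in>I. M i z)" by auto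
qed

lemma Ncount_mono:
  assumes "locfin M" "locfin N" "r > 0" "\<And>z. M z \<le> N z"
  shows "Ncount M r \<le> Ncount N r"
proof -
  let ?S = "{z. norm z < r \<and> M z \<noteq> 0} \<union> {z. norm z < r \<and> N z \<noteq> 0}"
  have f: "finite ?S" using assms by (auto intro: locfin_finite)
  have e: "Ncount K r = (\<Sum>z\<in>?S. K z * lam r z)" if "{z. norm z < r \<and> K z \<noteq> 0} \<subseteq> ?S" for K
    by (rule Ncount_superset[OF f that assms(3)])
  have "Ncount M r = (\<Sum>z\<in>?S. M z * lam r z)" by (rule e) auto
  also have "\<dots> \<le> (\<Sum>z\<in>?S. N z * lam r z)" by (intro sum_mono mult_right_mono lam_nonneg assms)
  also have "\<dots> = Ncount N r" by (rule e[symmetric]) auto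
  finally show ?thesis .
qed

lemma Ncount_nonneg: "(\<And>z. M z \<ge> 0) \<Longrightarrow> Ncount M r \<ge> 0"
  unfolding Ncount_def by (intro sum_nonneg mult_nonneg_nonneg lam_nonneg)

lemma ncount_nonneg: "(\<And>z. M z \<ge> 0) \<Longrightarrow> ncount M r \<ge> 0"
  unfolding ncount_def by (intro sum_nonneg)

text \<open>Every point of norm less than r has weight at least ln R - ln r in the integrated count
  at R.\<close>

lemma ncount_le_Ncount:
  assumes "locfin M" "\<And>z. M z \<ge> 0" "1 \<le> r" "r \<le> R"
  shows "ncount M r * (ln R - ln r) \<le> Ncount M R"
proof -
  have "ncount M r * (ln R - ln r) = (\<Sum>z | norm z < r \<and> M z \<noteq> 0. M z * (ln R - ln r))"
    by (simp add: ncount_def sum_distrib_right)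
  also have "\<dots> \<le> (\<Sum>z | norm z < r \<and> M z \<noteq> 0. M z * lam R z)"
  proof (intro sum_mono mult_left_mono)
    fix z assume "z \<in> {z. norm z < r \<and> M z \<noteq> 0}"
    then have z: "norm z < r" by simp
    then have "ln (max 1 (norm z)) \<le> ln r" using assms by (subst ln_le_cancel_iff) auto
    then show "ln R - ln r \<le> lam R z" using z assms by (subst lam_eq) auto
  qed (use assms in auto)
  also have "\<dots> \<le> Ncount M R"
    unfolding Ncount_def using assms
    by (intro sum_mono2 locfin_finite mult_nonneg_nonneg lam_nonneg) auto
  finally show ?thesis .
qed

text \<open>With the scale max 1 (norm a), the factor at a contributes exactly
  \<open>lam r a\<close> to the mean, and the holomorphic part contributes its value at 0. That
  value has no intrinsic meaning here and is left as an unspecified constant.\<close>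

lemma jensen:
  assumes h: "mero_nz h"
  obtains C where "\<And>r. r > 1 \<Longrightarrow> good_radius h r \<Longrightarrow>
     cmean (\<lambda>z. ln (norm (h z))) r = C + Ncount (zord h) r"
proof -
  define D where "D = (\<lambda>r. cmean (\<lambda>z. ln (norm (h z))) r - Ncount (zord h) r)"
  \<comment> \<open>The factorization lives on a disc of radius R and its logarithm depends on R, so
    \<open>D\<close> is first seen to be constant only below R.\<close>
  have key: "\<exists>C. \<forall>r. 1 < r \<and> r < R \<and> good_radius h r \<longrightarrow> D r = C" if "R > 1" for R
  proof -
    define S where "S = {a. norm a < R \<and> zord h a \<noteq> 0}"
    have fin: "finite S" unfolding S_def by (intro locfin_finite locfin_zord h)
    obtain L where L: "L holomorphic_on ball 0 R"
      "\<And>z. norm z < R \<Longrightarrow> regular_at h z \<Longrightarrow>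
       ln (norm (h z)) = Re (L z) + (\<Sum>a\<in>S. zord h a * (ln (norm (z - a)) - ln (max 1 (norm a))))"
      unfolding S_def
    proof (rule mero_ln_norm_factorization[OF h, of R "\<lambda>a. max 1 (norm a)"])
    qed (use \<open>R > 1\<close> in auto)
    have "D r = Re (L 0)" if r: "1 < r" "r < R" "good_radius h r" for r
    proof -
      have na: "norm a \<noteq> r" if "a \<in> S" for a
        using that r(3) zorder_regular by (auto simp: S_def good_radius_def zord_def)
      have ci: "circ_int (\<lambda>z. zord h a * (ln (norm (z - a)) - ln (max 1 (norm a)))) r" if "a \<in> S" for a
        using na[OF that] r by (intro circ_int_intros circ_int_ln_norm) auto
      have "continuous_on (sphere 0 r) (\<lambda>z. Re (L z))"
        using r by (intro continuous_intros holomorphic_on_imp_continuous_on[OF holomorphic_on_subset[OF L(1)]]) auto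
      then have cL: "circ_int (\<lambda>z. Re (L z)) r" using r by (intro circ_int_continuous) auto
      have "cmean (\<lambda>z. ln (norm (h z))) r
          = cmean (\<lambda>z. Re (L z) + (\<Sum>a\<in>S. zord h a * (ln (norm (z - a)) - ln (max 1 (norm a))))) r"
        using r by (intro cmean_cong L(2)) (auto simp: good_radius_def)
      also have "\<dots> = cmean (\<lambda>z. Re (L z)) r + (\<Sum>a\<in>S. cmean (\<lambda>z. zord h a * (ln (norm (z - a)) - ln (max 1 (norm a)))) r)"
      proof -
        have "cmean (\<lambda>z. \<Sum>a\<in>S. zord h a * (ln (norm (z - a)) - ln (max 1 (norm a)))) r
           = (\<Sum>a\<in>S. cmean (\<lambda>z. zord h a * (ln (norm (z - a)) - ln (max 1 (norm a)))) r)"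
          by (rule cmean_sum[OF fin ci])
        then show ?thesis using cmean_add[OF cL circ_int_sum[OF fin ci]] by (simp only:)
      qed
      also have "cmean (\<lambda>z. Re (L z)) r = Re (L 0)" by (rule cmean_Re_holomorphic[OF L(1)]) (use r in auto)
      also have "(\<Sum>a\<in>S. cmean (\<lambda>z. zord h a * (ln (norm (z - a)) - ln (max 1 (norm a)))) r) = (\<Sum>a\<in>S. zord h a * lam r a)"
      proof (intro sum.cong refl)
        fix a assume a: "a \<in> S"
        have "cmean (\<lambda>z. zord h a * (ln (norm (z - a)) - ln (max 1 (norm a)))) r
            = zord h a * (ln (max r (norm a)) - ln (max 1 (norm a)))"
          unfolding cmean_cmult using na[OF a] r
          by (subst cmean_diff) (auto simp: circ_int_ln_norm circ_int_const cmean_const cmean_ln_norm)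
        also have "ln (max r (norm a)) - ln (max 1 (norm a)) = lam r a"
        proof (cases "norm a \<le> r")
          case True
          then have "lam r a = ln r - ln (max 1 (norm a))" using r by (intro lam_eq) auto
          then show ?thesis using True by (simp add: max_absorb1)
        next
          case False
          then have "lam r a = 0" "max r (norm a) = norm a" "max 1 (norm a) = norm a" using r by (auto intro: lam_eq_0)
          then show ?thesis by simp
        qed
        finally show "cmean (\<lambda>z. zord h a * (ln (norm (z - a)) - ln (max 1 (norm a)))) r = zord h a * lam r a" .
      qed
      also have "\<dots> = Ncount (zord h) r"
        by (rule Ncount_superset[symmetric]) (use r fin in \<open>auto simp: S_def\<close>)
      finally show ?thesis by (simp add: D_def)
    qed
    then show ?thesis by blast
  qed
  \<comment> \<open>A fixed reference radius forces the constants belonging to different R to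
    agree.\<close>
  obtain r0 where r0: "1 < r0" "r0 < 2" "good_radius h r0"
    using good_radius_exists[of "{h}" 1 2] h by auto
  show ?thesis
  proof (rule that[of "D r0"])
    fix r assume r: "r > 1" "good_radius h r"
    have "max r r0 + 1 > 1" using r by simp
    from key[OF this] obtain C where C: "\<And>s. 1 < s \<Longrightarrow> s < max r r0 + 1 \<Longrightarrow> good_radius h s \<Longrightarrow> D s = C" by blast
    have "D r = C" "D r0 = C" by (rule C; use r r0 in simp)+
    then have "D r = D r0" by simp
    then show "cmean (\<lambda>z. ln (norm (h z))) r = D r0 + Ncount (zord h) r" by (simp add: D_def)
  qed
qed

lemma ln_plus_eq: "x > 0 \<Longrightarrow> ln_plus x = max 0 (ln x)"
  unfolding ln_plus_def by (cases "x \<ge> 1") (auto simp: max_def)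

lemma ln_plus_nonneg: "ln_plus x \<ge> 0"
  unfolding ln_plus_def by simp

subsection \<open>The logarithmic difference\<close>

lemma ln_norm_shift_le:
  fixes u v :: complex
  assumes "u \<noteq> 0" "v \<noteq> 0" "norm (u - v) \<le> 1/2"
  shows "ln (norm u) - ln (norm v) \<le> ln (1 + (1/2) / norm v)"
proof -
  have "norm u \<le> norm v + 1/2" using assms(3) norm_triangle_sub[of u v] by simp
  also have "\<dots> = norm v * (1 + (1/2) / norm v)" using assms by (simp add: distrib_left)
  finally have "norm u \<le> norm v * (1 + (1/2) / norm v)" .
  then have "ln (norm u) \<le> ln (norm v * (1 + (1/2) / norm v))" using assms
    by (subst ln_le_cancel_iff) (auto intro!: mult_pos_pos add_pos_nonneg)
  also have "\<dots> = ln (norm v) + ln (1 + (1/2) / norm v)" using assms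
    by (subst ln_mult_pos) (auto intro!: add_pos_nonneg)
  finally show ?thesis by simp
qed

text \<open>On the disc of radius 2R, ln (norm (h z)) is the real part of a holomorphic L plus one
  logarithm for each zero or pole. The derivative estimate bounds the change of L under the shift by
  a multiple of 1 / R times a mean of |Re L|. The change of each logarithm has mean at most 2
  log_const / sqrt r, wherever its singularity lies.\<close>

lemma cmean_log_difference_le:
  assumes h: "mero_nz h" and c: "norm c = 1/2" and r: "2 \<le> r" "2 * r \<le> R"
    and g: "good_radius h r" "good_radius (\<lambda>z. h (z + c)) r" "good_radius h R"
  defines "n \<equiv> ncount (\<lambda>z. \<bar>zord h z\<bar>) (2 * R)"
  shows "cmean (\<lambda>z. ln_plus (norm (h (z + c) / h z))) r
           \<le> 8 / R * (cmean (\<lambda>z. \<bar>ln (norm (h z))\<bar>) R + n * ln 4) + n * (2 * (log_const / sqrt r))"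
proof -
  define S where "S = {a. norm a < 2 * R \<and> zord h a \<noteq> 0}"
  have fin: "finite S" unfolding S_def by (intro locfin_finite locfin_zord h)
  have n: "n = (\<Sum>a\<in>S. \<bar>zord h a\<bar>)" by (simp add: n_def ncount_def S_def)
  \<comment> \<open>The scale 4R exceeds norm (z - a) for norm z = R and norm a < 2R. Hence every
    logarithm is nonpositive on that circle, and its mean there is at least - ln 4.\<close>
  obtain L where L: "L holomorphic_on ball 0 (2*R)"
    "\<And>z. norm z < 2*R \<Longrightarrow> regular_at h z \<Longrightarrow>
       ln (norm (h z)) = Re (L z) + (\<Sum>a\<in>S. zord h a * (ln (norm (z - a)) - ln (4*R)))"
    unfolding S_def
  proof (rule mero_ln_norm_factorization[OF h, of "2*R" "\<lambda>a. 4*R"])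
  qed (use r in auto)
  have regS: "\<not> regular_at h a" if "a \<in> S" for a
    using that zorder_regular by (auto simp: S_def zord_def)
  have naR: "norm a \<noteq> R" if "a \<in> S" for a using regS[OF that] g(3) by (auto simp: good_radius_def)
  have nar: "norm a \<noteq> r" if "a \<in> S" for a using regS[OF that] g(1) by (auto simp: good_radius_def)
  have reg_shift: "regular_at h (z + c)" if "norm z = r" for z
  proof -
    have 1: "(\<lambda>z. h (z + c)) analytic_on {z}" "h (z + c) \<noteq> 0"
      using g(2) that by (auto simp: good_radius_def regular_at_def)
    have "(\<lambda>w. w - c) analytic_on {z + c}" by (intro analytic_intros)
    then have "(\<lambda>w. (\<lambda>z. h (z + c)) (w - c)) analytic_on {z + c}"
      using analytic_on_compose_gen[of "\<lambda>w. w - c" "{z + c}" "\<lambda>z. h (z + c)" "{z}"] 1(1)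
      by (auto simp: o_def)
    then show ?thesis using 1(2) by (simp add: regular_at_def)
  qed
  have narc: "norm (a - c) \<noteq> r" if "a \<in> S" for a
    using regS[OF that] reg_shift[of "a - c"] by auto
  define M where "M = cmean (\<lambda>z. \<bar>Re (L z)\<bar>) R"
  have contL: "continuous_on (sphere 0 R) L"
    using r by (intro holomorphic_on_imp_continuous_on[OF holomorphic_on_subset[OF L(1)]]) auto
  have ciL: "circ_int (\<lambda>z. \<bar>Re (L z)\<bar>) R" using contL r by (intro circ_int_continuous continuous_intros) auto
  have ci1: "circ_int (\<lambda>z. \<bar>zord h a\<bar> * (ln (4*R) - ln (norm (z - a)))) R" if "a \<in> S" for a
    using naR[OF that] r by (intro circ_int_intros circ_int_ln_norm) auto
  have M: "M \<le> cmean (\<lambda>z. \<bar>ln (norm (h z))\<bar>) R + n * ln 4"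
  proof -
    have "M \<le> cmean (\<lambda>z. \<bar>ln (norm (h z))\<bar> + (\<Sum>a\<in>S. \<bar>zord h a\<bar> * (ln (4*R) - ln (norm (z - a))))) R"
      unfolding M_def
    proof (rule cmean_mono[OF ciL])
      fix z :: complex assume z: "norm z = R"
      have "\<bar>Re (L z)\<bar> = \<bar>ln (norm (h z)) - (\<Sum>a\<in>S. zord h a * (ln (norm (z - a)) - ln (4*R)))\<bar>"
        using L(2)[of z] z g(3) r by (simp add: good_radius_def)
      also have "\<dots> \<le> \<bar>ln (norm (h z))\<bar> + \<bar>\<Sum>a\<in>S. zord h a * (ln (norm (z - a)) - ln (4*R))\<bar>" by simp
      also have "\<bar>\<Sum>a\<in>S. zord h a * (ln (norm (z - a)) - ln (4*R))\<bar> \<le> (\<Sum>a\<in>S. \<bar>zord h a\<bar> * (ln (4*R) - ln (norm (z - a))))"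
      proof (rule order_trans[OF sum_abs], rule sum_mono)
        fix a assume a: "a \<in> S"
        have "norm (z - a) \<le> 4 * R" using norm_triangle_ineq4[of z a] a z r by (auto simp: S_def)
        moreover have "norm (z - a) > 0" using naR[OF a] z by auto
        ultimately have "ln (norm (z - a)) \<le> ln (4*R)" using r by (subst ln_le_cancel_iff) auto
        then show "\<bar>zord h a * (ln (norm (z - a)) - ln (4*R))\<bar> \<le> \<bar>zord h a\<bar> * (ln (4*R) - ln (norm (z - a)))"
          by (simp add: abs_mult)
      qed
      finally show "\<bar>Re (L z)\<bar> \<le> \<bar>ln (norm (h z))\<bar> + (\<Sum>a\<in>S. \<bar>zord h a\<bar> * (ln (4*R) - ln (norm (z - a))))" by simp
    qed (use r g(3) in \<open>auto intro!: circ_int_add circ_int_abs_ln_norm circ_int_sum fin ci1\<close>)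
    also have "\<dots> = cmean (\<lambda>z. \<bar>ln (norm (h z))\<bar>) R + cmean (\<lambda>z. \<Sum>a\<in>S. \<bar>zord h a\<bar> * (ln (4*R) - ln (norm (z - a)))) R"
      by (rule cmean_add) (use r g(3) in \<open>auto intro!: circ_int_abs_ln_norm circ_int_sum fin ci1\<close>)
    also have "cmean (\<lambda>z. \<Sum>a\<in>S. \<bar>zord h a\<bar> * (ln (4*R) - ln (norm (z - a)))) R
                = (\<Sum>a\<in>S. cmean (\<lambda>z. \<bar>zord h a\<bar> * (ln (4*R) - ln (norm (z - a)))) R)"
      by (rule cmean_sum[OF fin ci1])
    also have "\<dots> \<le> (\<Sum>a\<in>S. \<bar>zord h a\<bar> * ln 4)"
    proof (rule sum_mono)
      fix a assume a: "a \<in> S"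
      have "cmean (\<lambda>z. ln (4*R) - ln (norm (z - a))) R = ln (4*R) - ln (max R (norm a))"
        using naR[OF a] r by (subst cmean_diff) (auto simp: circ_int_ln_norm circ_int_const cmean_const cmean_ln_norm)
      also have "ln R \<le> ln (max R (norm a))" using r by (subst ln_le_cancel_iff) auto
      then have "ln (4*R) - ln (max R (norm a)) \<le> ln 4" using r by (simp add: ln_mult)
      finally show "cmean (\<lambda>z. \<bar>zord h a\<bar> * (ln (4*R) - ln (norm (z - a)))) R \<le> \<bar>zord h a\<bar> * ln 4"
        unfolding cmean_cmult by (intro mult_left_mono) auto
    qed
    also have "\<dots> = n * ln 4" by (simp add: n sum_distrib_right)
    finally show ?thesis by simp
  qed
  have M0: "M \<ge> 0" unfolding M_def using r by (intro cmean_nonneg) auto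
  have Ldiff: "norm (L (z + c) - L z) \<le> 8 / R * M" if "norm z = r" for z
  proof -
    \<comment> \<open>As 1/2 \<le> r/4 and r \<le> R/2, points of norm at most r + 1/2 have distance
      at least 3R/8 from the circle of radius R, and 2R / (3R/8)^2 \<le> 16 / R. The shift has norm
      1/2.\<close>
    have "norm (L (z + c) - L z) \<le> 16 / R * M * norm (z + c - z)"
    proof (rule field_differentiable_bound[of "cball 0 (r + 1/2)"])
      fix w :: complex assume w: "w \<in> cball 0 (r + 1/2)"
      then have wR: "norm w < R" using r by simp
      then show "(L has_field_derivative deriv L w) (at w within cball 0 (r + 1/2))"
        using r by (intro has_field_derivative_at_within[OF holomorphic_derivI[OF L(1)]]) auto
      have "norm (deriv L w) \<le> 2 * R / (R - norm w)^2 * M"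
        unfolding M_def by (rule norm_deriv_le_cmean_Re[OF L(1)]) (use r wR in auto)
      also have "\<dots> \<le> 16 / R * M"
      proof (rule mult_right_mono[OF _ M0])
        have "3/8 * R \<le> R - norm w" using w r by simp
        then have "(3/8 * R)^2 \<le> (R - norm w)^2" using r by (intro power_mono) auto
        then have "2 * R / (R - norm w)^2 \<le> 2 * R / (3/8 * R)^2" using r wR by (intro divide_left_mono) auto
        also have "\<dots> \<le> 16 / R" using r by (simp add: field_simps power2_eq_square)
        finally show "2 * R / (R - norm w)^2 \<le> 16 / R" .
      qed
      finally show "norm (deriv L w) \<le> 16 / R * M" .
    qed (use that c norm_triangle_ineq[of z c] in auto)
    then show ?thesis using c by simp
  qed
  \<comment> \<open>Zeros and poles enter with opposite signs, so the change of ln (norm (z - a)) is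
    bounded from both sides: one bound is centred at a, the other at a - c.\<close>
  define \<phi> where "\<phi> = (\<lambda>a z. ln (1 + (1/2) / norm (z - a)) + ln (1 + (1/2) / norm (z - (a - c))))"
  have ci\<phi>: "circ_int (\<phi> a) r" if "a \<in> S" for a
    unfolding \<phi>_def using nar[OF that] narc[OF that] r by (intro circ_int_add circ_int_ln_inverse_dist) auto
  have "cmean (\<lambda>z. ln_plus (norm (h (z + c) / h z))) r \<le> cmean (\<lambda>z. 8 / R * M + (\<Sum>a\<in>S. \<bar>zord h a\<bar> * \<phi> a z)) r"
  proof (rule cmean_mono)
    have "continuous_on (sphere 0 r) (\<lambda>z. h (z + c) / h z)"
      using good_radius_continuous[OF g(1)] good_radius_continuous[OF g(2)] good_radius_nz[OF g(1)]
      by (intro continuous_intros) auto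
    then show "circ_int (\<lambda>z. ln_plus (norm (h (z + c) / h z))) r" using r by (intro circ_int_ln_plus) auto
    show "circ_int (\<lambda>z. 8 / R * M + (\<Sum>a\<in>S. \<bar>zord h a\<bar> * \<phi> a z)) r"
      by (intro circ_int_add circ_int_const circ_int_sum circ_int_cmult ci\<phi> fin)
    fix z :: complex assume z: "norm z = r"
    have reg: "regular_at h z" "regular_at h (z + c)" using g(1) reg_shift z by (auto simp: good_radius_def)
    have lt: "norm z < 2*R" "norm (z + c) < 2*R" using z r c norm_triangle_ineq[of z c] by auto
    have pos: "\<phi> a z \<ge> 0" for a unfolding \<phi>_def by (intro add_nonneg_nonneg ln_ge_zero) auto
    have "ln (norm (h (z + c) / h z)) = ln (norm (h (z + c))) - ln (norm (h z))"
      using reg by (simp add: norm_divide ln_div regular_at_def)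
    also have "\<dots> = Re (L (z + c) - L z) + (\<Sum>a\<in>S. zord h a * (ln (norm (z + c - a)) - ln (norm (z - a))))"
    proof -
      have "(\<Sum>a\<in>S. zord h a * (ln (norm (z + c - a)) - ln (4*R))) - (\<Sum>a\<in>S. zord h a * (ln (norm (z - a)) - ln (4*R)))
          = (\<Sum>a\<in>S. zord h a * (ln (norm (z + c - a)) - ln (norm (z - a))))"
        unfolding sum_subtractf[symmetric] right_diff_distrib[symmetric] by simp
      then show ?thesis
        unfolding L(2)[OF lt(1) reg(1)] L(2)[OF lt(2) reg(2)] minus_complex.sel by linarith
    qed
    also have "\<dots> \<le> 8 / R * M + (\<Sum>a\<in>S. \<bar>zord h a\<bar> * \<phi> a z)"
    proof (rule add_mono)
      show "Re (L (z + c) - L z) \<le> 8 / R * M"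
        using Ldiff[OF z] complex_Re_le_cmod[of "L (z + c) - L z"] by linarith
      show "(\<Sum>a\<in>S. zord h a * (ln (norm (z + c - a)) - ln (norm (z - a)))) \<le> (\<Sum>a\<in>S. \<bar>zord h a\<bar> * \<phi> a z)"
      proof (rule sum_mono)
        fix a assume a: "a \<in> S"
        have nz: "z - a \<noteq> 0" "z + c - a \<noteq> 0" using regS[OF a] reg by auto
        define d where "d = ln (norm (z + c - a)) - ln (norm (z - a))"
        have 1: "d \<le> ln (1 + (1/2) / norm (z - a))"
          unfolding d_def by (rule ln_norm_shift_le) (use nz c in auto)
        have "- d \<le> ln (1 + (1/2) / norm (z + c - a))"
          using ln_norm_shift_le[of "z - a" "z + c - a"] nz c by (auto simp: d_def)
        then have 2: "- d \<le> ln (1 + (1/2) / norm (z - (a - c)))" by (simp add: algebra_simps)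
        have 3: "ln (1 + (1/2) / norm (z - a)) \<ge> 0" "ln (1 + (1/2) / norm (z - (a - c))) \<ge> 0" by (intro ln_ge_zero; simp)+
        then have "\<bar>d\<bar> \<le> \<phi> a z" unfolding \<phi>_def using 1 2 3 by linarith
        then have "\<bar>zord h a * d\<bar> \<le> \<bar>zord h a\<bar> * \<phi> a z" by (simp add: abs_mult mult_left_mono)
        then show "zord h a * (ln (norm (z + c - a)) - ln (norm (z - a))) \<le> \<bar>zord h a\<bar> * \<phi> a z"
          unfolding d_def by linarith
      qed
    qed
    finally have 1: "ln (norm (h (z + c) / h z)) \<le> 8 / R * M + (\<Sum>a\<in>S. \<bar>zord h a\<bar> * \<phi> a z)" .
    have "norm (h (z + c) / h z) > 0" using reg by (simp add: regular_at_def)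
    moreover have "0 \<le> 8 / R * M + (\<Sum>a\<in>S. \<bar>zord h a\<bar> * \<phi> a z)"
      using M0 r pos by (intro add_nonneg_nonneg sum_nonneg mult_nonneg_nonneg) auto
    ultimately show "ln_plus (norm (h (z + c) / h z)) \<le> 8 / R * M + (\<Sum>a\<in>S. \<bar>zord h a\<bar> * \<phi> a z)"
      using 1 by (simp add: ln_plus_eq)
  qed (use r in auto)
  also have "\<dots> = 8 / R * M + (\<Sum>a\<in>S. cmean (\<lambda>z. \<bar>zord h a\<bar> * \<phi> a z) r)"
  proof -
    have "circ_int (\<lambda>z. \<Sum>a\<in>S. \<bar>zord h a\<bar> * \<phi> a z) r"
      by (intro circ_int_sum circ_int_cmult ci\<phi> fin)
    from cmean_add[OF circ_int_const this] show ?thesis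
      using cmean_sum[OF fin circ_int_cmult[OF ci\<phi>]] by (simp only: cmean_const)
  qed
  also have "\<dots> \<le> 8 / R * M + (\<Sum>a\<in>S. \<bar>zord h a\<bar> * (2 * (log_const / sqrt r)))"
  proof (intro add_left_mono sum_mono)
    fix a assume a: "a \<in> S"
    have "cmean (\<phi> a) r = cmean (\<lambda>z. ln (1 + (1/2) / norm (z - a))) r + cmean (\<lambda>z. ln (1 + (1/2) / norm (z - (a - c)))) r"
      unfolding \<phi>_def using nar[OF a] narc[OF a] r by (intro cmean_add circ_int_ln_inverse_dist) auto
    also have "\<dots> \<le> log_const / sqrt r + log_const / sqrt r"
      using nar[OF a] narc[OF a] r by (intro add_mono cmean_ln_inverse_dist_le) auto
    finally have "cmean (\<phi> a) r \<le> 2 * (log_const / sqrt r)" by simp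
    then show "cmean (\<lambda>z. \<bar>zord h a\<bar> * \<phi> a z) r \<le> \<bar>zord h a\<bar> * (2 * (log_const / sqrt r))"
      unfolding cmean_cmult by (intro mult_left_mono) auto
  qed
  also have "\<dots> = 8 / R * M + n * (2 * (log_const / sqrt r))" by (simp only: n sum_distrib_right)
  also have "\<dots> \<le> 8 / R * (cmean (\<lambda>z. \<bar>ln (norm (h z))\<bar>) R + n * ln 4) + n * (2 * (log_const / sqrt r))"
    using M r by (intro add_right_mono mult_left_mono) auto
  finally show ?thesis .
qed

subsection \<open>Counting functions of shifted divisors\<close>

text \<open>Bounds the total change of the weights when points move by at most 1/2: by
  \<open>lam_lipschitz\<close> a point w costs at most 1 / max 1 (norm w). The radius r + 1 leaves
  room for points that a displacement moves out of the disc.\<close>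

definition shift_error :: "(complex \<Rightarrow> real) \<Rightarrow> real \<Rightarrow> real" where
  "shift_error M r = (\<Sum>w | norm w < r + 1 \<and> M w \<noteq> 0. M w / max 1 (norm w))"

lemma lam_lipschitz:
  assumes "norm (z - w) \<le> 1/2" "r > 0"
  shows "\<bar>lam r z - lam r w\<bar> \<le> 1 / max 1 (norm w)"
proof -
  define A where "A = max 1 (norm z)"
  define B where "B = max 1 (norm w)"
  have AB: "A \<ge> 1" "B \<ge> 1" by (auto simp: A_def B_def)
  have "\<bar>norm z - norm w\<bar> \<le> 1/2" using norm_triangle_ineq3[of z w] assms by simp
  then have d: "\<bar>A - B\<bar> \<le> 1/2" by (auto simp: A_def B_def max_def)
  have 1: "ln A - ln B \<le> 1 / B"
  proof -
    have "ln A - ln B = ln (A / B)" using AB by (simp add: ln_div)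
    also have "\<dots> \<le> A / B - 1" using AB by (intro ln_le_minus_one) auto
    also have "\<dots> = (A - B) / B" using AB by (simp add: field_simps)
    also have "\<dots> \<le> 1 / B" using AB d by (intro divide_right_mono) linarith+
    finally show ?thesis .
  qed
  have 2: "ln B - ln A \<le> 1 / B"
  proof -
    have "ln B - ln A = ln (B / A)" using AB by (simp add: ln_div)
    also have "\<dots> \<le> B / A - 1" using AB by (intro ln_le_minus_one) auto
    also have "\<dots> = (B - A) / A" using AB by (simp add: field_simps)
    also have "\<dots> \<le> (1/2) / A" using AB d by (intro divide_right_mono) linarith+
    also have "\<dots> \<le> (1/2) / (B / 2)"
    proof (rule divide_left_mono)
      show "B / 2 \<le> A" using AB d by linarith
    qed (use AB in auto)
    finally show ?thesis by simp
  qed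
  have "lam r z = max 0 (ln r - ln A)" "lam r w = max 0 (ln r - ln B)"
    using assms(2) AB by (auto simp: lam_def A_def B_def ln_div)
  then show ?thesis using 1 2 AB unfolding B_def[symmetric] by (auto simp: max_def)
qed

lemma locfin_shift: 
  assumes "locfin M"
  shows "locfin (\<lambda>z. M (z + c))"
  unfolding locfin_def
proof
  fix R
  have "finite ((\<lambda>z. z - c) ` {z. norm z \<le> R + norm c \<and> M z \<noteq> 0})"
    using assms by (auto simp: locfin_def)
  moreover have "{z. norm z \<le> R \<and> M (z + c) \<noteq> 0} \<subseteq> (\<lambda>z. z - c) ` {z. norm z \<le> R + norm c \<and> M z \<noteq> 0}"
  proof
    fix z assume "z \<in> {z. norm z \<le> R \<and> M (z + c) \<noteq> 0}"
    then have "z + c \<in> {z. norm z \<le> R + norm c \<and> M z \<noteq> 0}" using norm_triangle_ineq[of z c] by auto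
    then show "z \<in> (\<lambda>z. z - c) ` {z. norm z \<le> R + norm c \<and> M z \<noteq> 0}" by force
  qed
  ultimately show "finite {z. norm z \<le> R \<and> M (z + c) \<noteq> 0}" by (rule finite_subset[rotated])
qed

lemma sum_le_Ncount:
  assumes "locfin M" "\<And>z. M z \<ge> 0" "finite T" "r > 0"
  shows "(\<Sum>z\<in>T. M z * lam r z) \<le> Ncount M r"
proof -
  have "(\<Sum>z\<in>T. M z * lam r z) \<le> (\<Sum>z\<in>T \<union> {z. norm z < r \<and> M z \<noteq> 0}. M z * lam r z)"
    using assms by (intro sum_mono2) (auto intro!: mult_nonneg_nonneg lam_nonneg locfin_finite)
  also have "\<dots> = Ncount M r"
    by (rule Ncount_superset[symmetric]) (use assms in \<open>auto intro: locfin_finite\<close>)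
  finally show ?thesis .
qed

lemma sum_le_shift_error:
  assumes "locfin M" "\<And>z. M z \<ge> 0" "finite T" "\<And>z. z \<in> T \<Longrightarrow> norm z < r + 1"
  shows "(\<Sum>w\<in>T. M w / max 1 (norm w)) \<le> shift_error M r"
proof -
  have "(\<Sum>w\<in>T. M w / max 1 (norm w)) = (\<Sum>w\<in>T \<inter> {w. M w \<noteq> 0}. M w / max 1 (norm w))"
    using assms(3) by (intro sum.mono_neutral_right) auto
  also have "\<dots> \<le> shift_error M r"
    unfolding shift_error_def
    using assms by (intro sum_mono2) (auto intro!: locfin_finite divide_nonneg_nonneg)
  finally show ?thesis .
qed

lemma shift_error_nonneg: "(\<And>z. M z \<ge> 0) \<Longrightarrow> shift_error M r \<ge> 0"
  unfolding shift_error_def by (intro sum_nonneg divide_nonneg_nonneg) auto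

text \<open>Split at norm sqrt r. Inner points cost at most 1 each and are few, because the
  integrated count at r gives each of them weight at least ln r / 2. Outer points cost at most 1 /
  sqrt r each. The inner part is the origin of the denominator ln r in
  \<open>err_term\<close>.\<close>

lemma shift_error_le:
  assumes "locfin M" "\<And>z. M z \<ge> 0" "r \<ge> 2"
  shows "shift_error M r \<le> 2 * Ncount M r / ln r + ncount M (2 * r) / sqrt r"
proof -
  define T where "T = {w. norm w < r + 1 \<and> M w \<noteq> 0}"
  have fin: "finite T" unfolding T_def using assms by (intro locfin_finite)
  have sq: "1 \<le> sqrt r" "sqrt r \<le> r" using assms(3) by (auto simp: real_le_rsqrt real_le_lsqrt power2_eq_square)
  have lr: "ln r > 0" using assms(3) by simp
  have "shift_error M r \<le> (\<Sum>w\<in>T. (if norm w < sqrt r then M w else 0) + M w / sqrt r)"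
    unfolding shift_error_def T_def[symmetric]
  proof (rule sum_mono)
    fix w assume "w \<in> T"
    show "M w / max 1 (norm w) \<le> (if norm w < sqrt r then M w else 0) + M w / sqrt r"
    proof (cases "norm w < sqrt r")
      case True
      have "M w / max 1 (norm w) \<le> M w / 1" using assms(2) by (intro divide_left_mono) auto
      moreover have "M w / sqrt r \<ge> 0" using assms by auto
      ultimately show ?thesis using True by simp
    next
      case False
      then show ?thesis using assms sq by (auto intro!: divide_left_mono)
    qed
  qed
  also have "\<dots> = (\<Sum>w\<in>T. (if norm w < sqrt r then M w else 0)) + (\<Sum>w\<in>T. M w) / sqrt r"
    by (simp add: sum.distrib sum_divide_distrib)
  also have "(\<Sum>w\<in>T. (if norm w < sqrt r then M w else 0)) = ncount M (sqrt r)"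
    unfolding ncount_def using fin sq by (subst sum.inter_filter[symmetric]) (auto simp: T_def intro!: sum.cong)
  also have "\<dots> \<le> 2 * Ncount M r / ln r"
  proof -
    have "ncount M (sqrt r) * (ln r - ln (sqrt r)) \<le> Ncount M r"
      using assms sq by (intro ncount_le_Ncount) auto
    then show ?thesis using lr assms(3) by (simp add: ln_sqrt field_simps)
  qed
  also have "(\<Sum>w\<in>T. M w) \<le> ncount M (2 * r)"
    unfolding ncount_def T_def using assms by (intro sum_mono2 locfin_finite) auto
  finally show ?thesis using assms(3) by (simp add: divide_right_mono)
qed

lemma Ncount_le_shift:
  assumes "locfin M" "\<And>z. M z \<ge> 0" "norm c \<le> 1/2" "r > 0"
  shows "Ncount M r \<le> Ncount (\<lambda>z. M (z + c)) r + shift_error M r"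
proof -
  define T where "T = {w. norm w < r \<and> M w \<noteq> 0}"
  have fin: "finite T" unfolding T_def using assms by (intro locfin_finite)
  have "Ncount M r \<le> (\<Sum>w\<in>T. M w * lam r (w - c) + M w / max 1 (norm w))"
    unfolding Ncount_def T_def[symmetric]
  proof (rule sum_mono)
    fix w assume "w \<in> T"
    have "lam r w \<le> lam r (w - c) + 1 / max 1 (norm w)"
      using lam_lipschitz[of "w - c" w r] assms by (auto simp: abs_le_iff)
    from mult_left_mono[OF this assms(2)[of w]]
    show "M w * lam r w \<le> M w * lam r (w - c) + M w / max 1 (norm w)" by (simp add: algebra_simps)
  qed
  also have "\<dots> = (\<Sum>w\<in>T. M w * lam r (w - c)) + (\<Sum>w\<in>T. M w / max 1 (norm w))" by (simp add: sum.distrib)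
  also have "(\<Sum>w\<in>T. M w * lam r (w - c)) = (\<Sum>z\<in>(\<lambda>w. w - c) ` T. M (z + c) * lam r z)"
    by (subst sum.reindex) (auto simp: inj_on_def)
  also have "\<dots> \<le> Ncount (\<lambda>z. M (z + c)) r"
    using assms fin by (intro sum_le_Ncount locfin_shift) auto
  also have "(\<Sum>w\<in>T. M w / max 1 (norm w)) \<le> shift_error M r"
    using assms fin by (intro sum_le_shift_error) (auto simp: T_def)
  finally show ?thesis by simp
qed

text \<open>By injectivity no point is charged twice, so \<open>M'\<close> is paid for by a single
  copy of \<open>M\<close>. Each of the finitely many exceptions has weight at most ln r.\<close>

lemma Ncount_displaced_le:
  assumes M: "locfin M" "\<And>z. M z \<ge> 0" and M': "locfin M'" "\<And>z. M' z \<ge> 0"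
    and w: "inj w" "\<And>z. norm (w z - z) \<le> 1/2" and E: "finite E" "\<And>z. z \<notin> E \<Longrightarrow> M' z \<le> M (w z)" and r: "r \<ge> 1"
  shows "Ncount M' r \<le> Ncount M r + shift_error M r + (\<Sum>z\<in>E. M' z) * ln r"
proof -
  define T where "T = {w. norm w < r \<and> M' w \<noteq> 0}"
  have fin: "finite T" unfolding T_def using M' by (intro locfin_finite)
  have inj: "inj_on w A" for A using w(1) by (rule inj_on_subset) auto
  have "Ncount M' r = (\<Sum>z\<in>T. M' z * lam r z)" by (simp add: Ncount_def T_def)
  also have "\<dots> = (\<Sum>z\<in>T \<inter> E. M' z * lam r z) + (\<Sum>z\<in>T - E. M' z * lam r z)"
    using fin by (subst sum.union_disjoint[symmetric]) (auto intro!: sum.cong)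
  also have "(\<Sum>z\<in>T \<inter> E. M' z * lam r z) \<le> (\<Sum>z\<in>E. M' z * lam r z)"
    using E(1) M' by (intro sum_mono2 mult_nonneg_nonneg lam_nonneg) auto
  also have "\<dots> \<le> (\<Sum>z\<in>E. M' z * ln r)"
    using r M' by (intro sum_mono mult_left_mono lam_le_ln) auto
  also have "\<dots> = (\<Sum>z\<in>E. M' z) * ln r" by (simp add: sum_distrib_right)
  also have "(\<Sum>z\<in>T - E. M' z * lam r z) \<le> (\<Sum>z\<in>T - E. M (w z) * lam r (w z) + M (w z) / max 1 (norm (w z)))"
  proof (rule sum_mono)
    fix z assume z: "z \<in> T - E"
    have "lam r z \<le> lam r (w z) + 1 / max 1 (norm (w z))"
      using lam_lipschitz[of z "w z" r] w(2)[of z] r by (auto simp: abs_le_iff norm_minus_commute)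
    then have "M' z * lam r z \<le> M (w z) * (lam r (w z) + 1 / max 1 (norm (w z)))"
      using E(2)[of z] z M by (intro mult_mono lam_nonneg) auto
    then show "M' z * lam r z \<le> M (w z) * lam r (w z) + M (w z) / max 1 (norm (w z))" by (simp add: algebra_simps)
  qed
  also have "\<dots> = (\<Sum>v\<in>w ` (T - E). M v * lam r v) + (\<Sum>v\<in>w ` (T - E). M v / max 1 (norm v))"
    by (simp add: sum.distrib sum.reindex[OF inj])
  also have "(\<Sum>v\<in>w ` (T - E). M v * lam r v) \<le> Ncount M r"
    using M fin r by (intro sum_le_Ncount) auto
  also have "(\<Sum>v\<in>w ` (T - E). M v / max 1 (norm v)) \<le> shift_error M r"
  proof (intro sum_le_shift_error M finite_imageI finite_Diff fin)
    fix v assume "v \<in> w ` (T - E)"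
    then obtain z where z: "z \<in> T" "v = w z" by auto
    then show "norm v < r + 1" using w(2)[of z] norm_triangle_sub[of "w z" z] by (auto simp: T_def)
  qed
  finally show ?thesis by simp
qed

subsection \<open>The characteristic function\<close>

definition zdiv :: "(complex \<Rightarrow> complex) \<Rightarrow> complex \<Rightarrow> real" where
  "zdiv h z = max 0 (zord h z)"

definition pdiv :: "(complex \<Rightarrow> complex) \<Rightarrow> complex \<Rightarrow> real" where
  "pdiv h z = max 0 (- zord h z)"

text \<open>The Nevanlinna characteristic with the truncated counting function. Its link to
  \<open>nevanlinna_char\<close> is the one-sided estimate \<open>nchar_square_le\<close>.\<close>

definition nchar :: "(complex \<Rightarrow> complex) \<Rightarrow> real \<Rightarrow> real" where
  "nchar g r = cmean (\<lambda>z. ln_plus (norm (g z))) r + Ncount (pdiv g) r"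

text \<open>Phrased through the differences g - a, since these are the functions to which Jensen's
  formula is applied.\<close>

definition nonconst :: "(complex \<Rightarrow> complex) \<Rightarrow> bool" where
  "nonconst g \<longleftrightarrow> (\<forall>a. mero_nz (\<lambda>z. g z - a))"

lemma nonconst_mero_nz: "nonconst g \<Longrightarrow> mero_nz (\<lambda>z. g z - a)"
  by (simp add: nonconst_def)

lemma nonconst_mero_nz0: "nonconst g \<Longrightarrow> mero_nz g"
  using nonconst_mero_nz[of g 0] by simp

lemma zdiv_nonneg: "zdiv h z \<ge> 0" by (simp add: zdiv_def)
lemma pdiv_nonneg: "pdiv h z \<ge> 0" by (simp add: pdiv_def)
lemma zord_eq_zdiv_pdiv: "zord h z = zdiv h z - pdiv h z" by (simp add: zdiv_def pdiv_def)
lemma abs_zord_eq: "\<bar>zord h z\<bar> = zdiv h z + pdiv h z" by (simp add: zdiv_def pdiv_def)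

lemma locfin_zdiv: "mero_nz h \<Longrightarrow> locfin (zdiv h)"
  by (rule locfin_comb[OF locfin_zord locfin_zord]) (auto simp: zdiv_def)
lemma locfin_pdiv: "mero_nz h \<Longrightarrow> locfin (pdiv h)"
  by (rule locfin_comb[OF locfin_zord locfin_zord]) (auto simp: pdiv_def)

lemma Ncount_zord:
  assumes "mero_nz h" "r > 0"
  shows "Ncount (zord h) r = Ncount (zdiv h) r - Ncount (pdiv h) r"
proof -
  have e: "zord h = (\<lambda>z. zdiv h z + (-1) * pdiv h z)" by (auto simp: zord_eq_zdiv_pdiv)
  have l: "locfin (\<lambda>z. (-1) * pdiv h z)"
    by (rule locfin_comb[OF locfin_pdiv locfin_pdiv]) (use assms in auto)
  show ?thesis unfolding e Ncount_add[OF locfin_zdiv[OF assms(1)] l assms(2)] Ncount_cmult by simp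
qed

lemma zorder_shift_arg: "zorder (\<lambda>z. h (z + c)) z = zorder h (z + c)"
proof -
  have "zorder (\<lambda>z. h (z + c)) z = zorder (\<lambda>u. h (u + z + c)) 0" by (rule zorder_shift)
  also have "\<dots> = zorder h (z + c)" by (subst (2) zorder_shift) (simp add: add_ac)
  finally show ?thesis .
qed

lemma mero_nz_shift:
  assumes "mero_nz h"
  shows "mero_nz (\<lambda>z. h (z + c))"
proof (subst mero_nz_iff_frequently)
  show "(\<lambda>z. h (z + c)) meromorphic_on UNIV"
    by (rule meromorphic_on_compose[OF mero_nz_meromorphic[OF assms, of UNIV]]) (auto intro!: analytic_intros)
  have "frequently (\<lambda>w. h w \<noteq> 0) (at c)" by (rule mero_nz_frequently[OF assms])
  then have "frequently (\<lambda>w. h (w + c) \<noteq> 0) (at 0)"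
    by (simp add: at_to_0[of c] frequently_filtermap add.commute)
  then show "\<exists>z. frequently (\<lambda>w. h (w + c) \<noteq> 0) (at z)" by blast
qed

lemma zord_diff_const:
  assumes "nonconst g" "zorder (\<lambda>z. g z - a) z < 0"
  shows "zorder (\<lambda>z. g z - b) z = zorder (\<lambda>z. g z - a) z"
proof (cases "a = b")
  case False
  have "zorder (\<lambda>z. (g z - a) - (b - a)) z = zorder (\<lambda>z. g z - a) z"
    using False assms(2)
    by (intro zorder_diff1[OF mero_nz_meromorphic[OF nonconst_mero_nz[OF assms(1)]]
          mero_nz_frequently[OF nonconst_mero_nz[OF assms(1)]] meromorphic_on_const]) auto
  then show ?thesis by simp
qed auto

lemma pdiv_diff_const:
  assumes "nonconst g"
  shows "pdiv (\<lambda>z. g z - a) = pdiv g"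
proof
  fix z
  show "pdiv (\<lambda>z. g z - a) z = pdiv g z"
  proof (cases "zorder (\<lambda>z. g z - a) z < 0 \<or> zorder (\<lambda>z. g z - 0) z < 0")
    case True
    then have "zorder (\<lambda>z. g z - a) z = zorder (\<lambda>z. g z - 0) z"
      using zord_diff_const[OF assms] by metis
    then show ?thesis by (simp add: pdiv_def zord_def)
  next
    case False
    then show ?thesis by (simp add: pdiv_def zord_def)
  qed
qed

lemma zorder_diff_const_unique:
  assumes "nonconst g" "a \<noteq> b" "zorder (\<lambda>z. g z - a) z > 0"
  shows "zorder (\<lambda>z. g z - b) z \<le> 0"
proof (rule ccontr)
  assume "\<not> zorder (\<lambda>z. g z - b) z \<le> 0"
  then have "zorder (\<lambda>z. (g z - a) - (g z - b)) z \<ge> 1"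
    using assms(2,3)
    by (intro zorder_diff_ge[OF mero_nz_meromorphic[OF nonconst_mero_nz[OF assms(1)]]
          mero_nz_frequently[OF nonconst_mero_nz[OF assms(1)]] 
          mero_nz_meromorphic[OF nonconst_mero_nz[OF assms(1)]]
          mero_nz_frequently[OF nonconst_mero_nz[OF assms(1)]]]) auto
  then show False using assms(2) by simp
qed

section \<open>The positive logarithm and the first main theorem\<close>

lemma ln_plus_mono: "x \<le> y \<Longrightarrow> ln_plus x \<le> ln_plus y"
  unfolding ln_plus_def by (subst ln_le_cancel_iff) auto

lemma ln_plus_mult:
  assumes "x \<ge> 0" "y \<ge> 0"
  shows "ln_plus (x * y) \<le> ln_plus x + ln_plus y"
proof -
  have "max 1 (x * y) \<le> max 1 x * max 1 y"
    using assms mult_mono[of 1 "max 1 x" 1 "max 1 y"] mult_mono[of x "max 1 x" y "max 1 y"] by auto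
  then have "ln (max 1 (x * y)) \<le> ln (max 1 x * max 1 y)" by (subst ln_le_cancel_iff) (auto intro!: mult_pos_pos)
  also have "\<dots> = ln (max 1 x) + ln (max 1 y)" by (rule ln_mult_pos) auto
  finally show ?thesis by (simp add: ln_plus_def)
qed

lemma ln_plus_add:
  assumes "x \<ge> 0" "y \<ge> 0"
  shows "ln_plus (x + y) \<le> ln_plus x + ln_plus y + ln 2"
proof -
  have 1: "max 1 x * max 1 y \<ge> max 1 x" "max 1 x * max 1 y \<ge> max 1 y"
    by (simp_all add: mult_le_cancel_left1 mult_le_cancel_right1)
  then have "max 1 (x + y) \<le> max 1 x * max 1 y * 2"
    using max.cobounded1[of 1 x] max.cobounded2[of x 1] max.cobounded2[of y 1] by simp
  then have "ln (max 1 (x + y)) \<le> ln (max 1 x * max 1 y * 2)" by (subst ln_le_cancel_iff) (auto intro!: mult_pos_pos)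
  also have "\<dots> = ln (max 1 x) + ln (max 1 y) + ln 2" by (subst ln_mult_pos; (subst ln_mult_pos)?) auto
  finally show ?thesis by (simp add: ln_plus_def)
qed

lemma ln_plus_diff_const:
  "ln_plus (norm (w - a)) \<le> ln_plus (norm w) + (ln_plus (norm a) + ln 2)"
  "ln_plus (norm w) \<le> ln_plus (norm (w - a)) + (ln_plus (norm a) + ln 2)"
proof -
  have "ln_plus (norm (w - a)) \<le> ln_plus (norm w + norm a)" by (intro ln_plus_mono norm_triangle_ineq4)
  also have "\<dots> \<le> ln_plus (norm w) + ln_plus (norm a) + ln 2" by (intro ln_plus_add) auto
  finally show "ln_plus (norm (w - a)) \<le> ln_plus (norm w) + (ln_plus (norm a) + ln 2)" by simp
  have "ln_plus (norm w) \<le> ln_plus (norm (w - a) + norm a)"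
    using norm_triangle_sub[of w a] by (intro ln_plus_mono) (simp add: add.commute)
  also have "\<dots> \<le> ln_plus (norm (w - a)) + ln_plus (norm a) + ln 2" by (intro ln_plus_add) auto
  finally show "ln_plus (norm w) \<le> ln_plus (norm (w - a)) + (ln_plus (norm a) + ln 2)" by simp
qed

lemma ln_eq_ln_plus_diff:
  assumes "x > 0"
  shows "ln x = ln_plus x - ln_plus (1 / x)" "\<bar>ln x\<bar> = ln_plus x + ln_plus (1 / x)"
  using assms by (auto simp: ln_plus_eq ln_div max_def)

lemma good_radius_circ_int:
  assumes "good_radius h r" "r \<ge> 0"
  shows "circ_int (\<lambda>z. ln_plus (norm (h z))) r" "circ_int (\<lambda>z. ln_plus (1 / norm (h z))) r"
proof -
  note c = good_radius_continuous[OF assms(1)]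
  show "circ_int (\<lambda>z. ln_plus (norm (h z))) r" using c assms(2) by (rule circ_int_ln_plus)
  have "circ_int (\<lambda>z. ln_plus (norm (1 / h z))) r"
    using c assms good_radius_nz[OF assms(1)] by (intro circ_int_ln_plus continuous_intros) auto
  then show "circ_int (\<lambda>z. ln_plus (1 / norm (h z))) r" by (simp add: norm_divide)
qed

lemma good_radius_continuous_diff:
  assumes "good_radius (\<lambda>z. g z - a) r"
  shows "continuous_on (sphere 0 r) g"
  using continuous_on_add[OF good_radius_continuous[OF assms] continuous_on_const[of _ a]] by simp

lemma cmean_ln_norm_split:
  assumes "good_radius h r" "r \<ge> 0"
  shows "cmean (\<lambda>z. ln (norm (h z))) r = cmean (\<lambda>z. ln_plus (norm (h z))) r - cmean (\<lambda>z. ln_plus (1 / norm (h z))) r"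
    and "cmean (\<lambda>z. \<bar>ln (norm (h z))\<bar>) r = cmean (\<lambda>z. ln_plus (norm (h z))) r + cmean (\<lambda>z. ln_plus (1 / norm (h z))) r"
proof -
  note ci = good_radius_circ_int[OF assms]
  have "cmean (\<lambda>z. ln (norm (h z))) r = cmean (\<lambda>z. ln_plus (norm (h z)) - ln_plus (1 / norm (h z))) r"
    using good_radius_nz[OF assms(1)] by (intro cmean_cong ln_eq_ln_plus_diff assms(2)) auto
  then show "cmean (\<lambda>z. ln (norm (h z))) r = cmean (\<lambda>z. ln_plus (norm (h z))) r - cmean (\<lambda>z. ln_plus (1 / norm (h z))) r"
    using cmean_diff[OF ci] by simp
  have "cmean (\<lambda>z. \<bar>ln (norm (h z))\<bar>) r = cmean (\<lambda>z. ln_plus (norm (h z)) + ln_plus (1 / norm (h z))) r"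
    using good_radius_nz[OF assms(1)] by (intro cmean_cong ln_eq_ln_plus_diff assms(2)) auto
  then show "cmean (\<lambda>z. \<bar>ln (norm (h z))\<bar>) r = cmean (\<lambda>z. ln_plus (norm (h z))) r + cmean (\<lambda>z. ln_plus (1 / norm (h z))) r"
    using cmean_add[OF ci] by simp
qed

lemma cmean_ln_plus_diff_const:
  assumes "good_radius (\<lambda>z. g z - a) r" "r \<ge> 0"
  shows "cmean (\<lambda>z. ln_plus (norm (g z - a))) r \<le> cmean (\<lambda>z. ln_plus (norm (g z))) r + (ln_plus (norm a) + ln 2)"
    and "cmean (\<lambda>z. ln_plus (norm (g z))) r \<le> cmean (\<lambda>z. ln_plus (norm (g z - a))) r + (ln_plus (norm a) + ln 2)"
proof -
  have ci: "circ_int (\<lambda>z. ln_plus (norm (g z))) r" "circ_int (\<lambda>z. ln_plus (norm (g z - a))) r"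
    using good_radius_continuous_diff[OF assms(1)] good_radius_continuous[OF assms(1)] assms(2) by (auto intro!: circ_int_ln_plus)
  have "cmean (\<lambda>z. ln_plus (norm (g z - a))) r \<le> cmean (\<lambda>z. ln_plus (norm (g z)) + (ln_plus (norm a) + ln 2)) r"
    by (intro cmean_mono ci circ_int_add circ_int_const ln_plus_diff_const assms(2))
  then show "cmean (\<lambda>z. ln_plus (norm (g z - a))) r \<le> cmean (\<lambda>z. ln_plus (norm (g z))) r + (ln_plus (norm a) + ln 2)"
    using cmean_add[OF ci(1) circ_int_const] by (simp add: cmean_const)
  have "cmean (\<lambda>z. ln_plus (norm (g z))) r \<le> cmean (\<lambda>z. ln_plus (norm (g z - a)) + (ln_plus (norm a) + ln 2)) r"
    by (intro cmean_mono ci circ_int_add circ_int_const ln_plus_diff_const assms(2))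
  then show "cmean (\<lambda>z. ln_plus (norm (g z))) r \<le> cmean (\<lambda>z. ln_plus (norm (g z - a))) r + (ln_plus (norm a) + ln 2)"
    using cmean_add[OF ci(2) circ_int_const] by (simp add: cmean_const)
qed

text \<open>Jensen's formula for g - a, with the proximity of g - a to infinity replaced by that of
  g at bounded cost. The estimate is two-sided because the first main theorem uses one direction and
  the main inequality the other.\<close>

lemma jensen_value:
  assumes "nonconst g"
  obtains C where "C \<ge> 0" "\<And>r. r > 1 \<Longrightarrow> good_radius (\<lambda>z. g z - a) r \<Longrightarrow>
     \<bar>cmean (\<lambda>z. ln_plus (norm (g z))) r - cmean (\<lambda>z. ln_plus (1 / norm (g z - a))) r
       - (Ncount (zdiv (\<lambda>z. g z - a)) r - Ncount (pdiv g) r)\<bar> \<le> C"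
proof -
  let ?h = "\<lambda>z. g z - a"
  obtain C where C: "\<And>r. r > 1 \<Longrightarrow> good_radius ?h r \<Longrightarrow>
     cmean (\<lambda>z. ln (norm (?h z))) r = C + Ncount (zord ?h) r"
    using jensen[OF nonconst_mero_nz[OF assms]] by blast
  show ?thesis
  proof (rule that[of "\<bar>C\<bar> + (ln_plus (norm a) + ln 2)"])
    fix r :: real assume r: "r > 1" "good_radius ?h r"
    have "Ncount (zord ?h) r = Ncount (zdiv ?h) r - Ncount (pdiv g) r"
      using Ncount_zord[OF nonconst_mero_nz[OF assms], of r a] r by (simp add: pdiv_diff_const[OF assms])
    then show "\<bar>cmean (\<lambda>z. ln_plus (norm (g z))) r - cmean (\<lambda>z. ln_plus (1 / norm (g z - a))) r
       - (Ncount (zdiv ?h) r - Ncount (pdiv g) r)\<bar> \<le> \<bar>C\<bar> + (ln_plus (norm a) + ln 2)"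
      using C[OF r] cmean_ln_norm_split(1)[OF r(2)] cmean_ln_plus_diff_const[OF r(2)] r(1) by auto
  qed (use ln_plus_nonneg[of "norm a"] in auto)
qed

lemma nchar_nonneg: "r \<ge> 0 \<Longrightarrow> nchar g r \<ge> 0"
  unfolding nchar_def by (intro add_nonneg_nonneg cmean_nonneg Ncount_nonneg ln_plus_nonneg pdiv_nonneg)

lemma Ncount_pdiv_le_nchar: "r \<ge> 0 \<Longrightarrow> Ncount (pdiv g) r \<le> nchar g r"
  unfolding nchar_def using cmean_nonneg[of r "\<lambda>z. ln_plus (norm (g z))"] ln_plus_nonneg by auto

text \<open>In the second estimate the mean of the absolute value is the sum of the proximities of g
  to a and of g - a to infinity, each at most the characteristic up to a constant.\<close>

lemma first_main:
  assumes "nonconst g"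
  obtains C where "C \<ge> 0"
    "\<And>r. r > 1 \<Longrightarrow> good_radius (\<lambda>z. g z - a) r \<Longrightarrow> Ncount (zdiv (\<lambda>z. g z - a)) r \<le> nchar g r + C"
    "\<And>r. r > 1 \<Longrightarrow> good_radius (\<lambda>z. g z - a) r \<Longrightarrow> cmean (\<lambda>z. \<bar>ln (norm (g z - a))\<bar>) r \<le> 2 * nchar g r + C"
proof -
  obtain C where C: "C \<ge> 0" "\<And>r. r > 1 \<Longrightarrow> good_radius (\<lambda>z. g z - a) r \<Longrightarrow>
     \<bar>cmean (\<lambda>z. ln_plus (norm (g z))) r - cmean (\<lambda>z. ln_plus (1 / norm (g z - a))) r
       - (Ncount (zdiv (\<lambda>z. g z - a)) r - Ncount (pdiv g) r)\<bar> \<le> C"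
    using jensen_value[OF assms] by blast
  have nn: "Ncount (zdiv (\<lambda>z. g z - a)) r \<ge> 0" "Ncount (pdiv g) r \<ge> 0" for r
    by (intro Ncount_nonneg zdiv_nonneg pdiv_nonneg)+
  have pl: "ln_plus (norm a) \<ge> 0" by (rule ln_plus_nonneg)
  show ?thesis
  proof (rule that[of "C + (ln_plus (norm a) + ln 2)"])
    fix r :: real assume r: "r > 1" "good_radius (\<lambda>z. g z - a) r"
    have p: "0 \<le> cmean (\<lambda>z. ln_plus (1 / norm (g z - a))) r"
      using r by (intro cmean_nonneg ln_plus_nonneg) auto
    show "Ncount (zdiv (\<lambda>z. g z - a)) r \<le> nchar g r + (C + (ln_plus (norm a) + ln 2))"
      using C(2)[OF r] p pl ln_gt_zero[of 2] unfolding nchar_def by linarith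
    show "cmean (\<lambda>z. \<bar>ln (norm (g z - a))\<bar>) r \<le> 2 * nchar g r + (C + (ln_plus (norm a) + ln 2))"
      using C(2)[OF r] nn[of r] cmean_ln_norm_split(2)[OF r(2)] cmean_ln_plus_diff_const(1)[OF r(2)] r(1)
      by (auto simp: nchar_def abs_le_iff)
  qed (use C(1) pl in auto)
qed

section \<open>Errors of size T / ln r\<close>

lemma ln_le_two_sqrt: "r \<ge> 1 \<Longrightarrow> ln r \<le> 2 * sqrt r"
  using ln_one_plus_le_sqrt[of "r - 1"] real_sqrt_le_mono[of "r - 1" r] by (simp del: real_sqrt_le_iff)

text \<open>Three radii occur because the logarithmic difference at r needs a circle mean at R and
  the number of zeros and poles in the disc of radius 2R; that number is bounded by integrated
  counts at R', hence by the characteristic there. The summand 1 absorbs additive constants.\<close>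

definition err_term :: "(complex \<Rightarrow> complex) \<Rightarrow> real \<Rightarrow> real \<Rightarrow> real \<Rightarrow> real" where
  "err_term g r R R' = (nchar g r + nchar g R + nchar g R' + 1) / ln r"

text \<open>Replaces the decay 1 / sqrt r by the weaker 1 / ln r, so that all errors share one
  shape.\<close>

lemma div_sqrt_le: "r \<ge> 2 \<Longrightarrow> x \<ge> 0 \<Longrightarrow> x / sqrt r \<le> 2 * x / ln r"
proof -
  assume r: "r \<ge> 2" "x \<ge> 0"
  then have "x / sqrt r = 2 * x / (2 * sqrt r)" by simp
  also have "\<dots> \<le> 2 * x / ln r" using r ln_le_two_sqrt[of r] by (intro divide_left_mono) auto
  finally show ?thesis .
qed

lemma log_const_nonneg: "log_const \<ge> 0"
  unfolding log_const_def by auto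

lemma ncount_le_of_Ncount:
  assumes "locfin M" "\<And>z. M z \<ge> 0" "1 \<le> s" "2 * s \<le> R"
  shows "ncount M s \<le> 2 * Ncount M R"
proof -
  have "1/2 \<le> ln (2::real)" using ln2_ge_two_thirds by simp
  also have "ln 2 \<le> ln R - ln s"
  proof -
    have "ln (2 * s) \<le> ln R" using assms by (subst ln_le_cancel_iff) auto
    then show ?thesis using assms by (simp add: ln_mult)
  qed
  finally have "ncount M s * (1/2) \<le> ncount M s * (ln R - ln s)"
    by (intro mult_left_mono ncount_nonneg assms)
  also have "\<dots> \<le> Ncount M R" using assms by (intro ncount_le_Ncount) auto
  finally show ?thesis by simp
qed

lemma log_difference_err:
  assumes g: "nonconst g" and c: "norm c = 1/2"
  obtains C where "C \<ge> 0" "\<And>r R R'. 2 \<le> r \<Longrightarrow> 4 * r \<le> R \<Longrightarrow> 4 * R \<le> R' \<Longrightarrow>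
     good_radius (\<lambda>z. g z - a) r \<Longrightarrow> good_radius (\<lambda>z. g (z + c) - a) r \<Longrightarrow>
     good_radius (\<lambda>z. g z - a) R \<Longrightarrow> good_radius (\<lambda>z. g z - a) R' \<Longrightarrow>
     cmean (\<lambda>z. ln_plus (norm ((g (z + c) - a) / (g z - a)))) r \<le> C * err_term g r R R'"
proof -
  let ?h = "\<lambda>z. g z - a"
  obtain K where K: "K \<ge> 0"
    "\<And>r. r > 1 \<Longrightarrow> good_radius ?h r \<Longrightarrow> Ncount (zdiv ?h) r \<le> nchar g r + K"
    "\<And>r. r > 1 \<Longrightarrow> good_radius ?h r \<Longrightarrow> cmean (\<lambda>z. \<bar>ln (norm (?h z))\<bar>) r \<le> 2 * nchar g r + K"
    using first_main[OF g] by blast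
  \<comment> \<open>Twice the coefficients 8, 8 ln 4 and 2 log_const of the bound below, the factor
    2 coming from \<open>div_sqrt_le\<close>.\<close>
  define B where "B = 16 + 16 * ln 4 + 4 * log_const"
  have B: "B \<ge> 0" using log_const_nonneg by (simp add: B_def)
  have h: "mero_nz ?h" by (rule nonconst_mero_nz[OF g])
  show ?thesis
  proof (rule that[of "B * (4 + 2 * K)"])
    fix r R R' :: real
    assume r: "2 \<le> r" "4 * r \<le> R" "4 * R \<le> R'" and gd: "good_radius ?h r" "good_radius (\<lambda>z. g (z + c) - a) r"
     "good_radius ?h R" "good_radius ?h R'"
    define n where "n = ncount (\<lambda>z. \<bar>zord ?h z\<bar>) (2 * R)"
    define m where "m = cmean (\<lambda>z. \<bar>ln (norm (?h z))\<bar>) R"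
    define X where "X = nchar g R + nchar g R' + 1"
    have T: "nchar g r \<ge> 0" "nchar g R \<ge> 0" "nchar g R' \<ge> 0" using r by (auto intro!: nchar_nonneg)
    have locf: "locfin (\<lambda>z. \<bar>zord ?h z\<bar>)" by (rule locfin_comb[OF locfin_zord[OF h] locfin_zord[OF h]]) auto
    have n0: "n \<ge> 0" unfolding n_def by (rule ncount_nonneg) auto
    have m0: "m \<ge> 0" unfolding m_def using r by (intro cmean_nonneg) auto
    have "n \<le> 2 * Ncount (\<lambda>z. \<bar>zord ?h z\<bar>) R'"
      unfolding n_def using r locf by (intro ncount_le_of_Ncount) auto
    also have "Ncount (\<lambda>z. \<bar>zord ?h z\<bar>) R' = Ncount (zdiv ?h) R' + Ncount (pdiv g) R'"
      unfolding abs_zord_eq pdiv_diff_const[OF g]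
      by (rule Ncount_add) (use r g h in \<open>auto intro!: locfin_zdiv locfin_pdiv nonconst_mero_nz0\<close>)
    finally have n1: "n \<le> 2 * (2 * nchar g R' + K)"
      using K(2)[of R'] Ncount_pdiv_le_nchar[of R' g] gd r by simp
    have m1: "m \<le> 2 * nchar g R + K" unfolding m_def using K(3) gd r by simp
    have X: "X \<ge> 0" "n \<le> (4 + 2 * K) * X" "m \<le> (4 + 2 * K) * X"
    proof -
      have "K * X \<ge> K * 1" using K(1) T by (intro mult_left_mono) (auto simp: X_def)
      then show "n \<le> (4 + 2 * K) * X" "m \<le> (4 + 2 * K) * X"
        using n1 m1 T K(1) unfolding distrib_right by (auto simp: X_def)
    qed (use T in \<open>auto simp: X_def\<close>)
    have "cmean (\<lambda>z. ln_plus (norm (?h (z + c) / ?h z))) r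
           \<le> 8 / R * (m + n * ln 4) + n * (2 * (log_const / sqrt r))"
      unfolding m_def n_def by (rule cmean_log_difference_le[OF h c]) (use r gd in auto)
    also have "8 / R * (m + n * ln 4) \<le> 8 / sqrt r * (m + n * ln 4)"
    proof (rule mult_right_mono)
      have "sqrt r \<le> r" using r by (intro real_le_lsqrt) (auto simp: power2_eq_square)
      then show "8 / R \<le> 8 / sqrt r" using r by (intro divide_left_mono) auto
    qed (use m0 n0 in auto)
    also have "8 / sqrt r * (m + n * ln 4) + n * (2 * (log_const / sqrt r)) = (8 * m + 8 * ln 4 * n + 2 * log_const * n) / sqrt r"
      by (simp add: add_divide_distrib distrib_left mult_ac)
    also have "\<dots> \<le> 2 * (8 * m + 8 * ln 4 * n + 2 * log_const * n) / ln r"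
      using r m0 n0 log_const_nonneg by (intro div_sqrt_le add_nonneg_nonneg mult_nonneg_nonneg) auto
    also have "\<dots> \<le> (B * ((4 + 2 * K) * X)) / ln r"
    proof (rule divide_right_mono)
      have "2 * (8 * m + 8 * ln 4 * n + 2 * log_const * n) = 16 * m + (16 * ln 4) * n + (4 * log_const) * n" by simp
      also have "\<dots> \<le> 16 * ((4 + 2 * K) * X) + (16 * ln 4) * ((4 + 2 * K) * X) + (4 * log_const) * ((4 + 2 * K) * X)"
        using X log_const_nonneg by (intro add_mono mult_left_mono) auto
      also have "\<dots> = B * ((4 + 2 * K) * X)" unfolding B_def distrib_right ..
      finally show "2 * (8 * m + 8 * ln 4 * n + 2 * log_const * n) \<le> B * ((4 + 2 * K) * X)" .
    qed (use r in auto)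
    also have "\<dots> = B * (4 + 2 * K) * (X / ln r)" by simp
    also have "\<dots> \<le> B * (4 + 2 * K) * err_term g r R R'"
      unfolding err_term_def X_def using B K T r by (intro mult_left_mono divide_right_mono) auto
    finally show "cmean (\<lambda>z. ln_plus (norm ((g (z + c) - a) / (g z - a)))) r \<le> B * (4 + 2 * K) * err_term g r R R'" by simp
  qed (use B K in auto)
qed

text \<open>The predicate \<open>good\<close> leaves open at which radii the count is controlled:
  good radii for the zeros of g - a, all radii above 1 for the poles.\<close>

lemma shift_error_err:
  assumes M: "locfin M" "\<And>z. M z \<ge> 0"
    and K: "\<And>r. r > 1 \<Longrightarrow> good r \<Longrightarrow> Ncount M r \<le> nchar g r + K" "K \<ge> 0"
  obtains C where "C \<ge> 0" "\<And>r R R'. 2 \<le> r \<Longrightarrow> 4 * r \<le> R \<Longrightarrow> 4 * R \<le> R' \<Longrightarrow> good r \<Longrightarrow> good R \<Longrightarrow>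
     shift_error M r \<le> C * err_term g r R R'"
proof (rule that[of "4 + 6 * K"])
  fix r R R' :: real
  assume r: "2 \<le> r" "4 * r \<le> R" "4 * R \<le> R'" and gd: "good r" "good R"
  have T: "nchar g r \<ge> 0" "nchar g R \<ge> 0" "nchar g R' \<ge> 0" using r by (auto intro!: nchar_nonneg)
  have lr: "ln r > 0" using r by simp
  have nc: "ncount M (2 * r) \<le> 2 * Ncount M R" using M r by (intro ncount_le_of_Ncount) auto
  have "shift_error M r \<le> 2 * Ncount M r / ln r + ncount M (2 * r) / sqrt r"
    using M r by (intro shift_error_le) auto
  also have "ncount M (2 * r) / sqrt r \<le> 2 * ncount M (2 * r) / ln r"
    using r M by (intro div_sqrt_le ncount_nonneg) auto
  also have "2 * Ncount M r / ln r + 2 * ncount M (2 * r) / ln r = (2 * Ncount M r + 2 * ncount M (2 * r)) / ln r"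
    by (simp add: add_divide_distrib)
  also have "\<dots> \<le> ((4 + 6 * K) * (nchar g r + nchar g R + nchar g R' + 1)) / ln r"
  proof (rule divide_right_mono)
    have "2 * Ncount M r + 2 * ncount M (2 * r) \<le> 2 * (nchar g r + K) + 4 * (nchar g R + K)"
      using nc K(1)[of r] K(1)[of R] gd r by simp
    also have "\<dots> \<le> (4 + 6 * K) * (nchar g r + nchar g R + nchar g R' + 1)"
    proof -
      have "6 * K * (nchar g r + nchar g R + nchar g R' + 1) \<ge> 6 * K * 1" using K(2) T by (intro mult_left_mono) auto
      then show ?thesis using T by (simp add: distrib_right)
    qed
    finally show "2 * Ncount M r + 2 * ncount M (2 * r) \<le> (4 + 6 * K) * (nchar g r + nchar g R + nchar g R' + 1)" .
  qed (use lr in auto)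
  finally show "shift_error M r \<le> (4 + 6 * K) * err_term g r R R'" by (simp add: err_term_def)
qed (use K in auto)

subsection \<open>The main inequality\<close>

definition cdiff :: "(complex \<Rightarrow> complex) \<Rightarrow> complex \<Rightarrow> complex" where
  "cdiff g z = g (z + \<i>/2) - g (z - \<i>/2)"

text \<open>Off a finite set, the larger of the two neighbouring multiplicities is dominated by the
  one at an injectively chosen point close to z. Counting the maxima then costs one copy of the
  counting function of M instead of two.\<close>

definition displaced :: "(complex \<Rightarrow> real) \<Rightarrow> bool" where
  "displaced M \<longleftrightarrow> (\<exists>E w. finite E \<and> inj w \<and> (\<forall>z. norm (w z - z) \<le> 1/2) \<and>
     (\<forall>z. z \<notin> E \<longrightarrow> max (M (z + \<i>/2)) (M (z - \<i>/2)) \<le> M (w z)))"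

lemma ln_plus_ratio_diff:
  fixes u v w a :: complex
  shows "ln_plus (norm ((u - v) / (w - a)))
           \<le> ln_plus (norm ((u - a) / (w - a))) + ln_plus (norm ((v - a) / (w - a))) + ln 2"
proof -
  have "(u - v) / (w - a) = (u - a) / (w - a) - (v - a) / (w - a)" by (simp add: diff_divide_distrib)
  then have "ln_plus (norm ((u - v) / (w - a))) \<le> ln_plus (norm ((u - a) / (w - a)) + norm ((v - a) / (w - a)))"
    by (intro ln_plus_mono) (metis norm_triangle_ineq4)
  also have "\<dots> \<le> ln_plus (norm ((u - a) / (w - a))) + ln_plus (norm ((v - a) / (w - a))) + ln 2"
    by (intro ln_plus_add) auto
  finally show ?thesis .
qed

lemma ln_plus_diff_le:
  fixes u v w a :: complex
  assumes "w \<noteq> a"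
  shows "ln_plus (norm (u - v)) \<le> ln_plus (norm w) + (ln_plus (norm ((u - a) / (w - a))) + ln_plus (norm ((v - a) / (w - a))))
           + (ln_plus (norm a) + 2 * ln 2)"
proof -
  have "ln_plus (norm (u - v)) = ln_plus (norm ((u - v) / (w - a)) * norm (w - a))"
    using assms by (simp add: norm_mult[symmetric])
  also have "\<dots> \<le> ln_plus (norm ((u - v) / (w - a))) + ln_plus (norm (w - a))" by (intro ln_plus_mult) auto
  finally show ?thesis using ln_plus_ratio_diff[of u v w a] ln_plus_diff_const(1)[of w a] by simp
qed

text \<open>The double sum covers every candidate for the value nearest to w, which varies with
  w.\<close>

definition sep_const :: "complex set \<Rightarrow> real" where
  "sep_const A = ln 2 + (\<Sum>b\<in>A. \<Sum>a\<in>A. ln_plus (2 / norm (a - b)))"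

text \<open>
  At most one of the values can be close to \<open>w\<close>, and for that one the reciprocal is controlled by
  the difference \<open>u - v\<close>.
\<close>

lemma sum_ln_plus_inverse_le:
  fixes u v w :: complex
  assumes A: "finite A" "w \<notin> A" and uv: "u \<noteq> v"
  shows "(\<Sum>a\<in>A. ln_plus (1 / norm (w - a)))
     \<le> ln_plus (1 / norm (u - v)) + (\<Sum>a\<in>A. ln_plus (norm ((u - a) / (w - a))) + ln_plus (norm ((v - a) / (w - a)))) + sep_const A"
proof (cases "A = {}")
  case True
  then show ?thesis using ln_plus_nonneg by (simp add: sep_const_def)
next
  case False
  obtain a0 where a0: "a0 \<in> A" "\<And>a. a \<in> A \<Longrightarrow> norm (w - a0) \<le> norm (w - a)"
    using ex_min_if_finite[of "(\<lambda>a. norm (w - a)) ` A"] A False by (auto simp: not_less)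
  have "(\<Sum>a\<in>A - {a0}. ln_plus (1 / norm (w - a))) \<le> (\<Sum>a\<in>A - {a0}. ln_plus (2 / norm (a - a0)))"
  proof (intro sum_mono ln_plus_mono)
    fix a assume a: "a \<in> A - {a0}"
    have "norm (a - a0) \<le> norm (w - a0) + norm (w - a)" using norm_triangle_ineq4[of "w - a0" "w - a"] by simp
    also have "\<dots> \<le> 2 * norm (w - a)" using a0(2)[of a] a by simp
    finally have 1: "norm (a - a0) \<le> 2 * norm (w - a)" .
    have "norm (a - a0) > 0" using a by auto
    moreover have "norm (w - a) > 0" using a A by auto
    ultimately show "1 / norm (w - a) \<le> 2 / norm (a - a0)" using 1 by (simp add: field_simps)
  qed
  also have "\<dots> \<le> (\<Sum>a\<in>A. ln_plus (2 / norm (a - a0)))" using A by (intro sum_mono2 ln_plus_nonneg) auto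
  also have "\<dots> \<le> (\<Sum>b\<in>A. \<Sum>a\<in>A. ln_plus (2 / norm (a - b)))"
    by (rule member_le_sum[OF a0(1)]) (use A in \<open>auto intro!: sum_nonneg ln_plus_nonneg\<close>)
  finally have 1: "(\<Sum>a\<in>A - {a0}. ln_plus (1 / norm (w - a))) \<le> sep_const A - ln 2" by (simp add: sep_const_def)
  have w: "w \<noteq> a0" using a0 A by auto
  have "ln_plus (1 / norm (w - a0)) = ln_plus (1 / norm (u - v) * norm ((u - v) / (w - a0)))"
    using uv w by (simp add: norm_divide)
  also have "\<dots> \<le> ln_plus (1 / norm (u - v)) + ln_plus (norm ((u - v) / (w - a0)))" by (intro ln_plus_mult) auto
  also have "ln_plus (norm ((u - v) / (w - a0)))
     \<le> (ln_plus (norm ((u - a0) / (w - a0))) + ln_plus (norm ((v - a0) / (w - a0)))) + ln 2"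
    by (rule ln_plus_ratio_diff)
  also have "ln_plus (norm ((u - a0) / (w - a0))) + ln_plus (norm ((v - a0) / (w - a0)))
    \<le> (\<Sum>a\<in>A. ln_plus (norm ((u - a) / (w - a))) + ln_plus (norm ((v - a) / (w - a))))"
    by (rule member_le_sum[OF a0(1)]) (use A in \<open>auto intro!: add_nonneg_nonneg ln_plus_nonneg\<close>)
  finally show ?thesis using 1 by (subst sum.remove[OF A(1) a0(1)]) simp
qed

text \<open>The sum of the two multiplicities is maximum plus minimum. The minimum is positive for
  at most one a, because g has only one value at z + i/2; for that a, writing \<open>cdiff g\<close>
  as a difference of two values of g - a shows a zero of at least this order. If every minimum is 0,
  the order of \<open>cdiff g\<close> is bounded below by minus the larger pole order.\<close>

lemma zorder_cdiff_ge:
  assumes g: "nonconst g" and D: "mero_nz (cdiff g)" and A: "finite A" "A \<noteq> {}"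
  shows "(\<Sum>a\<in>A. zdiv (\<lambda>z. g z - a) (z + \<i>/2) + zdiv (\<lambda>z. g z - a) (z - \<i>/2))
    \<le> zord (cdiff g) z + ((\<Sum>a\<in>A. max (zdiv (\<lambda>z. g z - a) (z + \<i>/2)) (zdiv (\<lambda>z. g z - a) (z - \<i>/2)))
        + max (pdiv g (z + \<i>/2)) (pdiv g (z - \<i>/2)))"
proof -
  define P where "P = (\<lambda>a. zdiv (\<lambda>z. g z - a) (z + \<i>/2))"
  define Q where "Q = (\<lambda>a. zdiv (\<lambda>z. g z - a) (z - \<i>/2))"
  define X where "X = max (pdiv g (z + \<i>/2)) (pdiv g (z - \<i>/2))"
  have X0: "X \<ge> 0" by (simp add: X_def pdiv_def)
  have PQ0: "P a \<ge> 0" "Q a \<ge> 0" for a by (simp_all add: P_def Q_def zdiv_def)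
  have key: "min (zord (\<lambda>z. g z - a) (z + \<i>/2)) (zord (\<lambda>z. g z - a) (z - \<i>/2)) \<le> zord (cdiff g) z" for a
  proof -
    let ?u = "\<lambda>z. g (z + \<i>/2) - a" and ?v = "\<lambda>z. g (z + (-(\<i>/2))) - a"
    have uv: "mero_nz ?u" "mero_nz ?v" using mero_nz_shift[OF nonconst_mero_nz[OF g]] by blast+
    have "min (zorder ?u z) (zorder ?v z) \<le> zorder (\<lambda>z. ?u z - ?v z) z"
    proof (rule zorder_diff_ge[OF mero_nz_meromorphic[OF uv(1)] mero_nz_frequently[OF uv(1)]
          mero_nz_meromorphic[OF uv(2)] mero_nz_frequently[OF uv(2)]])
      show "\<exists>\<^sub>F z in at z. ?u z \<noteq> ?v z"
        using mero_nz_frequently[OF D, of z] by (rule frequently_elim1) (auto simp: cdiff_def)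
    qed auto
    moreover have "(\<lambda>z. ?u z - ?v z) = cdiff g" by (auto simp: cdiff_def)
    moreover have "zorder ?u z = zorder (\<lambda>z. g z - a) (z + \<i>/2)" "zorder ?v z = zorder (\<lambda>z. g z - a) (z - \<i>/2)"
      using zorder_shift_arg[of "\<lambda>z. g z - a" "\<i>/2" z] zorder_shift_arg[of "\<lambda>z. g z - a" "-(\<i>/2)" z] by simp_all
    ultimately show ?thesis by (simp add: zord_def)
  qed
  have "(\<Sum>a\<in>A. min (P a) (Q a)) \<le> zord (cdiff g) z + X"
  proof (cases "\<exists>a\<in>A. min (P a) (Q a) > 0")
    case True
    then obtain a where a: "a \<in> A" "P a > 0" "Q a > 0" by auto
    have "min (P b) (Q b) = 0" if "b \<noteq> a" for b
    proof -
      have "zorder (\<lambda>z. g z - b) (z + \<i>/2) \<le> 0"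
        by (rule zorder_diff_const_unique[OF g, of a]) (use that a in \<open>auto simp: P_def zdiv_def zord_def\<close>)
      then have "P b = 0" by (simp add: P_def zdiv_def zord_def)
      then show ?thesis using PQ0[of b] by simp
    qed
    then have "(\<Sum>a\<in>A. min (P a) (Q a)) = min (P a) (Q a)"
      using A a by (subst sum.remove[OF A(1) a(1)]) (auto intro!: sum.neutral)
    also have "\<dots> = min (zord (\<lambda>z. g z - a) (z + \<i>/2)) (zord (\<lambda>z. g z - a) (z - \<i>/2))"
      using a by (auto simp: P_def Q_def zdiv_def)
    also have "\<dots> \<le> zord (cdiff g) z" by (rule key)
    finally show ?thesis using X0 by simp
  next
    case False
    then have "min (P a) (Q a) = 0" if "a \<in> A" for a using that PQ0[of a] by (smt (verit))
    then have 1: "(\<Sum>a\<in>A. min (P a) (Q a)) = 0" by simp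
    obtain a where a: "a \<in> A" using A by auto
    have "- pdiv g w \<le> zord (\<lambda>z. g z - a) w" for w
    proof -
      have "- pdiv (\<lambda>z. g z - a) w \<le> zord (\<lambda>z. g z - a) w" unfolding pdiv_def by linarith
      then show ?thesis by (simp only: pdiv_diff_const[OF g])
    qed
    from this[of "z + \<i>/2"] this[of "z - \<i>/2"] have "- X \<le> zord (cdiff g) z"
      using key[of a] unfolding X_def by linarith
    then show ?thesis using 1 by simp
  qed
  moreover have "P a + Q a = max (P a) (Q a) + min (P a) (Q a)" for a by simp
  then have "(\<Sum>a\<in>A. P a + Q a) = (\<Sum>a\<in>A. max (P a) (Q a)) + (\<Sum>a\<in>A. min (P a) (Q a))"
    by (simp only: sum.distrib)
  ultimately show ?thesis unfolding P_def Q_def X_def by linarith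
qed

lemma locfin_max_shift:
  assumes "locfin M" "\<And>z. M z \<ge> 0"
  shows "locfin (\<lambda>z. max (M (z + \<i>/2)) (M (z - \<i>/2)))"
  by (rule locfin_comb[OF locfin_shift[OF assms(1), of "\<i>/2"] locfin_shift[OF assms(1), of "-(\<i>/2)"]]) simp

lemma displaced_Ncount:
  assumes M: "locfin M" "\<And>z. M z \<ge> 0" and "displaced M"
  obtains K where "K \<ge> 0" "\<And>r. r \<ge> 1 \<Longrightarrow>
     Ncount (\<lambda>z. max (M (z + \<i>/2)) (M (z - \<i>/2))) r \<le> Ncount M r + shift_error M r + K * ln r"
proof -
  let ?M = "\<lambda>z. max (M (z + \<i>/2)) (M (z - \<i>/2))"
  obtain E w where E: "finite E" and w: "inj w" "\<And>z. norm (w z - z) \<le> 1/2"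
    and le: "\<And>z. z \<notin> E \<Longrightarrow> ?M z \<le> M (w z)"
    using assms(3) unfolding displaced_def by blast
  have M': "locfin ?M" "\<And>z. ?M z \<ge> 0" using locfin_max_shift[OF M] M(2) by (auto simp: le_max_iff_disj)
  show ?thesis
  proof (rule that)
    show "(\<Sum>z\<in>E. ?M z) \<ge> 0" by (intro sum_nonneg M'(2))
    fix r :: real assume "r \<ge> 1"
    then show "Ncount ?M r \<le> Ncount M r + shift_error M r + (\<Sum>z\<in>E. ?M z) * ln r"
      using Ncount_displaced_le[of M ?M w E r] M M' w E le by blast
  qed
qed

lemma Ncount_shift_le:
  assumes M: "locfin M" "\<And>z. M z \<ge> 0" and "norm c \<le> 1/2" "r \<ge> 1"
  shows "Ncount (\<lambda>z. M (z + c)) r \<le> Ncount M r + shift_error M r"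
  using Ncount_displaced_le[OF M, of "\<lambda>z. M (z + c)" "\<lambda>z. z + c" "{}" r] assms
  by (auto simp: locfin_shift inj_def)

text \<open>One radius has to suit all functions of the main inequality at once. The form z + -
  (i/2) matches the general shift z + c.\<close>

definition admissible :: "(complex \<Rightarrow> complex) \<Rightarrow> complex set \<Rightarrow> real \<Rightarrow> bool" where
  "admissible g A r \<longleftrightarrow> good_radius (cdiff g) r \<and>
     (\<forall>a\<in>A. good_radius (\<lambda>z. g z - a) r \<and> good_radius (\<lambda>z. g (z + \<i>/2) - a) r \<and> good_radius (\<lambda>z. g (z + - (\<i>/2)) - a) r)"

text \<open>Integrating \<open>zorder_cdiff_ge\<close> gives the zeros of the g - a nearly twice on
  the left and, since they are displaced, only once on the right, up to errors. One copy cancels.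
  What remains besides the order of \<open>cdiff g\<close> is the maximum of the two neighbouring
  pole orders.\<close>

lemma counting_inequality:
  assumes g: "nonconst g" and D: "mero_nz (cdiff g)" and A: "finite A" "A \<noteq> {}"
    and dA: "\<And>a. a \<in> A \<Longrightarrow> displaced (zdiv (\<lambda>z. g z - a))"
    and cases: "card A \<ge> 3 \<or> card A = 2 \<and> displaced (pdiv g)"
  obtains C where "C \<ge> 0" "\<And>r R R'. 2 \<le> r \<Longrightarrow> 4 * r \<le> R \<Longrightarrow> 4 * R \<le> R' \<Longrightarrow>
     admissible g A r \<Longrightarrow> admissible g A R \<Longrightarrow>
     (\<Sum>a\<in>A. Ncount (zdiv (\<lambda>z. g z - a)) r) \<le> Ncount (zord (cdiff g)) r + (real (card A) - 1) * Ncount (pdiv g) r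
       + C * err_term g r R R' + C * ln r"
proof -
  define Z where "Z = (\<lambda>a. zdiv (\<lambda>z. g z - a))"
  define mx where "mx = (\<lambda>M::complex \<Rightarrow> real. \<lambda>z. max (M (z + \<i>/2)) (M (z - \<i>/2)))"
  have Z: "locfin (Z a)" "Z a z \<ge> 0" for a z
    by (auto simp: Z_def zdiv_nonneg intro!: locfin_zdiv nonconst_mero_nz g)
  have p: "locfin (pdiv g)" "pdiv g z \<ge> 0" for z
    by (auto simp: pdiv_nonneg intro!: locfin_pdiv nonconst_mero_nz0 g)
  have locmx: "locfin (mx M)" if "locfin M" "\<And>z. M z \<ge> 0" for M unfolding mx_def using that by (rule locfin_max_shift)
  have "\<exists>K. K \<ge> 0 \<and> (\<forall>r\<ge>1. Ncount (mx (Z a)) r \<le> Ncount (Z a) r + shift_error (Z a) r + K * ln r)" if a: "a \<in> A" for a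
  proof -
    have da: "displaced (Z a)" unfolding Z_def by (rule dA[OF a])
    obtain K where "K \<ge> 0"
      "\<And>r. r \<ge> 1 \<Longrightarrow> Ncount (\<lambda>z. max (Z a (z + \<i>/2)) (Z a (z - \<i>/2))) r \<le> Ncount (Z a) r + shift_error (Z a) r + K * ln r"
      by (rule displaced_Ncount[OF Z da]) (rule that)
    then show ?thesis unfolding mx_def by (intro exI[of _ K]) simp
  qed
  from bchoice[OF ballI[OF this]] obtain K where "\<forall>a\<in>A. K a \<ge> 0 \<and> (\<forall>r\<ge>1. Ncount (mx (Z a)) r \<le> Ncount (Z a) r + shift_error (Z a) r + K a * ln r)" ..
  then have K: "\<And>a. a \<in> A \<Longrightarrow> K a \<ge> 0"
    "\<And>a r. a \<in> A \<Longrightarrow> r \<ge> 1 \<Longrightarrow> Ncount (mx (Z a)) r \<le> Ncount (Z a) r + shift_error (Z a) r + K a * ln r" by simp_all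
  have "\<exists>C. C \<ge> 0 \<and> (\<forall>r R R'. 2 \<le> r \<longrightarrow> 4 * r \<le> R \<longrightarrow> 4 * R \<le> R' \<longrightarrow> good_radius (\<lambda>z. g z - a) r \<longrightarrow> good_radius (\<lambda>z. g z - a) R \<longrightarrow>
     shift_error (Z a) r \<le> C * err_term g r R R')" for a
  proof -
    obtain K1 where K1: "K1 \<ge> 0" "\<And>r. r > 1 \<Longrightarrow> good_radius (\<lambda>z. g z - a) r \<Longrightarrow> Ncount (Z a) r \<le> nchar g r + K1"
      unfolding Z_def using first_main[OF g, of a thesis] by simp
    obtain C where "C \<ge> 0" "\<And>r R R'. 2 \<le> r \<Longrightarrow> 4 * r \<le> R \<Longrightarrow> 4 * R \<le> R' \<Longrightarrow> good_radius (\<lambda>z. g z - a) r \<Longrightarrow> good_radius (\<lambda>z. g z - a) R \<Longrightarrow>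
        shift_error (Z a) r \<le> C * err_term g r R R'"
      by (rule shift_error_err[where M = "Z a" and good = "good_radius (\<lambda>z. g z - a)" and g = g, OF Z K1(2,1)])
         (assumption | rule that)+
    then show ?thesis by (intro exI[of _ C]) simp
  qed
  from choice[OF allI[OF this]] obtain C1 where "\<forall>a. C1 a \<ge> 0 \<and> (\<forall>r R R'. 2 \<le> r \<longrightarrow> 4 * r \<le> R \<longrightarrow> 4 * R \<le> R' \<longrightarrow> good_radius (\<lambda>z. g z - a) r \<longrightarrow> good_radius (\<lambda>z. g z - a) R \<longrightarrow>
     shift_error (Z a) r \<le> C1 a * err_term g r R R')" ..
  then have C1: "\<And>a. C1 a \<ge> 0"
    "\<And>a r R R'. 2 \<le> r \<Longrightarrow> 4 * r \<le> R \<Longrightarrow> 4 * R \<le> R' \<Longrightarrow> good_radius (\<lambda>z. g z - a) r \<Longrightarrow> good_radius (\<lambda>z. g z - a) R \<Longrightarrow>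
     shift_error (Z a) r \<le> C1 a * err_term g r R R'" by simp_all
  obtain C2 where C2: "C2 \<ge> 0"
    "\<And>r R R'. 2 \<le> r \<Longrightarrow> 4 * r \<le> R \<Longrightarrow> 4 * R \<le> R' \<Longrightarrow> shift_error (pdiv g) r \<le> C2 * err_term g r R R'"
  proof (rule shift_error_err[OF p, of "\<lambda>r. r > 1" g 0])
    show "Ncount (pdiv g) r \<le> nchar g r + 0" if "r > 1" for r
      using Ncount_pdiv_le_nchar[of r g] that by simp
  qed auto
  \<comment> \<open>With at least three finite values two copies of the poles are affordable, so the
    maximum may be bounded by the sum over both neighbours. With two finite values only one copy is,
    and then the poles are displaced.\<close>
  obtain K2 where K2: "K2 \<ge> 0"
    "\<And>r. r \<ge> 1 \<Longrightarrow> Ncount (mx (pdiv g)) r \<le> (real (card A) - 1) * Ncount (pdiv g) r + 2 * shift_error (pdiv g) r + K2 * ln r"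
  proof -
    have N0: "Ncount (pdiv g) r \<ge> 0" "shift_error (pdiv g) r \<ge> 0" for r
      by (intro Ncount_nonneg shift_error_nonneg pdiv_nonneg)+
    show ?thesis
    proof (cases "card A \<ge> 3")
      case True
      have "Ncount (mx (pdiv g)) r \<le> (real (card A) - 1) * Ncount (pdiv g) r + 2 * shift_error (pdiv g) r + 0 * ln r" if "r \<ge> 1" for r
      proof -
        have l: "locfin (\<lambda>z. pdiv g (z + \<i>/2))" "locfin (\<lambda>z. pdiv g (z + - (\<i>/2)))" by (intro locfin_shift p)+
        have "Ncount (mx (pdiv g)) r \<le> Ncount (\<lambda>z. pdiv g (z + \<i>/2) + pdiv g (z + - (\<i>/2))) r"
          by (rule Ncount_mono[OF locmx[OF p] locfin_comb[OF l]]) (use that p in \<open>auto simp: mx_def\<close>)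
        also have "\<dots> = Ncount (\<lambda>z. pdiv g (z + \<i>/2)) r + Ncount (\<lambda>z. pdiv g (z + - (\<i>/2))) r"
          by (rule Ncount_add[OF l]) (use that in auto)
        also have "\<dots> \<le> 2 * Ncount (pdiv g) r + 2 * shift_error (pdiv g) r"
          using Ncount_shift_le[OF p, of "\<i>/2" r] Ncount_shift_le[OF p, of "- (\<i>/2)" r] that by simp
        also have "2 * Ncount (pdiv g) r \<le> (real (card A) - 1) * Ncount (pdiv g) r"
          using True N0 by (intro mult_right_mono) auto
        finally show ?thesis by simp
      qed
      then show ?thesis using that[of 0] by simp
    next
      case False
      then have "card A = 2" "displaced (pdiv g)" using cases by auto
      then obtain K where "K \<ge> 0" "\<And>r. r \<ge> 1 \<Longrightarrow> Ncount (mx (pdiv g)) r \<le> Ncount (pdiv g) r + shift_error (pdiv g) r + K * ln r"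
        using displaced_Ncount[OF p] unfolding mx_def by blast
      then show ?thesis using that[of K] N0(2) \<open>card A = 2\<close> by (fastforce intro: order_trans)
    qed
  qed
  \<comment> \<open>Each value incurs three shift errors: two from the shifts on the left and one
    from the displaced count on the right.\<close>
  define C where "C = (\<Sum>a\<in>A. 3 * C1 a + K a) + 2 * C2 + K2"
  have Cge: "(\<Sum>a\<in>A. 3 * C1 a) + 2 * C2 \<le> C" "(\<Sum>a\<in>A. K a) + K2 \<le> C" "C \<ge> 0"
    using C1 C2 K K2 by (auto simp: C_def sum.distrib sum_nonneg intro!: add_nonneg_nonneg)
  show ?thesis
  proof (rule that[of C])
    show "C \<ge> 0" by fact
    fix r R R' :: real
    assume r: "2 \<le> r" "4 * r \<le> R" "4 * R \<le> R'" and adm: "admissible g A r" "admissible g A R"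
    define e where "e = err_term g r R R'"
    have e0: "e \<ge> 0" unfolding e_def err_term_def using r
      by (intro divide_nonneg_nonneg add_nonneg_nonneg nchar_nonneg) auto
    have r0: "r > 0" "r \<ge> 1" using r by auto
    have se: "shift_error (Z a) r \<le> C1 a * e" if "a \<in> A" for a
      unfolding e_def using C1(2)[OF r] adm that by (auto simp: admissible_def)
    have sp: "shift_error (pdiv g) r \<le> C2 * e" unfolding e_def using C2(2)[OF r] .
    have l1: "locfin (\<lambda>z. Z a (z + \<i>/2))" "locfin (\<lambda>z. Z a (z + - (\<i>/2)))" for a by (intro locfin_shift Z)+
    have l2: "locfin (\<lambda>z. Z a (z + \<i>/2) + Z a (z + - (\<i>/2)))" for a by (rule locfin_comb[OF l1(1)[of a] l1(2)[of a]]) simp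
    have l3: "locfin (\<lambda>z. \<Sum>a\<in>A. mx (Z a) z)" by (rule Ncount_sum(2)[OF A(1) locmx[OF Z] r0(1)])
    have l4: "locfin (\<lambda>z. (\<Sum>a\<in>A. mx (Z a) z) + mx (pdiv g) z)" by (rule locfin_comb[OF l3 locmx[OF p]]) simp
    \<comment> \<open>Each shift changes a count by at most one shift error, so the two shifted
      divisors still count the zeros twice.\<close>
    have "(\<Sum>a\<in>A. 2 * Ncount (Z a) r - 2 * (C1 a * e)) \<le> (\<Sum>a\<in>A. Ncount (\<lambda>z. Z a (z + \<i>/2) + Z a (z + - (\<i>/2))) r)"
    proof (rule sum_mono)
      fix a assume a: "a \<in> A"
      have "Ncount (\<lambda>z. Z a (z + \<i>/2) + Z a (z + - (\<i>/2))) r = Ncount (\<lambda>z. Z a (z + \<i>/2)) r + Ncount (\<lambda>z. Z a (z + - (\<i>/2))) r"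
        by (rule Ncount_add[OF l1(1)[of a] l1(2)[of a] r0(1)])
      then show "2 * Ncount (Z a) r - 2 * (C1 a * e) \<le> Ncount (\<lambda>z. Z a (z + \<i>/2) + Z a (z + - (\<i>/2))) r"
        using se[OF a] Ncount_le_shift[OF Z, of "\<i>/2" r a] Ncount_le_shift[OF Z, of "- (\<i>/2)" r a] r0 by simp
    qed
    also have "\<dots> = Ncount (\<lambda>z. \<Sum>a\<in>A. Z a (z + \<i>/2) + Z a (z + - (\<i>/2))) r"
      by (rule Ncount_sum(1)[OF A(1) l2 r0(1), symmetric])
    also have "\<dots> \<le> Ncount (\<lambda>z. zord (cdiff g) z + ((\<Sum>a\<in>A. mx (Z a) z) + mx (pdiv g) z)) r"
    proof (rule Ncount_mono[OF Ncount_sum(2)[OF A(1) l2 r0(1)] locfin_comb[OF locfin_zord[OF D] l4] r0(1)])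
      fix z
      show "(\<Sum>a\<in>A. Z a (z + \<i>/2) + Z a (z + - (\<i>/2))) \<le> zord (cdiff g) z + ((\<Sum>a\<in>A. mx (Z a) z) + mx (pdiv g) z)"
        using zorder_cdiff_ge[OF g D A, of z] by (simp add: Z_def mx_def)
    qed simp
    also have "\<dots> = Ncount (zord (cdiff g)) r + ((\<Sum>a\<in>A. Ncount (mx (Z a)) r) + Ncount (mx (pdiv g)) r)"
      unfolding Ncount_add[OF locfin_zord[OF D] l4 r0(1)] Ncount_add[OF l3 locmx[OF p] r0(1)]
        Ncount_sum(1)[OF A(1) locmx[OF Z] r0(1)] ..
    also have "(\<Sum>a\<in>A. Ncount (mx (Z a)) r) \<le> (\<Sum>a\<in>A. Ncount (Z a) r + C1 a * e + K a * ln r)"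
      using K(2)[OF _ r0(2)] se by (intro sum_mono) (smt (verit))
    also have "Ncount (mx (pdiv g)) r \<le> (real (card A) - 1) * Ncount (pdiv g) r + 2 * (C2 * e) + K2 * ln r"
      using K2(2)[OF r0(2)] sp by simp
    finally have "(\<Sum>a\<in>A. 2 * Ncount (Z a) r - 2 * (C1 a * e)) \<le> Ncount (zord (cdiff g)) r
      + ((\<Sum>a\<in>A. Ncount (Z a) r + C1 a * e + K a * ln r) + ((real (card A) - 1) * Ncount (pdiv g) r + 2 * (C2 * e) + K2 * ln r))"
      by simp
    moreover have "(\<Sum>a\<in>A. 2 * Ncount (Z a) r - 2 * (C1 a * e)) = 2 * (\<Sum>a\<in>A. Ncount (Z a) r) - 2 * ((\<Sum>a\<in>A. C1 a) * e)"
      by (simp add: sum_subtractf sum_distrib_left sum_distrib_right)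
    moreover have "(\<Sum>a\<in>A. Ncount (Z a) r + C1 a * e + K a * ln r) = (\<Sum>a\<in>A. Ncount (Z a) r) + (\<Sum>a\<in>A. C1 a) * e + (\<Sum>a\<in>A. K a) * ln r"
      by (simp add: sum.distrib sum_distrib_right)
    ultimately have "(\<Sum>a\<in>A. Ncount (Z a) r) \<le> Ncount (zord (cdiff g)) r + (real (card A) - 1) * Ncount (pdiv g) r
      + ((3 * (\<Sum>a\<in>A. C1 a)) * e + 2 * C2 * e) + ((\<Sum>a\<in>A. K a) * ln r + K2 * ln r)" by (simp add: mult_ac)
    also have "(3 * (\<Sum>a\<in>A. C1 a)) * e + 2 * C2 * e \<le> C * e"
      using mult_right_mono[OF Cge(1) e0] by (simp add: distrib_right sum_distrib_left)
    also have "(\<Sum>a\<in>A. K a) * ln r + K2 * ln r \<le> C * ln r"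
      using mult_right_mono[OF Cge(2), of "ln r"] r by (simp add: distrib_right)
    finally show "(\<Sum>a\<in>A. Ncount (zdiv (\<lambda>z. g z - a)) r) \<le> Ncount (zord (cdiff g)) r + (real (card A) - 1) * Ncount (pdiv g) r
       + C * err_term g r R R' + C * ln r" by (simp add: Z_def e_def)
  qed
qed

text \<open>With q = card A, Jensen's formula summed over A bounds q (m + N), proximity and poles of
  g, by the proximities to the values plus their zeros. The former are paid by the proximity of
  \<open>cdiff g\<close> to 0, the latter by its divisor and q - 1 copies of the poles. Jensen's
  formula for \<open>cdiff g\<close> turns these two payments into its proximity to infinity, which
  is at most that of g up to errors.\<close>

lemma main_inequality:
  assumes g: "nonconst g" and D: "mero_nz (cdiff g)" and A: "finite A"
    and dA: "\<And>a. a \<in> A \<Longrightarrow> displaced (zdiv (\<lambda>z. g z - a))"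
    and cases: "card A \<ge> 3 \<or> card A = 2 \<and> displaced (pdiv g)"
  shows "\<exists>C\<ge>0. \<forall>r R R'. 2 \<le> r \<longrightarrow> 4 * r \<le> R \<longrightarrow> 4 * R \<le> R' \<longrightarrow>
     admissible g A r \<longrightarrow> admissible g A R \<longrightarrow> admissible g A R' \<longrightarrow>
     nchar g r \<le> C * err_term g r R R' + C * ln r"
proof -
  have q: "card A \<ge> 2" using cases by auto
  then have Ane: "A \<noteq> {}" by auto
  then obtain a1 where a1: "a1 \<in> A" by auto
  define ld where "ld = (\<lambda>c a r. cmean (\<lambda>z. ln_plus (norm ((g (z + c) - a) / (g z - a)))) r)"
  have "\<exists>J. \<forall>r. r > 1 \<longrightarrow> good_radius (\<lambda>z. g z - a) r \<longrightarrow>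
     cmean (\<lambda>z. ln_plus (norm (g z))) r - cmean (\<lambda>z. ln_plus (1 / norm (g z - a))) r
       - (Ncount (zdiv (\<lambda>z. g z - a)) r - Ncount (pdiv g) r) \<le> J" for a
  proof (rule jensen_value[OF g, of a])
    fix C assume C: "\<And>r. r > 1 \<Longrightarrow> good_radius (\<lambda>z. g z - a) r \<Longrightarrow>
     \<bar>cmean (\<lambda>z. ln_plus (norm (g z))) r - cmean (\<lambda>z. ln_plus (1 / norm (g z - a))) r
       - (Ncount (zdiv (\<lambda>z. g z - a)) r - Ncount (pdiv g) r)\<bar> \<le> C"
    show ?thesis by (rule exI[of _ C]) (use C in \<open>auto simp: abs_le_iff\<close>)
  qed
  from choice[OF allI[OF this]] obtain J where J: "\<forall>a r. r > 1 \<longrightarrow> good_radius (\<lambda>z. g z - a) r \<longrightarrow>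
     cmean (\<lambda>z. ln_plus (norm (g z))) r - cmean (\<lambda>z. ln_plus (1 / norm (g z - a))) r
       - (Ncount (zdiv (\<lambda>z. g z - a)) r - Ncount (pdiv g) r) \<le> J a" ..
  have "\<exists>L. L \<ge> 0 \<and> (\<forall>r R R'. 2 \<le> r \<longrightarrow> 4 * r \<le> R \<longrightarrow> 4 * R \<le> R' \<longrightarrow>
     good_radius (\<lambda>z. g z - a) r \<longrightarrow> good_radius (\<lambda>z. g (z + c) - a) r \<longrightarrow>
     good_radius (\<lambda>z. g z - a) R \<longrightarrow> good_radius (\<lambda>z. g z - a) R' \<longrightarrow>
     ld c a r \<le> L * err_term g r R R')" if c: "norm c = 1/2" for a c
  proof (rule log_difference_err[OF g c, of a])
    fix C assume C: "C \<ge> 0" "\<And>r R R'. 2 \<le> r \<Longrightarrow> 4 * r \<le> R \<Longrightarrow> 4 * R \<le> R' \<Longrightarrow>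
     good_radius (\<lambda>z. g z - a) r \<Longrightarrow> good_radius (\<lambda>z. g (z + c) - a) r \<Longrightarrow>
     good_radius (\<lambda>z. g z - a) R \<Longrightarrow> good_radius (\<lambda>z. g z - a) R' \<Longrightarrow>
     cmean (\<lambda>z. ln_plus (norm ((g (z + c) - a) / (g z - a)))) r \<le> C * err_term g r R R'"
    show ?thesis unfolding ld_def by (rule exI[of _ C]) (use C in auto)
  qed
  then have ex: "\<forall>a. \<exists>L. L \<ge> 0 \<and> (\<forall>r R R'. 2 \<le> r \<longrightarrow> 4 * r \<le> R \<longrightarrow> 4 * R \<le> R' \<longrightarrow>
     good_radius (\<lambda>z. g z - a) r \<longrightarrow> good_radius (\<lambda>z. g (z + c) - a) r \<longrightarrow>
     good_radius (\<lambda>z. g z - a) R \<longrightarrow> good_radius (\<lambda>z. g z - a) R' \<longrightarrow>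
     ld c a r \<le> L * err_term g r R R')" if "norm c = 1/2" for c
    using that by blast
  have "norm (\<i>/2) = 1/2" "norm (- (\<i>/2)) = 1/2" by simp_all
  from choice[OF ex[OF this(1)]] choice[OF ex[OF this(2)]]
  obtain L1 L2 where L: "\<forall>a. L1 a \<ge> 0 \<and> (\<forall>r R R'. 2 \<le> r \<longrightarrow> 4 * r \<le> R \<longrightarrow> 4 * R \<le> R' \<longrightarrow>
     good_radius (\<lambda>z. g z - a) r \<longrightarrow> good_radius (\<lambda>z. g (z + \<i>/2) - a) r \<longrightarrow>
     good_radius (\<lambda>z. g z - a) R \<longrightarrow> good_radius (\<lambda>z. g z - a) R' \<longrightarrow>
     ld (\<i>/2) a r \<le> L1 a * err_term g r R R')"
    "\<forall>a. L2 a \<ge> 0 \<and> (\<forall>r R R'. 2 \<le> r \<longrightarrow> 4 * r \<le> R \<longrightarrow> 4 * R \<le> R' \<longrightarrow>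
     good_radius (\<lambda>z. g z - a) r \<longrightarrow> good_radius (\<lambda>z. g (z + - (\<i>/2)) - a) r \<longrightarrow>
     good_radius (\<lambda>z. g z - a) R \<longrightarrow> good_radius (\<lambda>z. g z - a) R' \<longrightarrow>
     ld (- (\<i>/2)) a r \<le> L2 a * err_term g r R R')" by (elim exE)
  obtain CD where CD: "\<And>r. r > 1 \<Longrightarrow> good_radius (cdiff g) r \<Longrightarrow>
     cmean (\<lambda>z. ln (norm (cdiff g z))) r = CD + Ncount (zord (cdiff g)) r"
    by (rule jensen[OF D]) (rule that)
  obtain C3 where C3: "C3 \<ge> 0" "\<And>r R R'. 2 \<le> r \<Longrightarrow> 4 * r \<le> R \<Longrightarrow> 4 * R \<le> R' \<Longrightarrow>
     admissible g A r \<Longrightarrow> admissible g A R \<Longrightarrow>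
     (\<Sum>a\<in>A. Ncount (zdiv (\<lambda>z. g z - a)) r) \<le> Ncount (zord (cdiff g)) r + (real (card A) - 1) * Ncount (pdiv g) r
       + C3 * err_term g r R R' + C3 * ln r"
    by (rule counting_inequality[OF g D A Ane dA cases]) (assumption | rule that)+
  define SL where "SL = (\<Sum>a\<in>A. L1 a + L2 a)"
  define K0 where "K0 = \<bar>sep_const A\<bar> + \<bar>\<Sum>a\<in>A. J a\<bar> + \<bar>ln_plus (norm a1) + 2 * ln 2\<bar> + \<bar>CD\<bar>"
  define C where "C = 2 * SL + C3 + 2 * K0"
  have SL0: "SL \<ge> 0" unfolding SL_def using L by (intro sum_nonneg) auto
  have K0: "K0 \<ge> 0" unfolding K0_def by simp
  show ?thesis
  proof (intro exI[of _ C] conjI allI impI)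
    show "C \<ge> 0" using SL0 C3 K0 by (simp add: C_def)
    fix r R R' :: real
    assume r: "2 \<le> r" "4 * r \<le> R" "4 * R \<le> R'"
      and adm: "admissible g A r" "admissible g A R" "admissible g A R'"
    define e where "e = err_term g r R R'"
    have e0: "e \<ge> 0" unfolding e_def err_term_def using r
      by (intro divide_nonneg_nonneg add_nonneg_nonneg nchar_nonneg) auto
    have r1: "r > 1" "r \<ge> 0" using r by auto
    have gd: "good_radius (\<lambda>z. g z - a) r" "good_radius (\<lambda>z. g (z + \<i>/2) - a) r" "good_radius (\<lambda>z. g (z + - (\<i>/2)) - a) r"
      if "a \<in> A" for a using adm(1) that by (auto simp: admissible_def)
    have gD: "good_radius (cdiff g) r" using adm(1) by (simp add: admissible_def)
    define pm where "pm = cmean (\<lambda>z. ln_plus (norm (g z))) r"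
    define Np where "Np = Ncount (pdiv g) r"
    define ND where "ND = Ncount (zord (cdiff g)) r"
    define SN where "SN = (\<Sum>a\<in>A. Ncount (zdiv (\<lambda>z. g z - a)) r)"
    define mD where "mD = cmean (\<lambda>z. ln_plus (1 / norm (cdiff g z))) r"
    define pD where "pD = cmean (\<lambda>z. ln_plus (norm (cdiff g z))) r"
    define Sm where "Sm = (\<Sum>a\<in>A. cmean (\<lambda>z. ln_plus (1 / norm (g z - a))) r)"
    have pm0: "pm \<ge> 0" unfolding pm_def using r1 by (intro cmean_nonneg ln_plus_nonneg)
    define d where "d = (\<lambda>a z. ln_plus (norm ((g (z + \<i>/2) - a) / (g z - a))) + ln_plus (norm ((g (z + - (\<i>/2)) - a) / (g z - a))))"
    have cild: "circ_int (\<lambda>z. ln_plus (norm ((g (z + c) - a) / (g z - a)))) r"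
      if "good_radius (\<lambda>z. g z - a) r" "good_radius (\<lambda>z. g (z + c) - a) r" for a c
      using good_radius_continuous[OF that(1)] good_radius_continuous[OF that(2)] good_radius_nz[OF that(1)] r1
      by (intro circ_int_ln_plus continuous_on_divide) auto
    have cid: "circ_int (d a) r" if "a \<in> A" for a
      unfolding d_def by (intro circ_int_add cild gd that)
    have cmd: "cmean (d a) r \<le> (L1 a + L2 a) * e" if "a \<in> A" for a
    proof -
      have "cmean (d a) r = ld (\<i>/2) a r + ld (- (\<i>/2)) a r"
        unfolding d_def ld_def by (intro cmean_add cild gd that)
      moreover have "ld (\<i>/2) a r \<le> L1 a * e"
        using L(1) r gd[OF that] adm(2,3) that unfolding e_def by (simp add: admissible_def)
      moreover have "ld (- (\<i>/2)) a r \<le> L2 a * e"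
        using L(2) r gd[OF that] adm(2,3) that unfolding e_def by (simp add: admissible_def)
      ultimately show ?thesis by (simp add: distrib_right)
    qed
    have sumd: "(\<Sum>a\<in>A. cmean (d a) r) \<le> SL * e"
      unfolding SL_def sum_distrib_right by (intro sum_mono cmd)
    have d1: "cmean (d a1) r \<le> SL * e"
    proof -
      have "cmean (d a1) r \<le> (\<Sum>a\<in>A. cmean (d a) r)"
        by (rule member_le_sum[OF a1]) (use A r1 in \<open>auto intro!: cmean_nonneg add_nonneg_nonneg ln_plus_nonneg simp: d_def\<close>)
      then show ?thesis using sumd by simp
    qed
    have i1: "Sm \<le> mD + SL * e + sep_const A"
    proof -
      note ci = good_radius_circ_int(2)[OF gd(1) r1(2)]
      have "Sm = cmean (\<lambda>z. \<Sum>a\<in>A. ln_plus (1 / norm (g z - a))) r"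
        unfolding Sm_def by (rule cmean_sum[OF A ci, symmetric])
      also have "\<dots> \<le> cmean (\<lambda>z. (ln_plus (1 / norm (cdiff g z)) + (\<Sum>a\<in>A. d a z)) + sep_const A) r"
      proof (rule cmean_mono)
        fix z :: complex assume z: "norm z = r"
        have "g (z + \<i>/2) \<noteq> g (z - \<i>/2)" using good_radius_nz[OF gD z] by (auto simp: cdiff_def)
        moreover have "g z \<notin> A" using good_radius_nz[OF gd(1) z] by auto
        ultimately show "(\<Sum>a\<in>A. ln_plus (1 / norm (g z - a))) \<le> (ln_plus (1 / norm (cdiff g z)) + (\<Sum>a\<in>A. d a z)) + sep_const A"
          using sum_ln_plus_inverse_le[OF A, of "g z" "g (z + \<i>/2)" "g (z - \<i>/2)"] by (simp add: cdiff_def d_def)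
      qed (use A r1 in \<open>auto intro!: circ_int_sum ci circ_int_add circ_int_const cid good_radius_circ_int(2)[OF gD]\<close>)
      also have "\<dots> = cmean (\<lambda>z. ln_plus (1 / norm (cdiff g z)) + (\<Sum>a\<in>A. d a z)) r + cmean (\<lambda>z. sep_const A) r"
        by (intro cmean_add circ_int_add circ_int_const circ_int_sum A cid good_radius_circ_int(2)[OF gD] r1)
      also have "cmean (\<lambda>z. ln_plus (1 / norm (cdiff g z)) + (\<Sum>a\<in>A. d a z)) r = mD + cmean (\<lambda>z. \<Sum>a\<in>A. d a z) r"
        unfolding mD_def by (intro cmean_add circ_int_sum A cid good_radius_circ_int(2)[OF gD] r1)
      also have "cmean (\<lambda>z. \<Sum>a\<in>A. d a z) r = (\<Sum>a\<in>A. cmean (d a) r)" by (rule cmean_sum[OF A cid])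
      finally show ?thesis using sumd by (simp add: cmean_const)
    qed
    \<comment> \<open>Factoring g - a1 out of \<open>cdiff g\<close>, for any one value a1, leaves a
      difference of two ratios controlled by the logarithmic difference.\<close>
    have i2: "pD \<le> pm + SL * e + (ln_plus (norm a1) + 2 * ln 2)"
    proof -
      have cg: "circ_int (\<lambda>z. ln_plus (norm (g z))) r"
        using good_radius_continuous_diff[OF gd(1)[OF a1]] r1 by (intro circ_int_ln_plus)
      have "pD \<le> cmean (\<lambda>z. (ln_plus (norm (g z)) + d a1 z) + (ln_plus (norm a1) + 2 * ln 2)) r"
        unfolding pD_def
      proof (rule cmean_mono)
        fix z :: complex assume z: "norm z = r"
        have "g z \<noteq> a1" using good_radius_nz[OF gd(1)[OF a1] z] by auto
        then show "ln_plus (norm (cdiff g z)) \<le> (ln_plus (norm (g z)) + d a1 z) + (ln_plus (norm a1) + 2 * ln 2)"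
          using ln_plus_diff_le[of "g z" a1 "g (z + \<i>/2)" "g (z - \<i>/2)"] by (simp add: cdiff_def d_def)
      qed (use a1 r1 in \<open>auto intro!: cg circ_int_add circ_int_const cid good_radius_circ_int(1)[OF gD]\<close>)
      also have "\<dots> = cmean (\<lambda>z. ln_plus (norm (g z)) + d a1 z) r + cmean (\<lambda>z. ln_plus (norm a1) + 2 * ln 2) r"
        by (intro cmean_add circ_int_add circ_int_const cid cg a1)
      also have "cmean (\<lambda>z. ln_plus (norm (g z)) + d a1 z) r = pm + cmean (d a1) r"
        unfolding pm_def by (intro cmean_add cid cg a1)
      finally show ?thesis using d1 by (simp add: cmean_const)
    qed
    have i3: "pD - mD = CD + ND"
      using CD[OF r1(1) gD] cmean_ln_norm_split(1)[OF gD r1(2)] by (simp add: pD_def mD_def ND_def)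
    have "(\<Sum>a\<in>A. pm - cmean (\<lambda>z. ln_plus (1 / norm (g z - a))) r - (Ncount (zdiv (\<lambda>z. g z - a)) r - Np)) \<le> (\<Sum>a\<in>A. J a)"
      using J r1 gd(1) unfolding pm_def Np_def by (intro sum_mono) simp
    then have i4: "real (card A) * pm - Sm - SN + real (card A) * Np \<le> (\<Sum>a\<in>A. J a)"
      by (simp add: sum_subtractf Sm_def SN_def)
    have i5: "SN \<le> ND + (real (card A) - 1) * Np + C3 * e + C3 * ln r"
      using C3(2)[OF r adm(1,2)] by (simp add: SN_def ND_def Np_def e_def)
    have "real (card A) * Np = (real (card A) - 1) * Np + Np" by (simp add: algebra_simps)
    moreover have "real (card A) * pm \<ge> 2 * pm" using q pm0 by (intro mult_right_mono) auto
    \<comment> \<open>By \<open>i3\<close> the sum mD + ND equals pD - CD, which \<open>i2\<close>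
      bounds by one copy of pm. Of the card A copies of pm at least one is left, and of the copies
      of Np exactly one.\<close>
    ultimately have "pm + Np \<le> 2 * (SL * e) + C3 * e + C3 * ln r + K0"
      using i1 i2 i3 i4 i5 unfolding K0_def by linarith
    also have "K0 \<le> 2 * K0 * ln r"
    proof -
      have "1/2 \<le> ln r" using r ln2_ge_two_thirds ln_mono[of 2 r] by linarith
      from mult_left_mono[OF this, of "2 * K0"] K0 show ?thesis by simp
    qed
    finally have "pm + Np \<le> (2 * SL + C3) * e + (C3 + 2 * K0) * ln r" by (simp add: algebra_simps)
    also have "(2 * SL + C3) * e \<le> C * e" using K0 e0 by (intro mult_right_mono) (auto simp: C_def)
    also have "(C3 + 2 * K0) * ln r \<le> C * ln r" using SL0 r by (intro mult_right_mono) (auto simp: C_def)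
    finally show "nchar g r \<le> C * err_term g r R R' + C * ln r" by (simp add: nchar_def pm_def Np_def e_def)
  qed
qed

text \<open>If this failed for all k \<ge> k1, t could be followed along jumps of length at most
  two, each gaining a factor of at least 2 B^2. The bound B^k pays only B^2 for a jump of length
  two, so the surplus powers of 2 contradict it.\<close>

lemma growth_selection:
  fixes t :: "nat \<Rightarrow> real"
  assumes t1: "\<And>k. t k \<ge> 1" and b: "B \<ge> 1" "\<And>k. k \<ge> k0 \<Longrightarrow> t k \<le> B ^ k"
  shows "\<exists>k\<ge>k1. t (k + 1) \<le> 2 * B^2 * t k \<and> t (k + 2) \<le> 2 * B^2 * t k"
proof (rule ccontr)
  assume "\<not> ?thesis"
  then have n: "t (k + 1) > 2 * B^2 * t k \<or> t (k + 2) > 2 * B^2 * t k" if "k \<ge> k1" for k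
    using that by (meson not_le)
  define k2 where "k2 = max k0 k1"
  \<comment> \<open>Each of the i jumps has length one or two, whence the range of j.\<close>
  have claim: "\<exists>j. k2 + i \<le> j \<and> j \<le> k2 + 2 * i \<and> t j \<ge> (2 * B^2) ^ i" for i
  proof (induction i)
    case 0
    then show ?case using t1[of k2] by auto
  next
    case (Suc i)
    then obtain j where j: "k2 + i \<le> j" "j \<le> k2 + 2 * i" "t j \<ge> (2 * B^2) ^ i" by blast
    have "(2 * B^2) ^ Suc i \<le> 2 * B^2 * t j" using j(3) by (simp add: mult_left_mono)
    moreover have "t (j + 1) > 2 * B^2 * t j \<or> t (j + 2) > 2 * B^2 * t j" using n[of j] j by (simp add: k2_def)
    ultimately have "t (j + 1) \<ge> (2 * B^2) ^ Suc i \<or> t (j + 2) \<ge> (2 * B^2) ^ Suc i" by linarith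
    then show ?case
    proof
      assume "t (j + 1) \<ge> (2 * B^2) ^ Suc i"
      then show ?thesis using j by (intro exI[of _ "j + 1"]) auto
    next
      assume "t (j + 2) \<ge> (2 * B^2) ^ Suc i"
      then show ?thesis using j by (intro exI[of _ "j + 2"]) auto
    qed
  qed
  obtain i where i: "2 ^ i > B ^ k2" using real_arch_pow[of 2 "B ^ k2"] by auto
  obtain j where j: "k2 + i \<le> j" "j \<le> k2 + 2 * i" "t j \<ge> (2 * B^2) ^ i" using claim by blast
  have "2 ^ i * (B^2) ^ i \<le> t j" using j(3) by (simp add: power_mult_distrib)
  also have "t j \<le> B ^ j" using j(1) by (intro b(2)) (simp add: k2_def)
  also have "\<dots> \<le> B ^ (k2 + 2 * i)" using j(2) b(1) by (intro power_increasing)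
  also have "\<dots> = B ^ k2 * (B^2) ^ i" by (simp add: power_add power_mult)
  finally have "2 ^ i \<le> B ^ k2" using b(1) by (simp add: mult_le_cancel_right)
  then show False using i by simp
qed

lemma admissible_exists:
  assumes g: "nonconst g" and D: "mero_nz (cdiff g)" and A: "finite A" and "x < y"
  shows "\<exists>r. x < r \<and> r < y \<and> admissible g A r"
proof -
  define H where "H = insert (cdiff g) ((\<lambda>a z. g z - a) ` A \<union> (\<lambda>a z. g (z + \<i>/2) - a) ` A \<union> (\<lambda>a z. g (z + - (\<i>/2)) - a) ` A)"
  have "mero_nz (\<lambda>z. g (z + c) - a)" for c a
    using mero_nz_shift[OF nonconst_mero_nz[OF g, of a], of c] by simp
  then have "\<And>h. h \<in> H \<Longrightarrow> mero_nz h" using D nonconst_mero_nz[OF g] unfolding H_def by blast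
  moreover have "finite H" using A by (simp add: H_def)
  ultimately obtain r where "x < r" "r < y" "\<forall>h\<in>H. good_radius h r" using good_radius_exists[of H x y] \<open>x < y\<close> by blast
  then show ?thesis by (intro exI[of _ r]) (auto simp: admissible_def H_def)
qed

text \<open>Along the selected radii the error is at most a constant times (T(r) + 1) / ln r. Once
  ln r is large this is at most half of T(r) + 1 and is absorbed on the left.\<close>

lemma logarithmic_growth:
  assumes g: "nonconst g" and D: "mero_nz (cdiff g)" and A: "finite A"
    and dA: "\<And>a. a \<in> A \<Longrightarrow> displaced (zdiv (\<lambda>z. g z - a))"
    and cases: "card A \<ge> 3 \<or> card A = 2 \<and> displaced (pdiv g)"
    and bound: "\<And>r. r > r0 \<Longrightarrow> admissible g A r \<Longrightarrow> nchar g r \<le> r ^ K"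
  shows "\<exists>C. \<forall>x. \<exists>r>x. admissible g A r \<and> nchar g r \<le> C * ln r"
proof -
  obtain C where C: "C \<ge> 0" "\<forall>r R R'. 2 \<le> r \<longrightarrow> 4 * r \<le> R \<longrightarrow> 4 * R \<le> R' \<longrightarrow>
     admissible g A r \<longrightarrow> admissible g A R \<longrightarrow> admissible g A R' \<longrightarrow>
     nchar g r \<le> C * err_term g r R R' + C * ln r"
    using main_inequality[OF g D A dA cases] by blast
  \<comment> \<open>Admissible radii can be prescribed only up to an interval; the ratio 8 between
    the intervals leaves a ratio of at least 4 between consecutive radii.\<close>
  have "\<forall>k. \<exists>r. 8 ^ k < r \<and> r < 2 * 8 ^ k \<and> admissible g A r"
    using admissible_exists[OF g D A] by (intro allI) auto
  from choice[OF this] obtain \<rho> where \<rho>: "\<And>k. 8 ^ k < \<rho> k" "\<And>k. \<rho> k < 2 * 8 ^ k" "\<And>k. admissible g A (\<rho> k)" by blast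
  have \<rho>4: "4 * \<rho> k \<le> \<rho> (k + 1)" for k using \<rho>(2)[of k] \<rho>(1)[of "k + 1"] by simp
  have \<rho>1: "\<rho> k > 1" for k using \<rho>(1)[of k] one_le_power[of "8::real" k] by linarith
  define t where "t = (\<lambda>k. nchar g (\<rho> k) + 1)"
  have t1: "t k \<ge> 1" for k using nchar_nonneg[of "\<rho> k" g] \<rho>1[of k] by (simp add: t_def)
  \<comment> \<open>For k \<ge> 1 one has \<rho> k < 2 * 8^k \<le> 16^k, and the factor 2 pays for
    the summand 1 in t.\<close>
  define B where "B = 2 * (16::real) ^ K"
  have B1: "B \<ge> 1" using one_le_power[of "16::real" K] unfolding B_def by linarith
  obtain k0 where k0: "r0 < 8 ^ k0" using real_arch_pow[of 8 r0] by auto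
  have tB: "t k \<le> B ^ k" if k: "k \<ge> max 1 k0" for k
  proof -
    have "(8::real) ^ k0 \<le> 8 ^ k" using k by (intro power_increasing) auto
    then have "r0 < \<rho> k" using k0 \<rho>(1)[of k] by linarith
    then have "nchar g (\<rho> k) \<le> \<rho> k ^ K" using \<rho>(3) by (intro bound)
    also have "\<dots> \<le> (16 ^ k) ^ K"
    proof (rule power_mono)
      have "(2::real) * 8 ^ k \<le> 2 ^ k * 8 ^ k" using k power_increasing[of 1 k "2::real"] by (intro mult_right_mono) auto
      also have "\<dots> = 16 ^ k" by (simp add: power_mult_distrib[symmetric])
      finally show "\<rho> k \<le> 16 ^ k" using \<rho>(2)[of k] by linarith
    qed (use \<rho>1[of k] in auto)
    also have "\<dots> = (16 ^ K) ^ k" by (simp add: power_mult[symmetric] mult.commute)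
    finally have "t k \<le> (16 ^ K) ^ k + 1" by (simp add: t_def)
    also have "\<dots> \<le> 2 * (16 ^ K) ^ k" using one_le_power[of "(16::real) ^ K" k] by (simp add: one_le_power)
    also have "\<dots> \<le> 2 ^ k * (16 ^ K) ^ k" using k power_increasing[of 1 k "2::real"] by (intro mult_right_mono) auto
    also have "\<dots> = B ^ k" by (simp add: B_def power_mult_distrib)
    finally show ?thesis .
  qed
  \<comment> \<open>The three characteristics and the 1 in \<open>err_term\<close> add up to at most
    (1 + 2 * 2 B^2) t k. Choosing r > exp (2 E) makes E / ln r at most 1/2.\<close>
  define E where "E = C * (1 + 4 * B^2)"
  have E0: "E \<ge> 0" using C by (simp add: E_def)
  show ?thesis
  proof (rule exI[of _ "2 + 2 * C"], rule allI)
    fix x :: real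
    obtain k1 where k1: "max x (exp (2 * E)) < 8 ^ k1" using real_arch_pow[of 8 "max x (exp (2 * E))"] by auto
    obtain k where k: "k \<ge> max k1 1" "t (k + 1) \<le> 2 * B^2 * t k" "t (k + 2) \<le> 2 * B^2 * t k"
      using growth_selection[of t B "max 1 k0" "max k1 1", OF t1 B1 tB] by blast
    define r where "r = \<rho> k"
    have "(8::real) ^ k1 \<le> 8 ^ k" using k by (intro power_increasing) auto
    then have big: "r > x" "r > exp (2 * E)" using k1 \<rho>(1)[of k] unfolding r_def by linarith+
    have "(8::real) ^ 1 \<le> 8 ^ k" using k by (intro power_increasing) auto
    then have r2: "r \<ge> 2" using \<rho>(1)[of k] by (simp add: r_def)
    have lr: "ln r \<ge> 2 * E" using big(2) r2 by (metis exp_gt_zero less_eq_real_def ln_exp ln_less_cancel_iff order_less_le_trans zero_less_numeral)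
    have lr2: "ln r \<ge> 1/2" using r2 ln2_ge_two_thirds ln_mono[of 2 r] by linarith
    have "nchar g r \<le> C * err_term g r (\<rho> (k + 1)) (\<rho> (k + 2)) + C * ln r"
      using C(2) r2 \<rho>4[of k] \<rho>4[of "k + 1"] \<rho>(3) unfolding r_def by simp
    also have "C * err_term g r (\<rho> (k + 1)) (\<rho> (k + 2)) \<le> (E * t k) / ln r"
    proof -
      have "nchar g r + nchar g (\<rho> (k + 1)) + nchar g (\<rho> (k + 2)) + 1 \<le> (1 + 4 * B^2) * t k"
        using k(2,3) by (simp add: t_def r_def algebra_simps)
      then have "C * (nchar g r + nchar g (\<rho> (k + 1)) + nchar g (\<rho> (k + 2)) + 1) \<le> C * ((1 + 4 * B^2) * t k)"
        using C(1) by (rule mult_left_mono)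
      then show ?thesis unfolding err_term_def E_def using lr2 by (simp add: divide_right_mono mult.assoc)
    qed
    also have "(E * t k) / ln r \<le> t k / 2"
    proof -
      have "2 * E * t k \<le> ln r * t k" using lr t1[of k] by (intro mult_right_mono) auto
      then show ?thesis using lr2 by (simp add: field_simps)
    qed
    finally have "nchar g r \<le> (nchar g r + 1) / 2 + C * ln r" by (simp add: t_def r_def)
    then have "nchar g r \<le> 1 + 2 * (C * ln r)" by (simp add: field_simps)
    also have "\<dots> \<le> (2 + 2 * C) * ln r" using lr2 by (simp add: distrib_right)
    finally show "\<exists>r>x. admissible g A r \<and> nchar g r \<le> (2 + 2 * C) * ln r"
      using big(1) \<rho>(3)[of k] by (auto simp: r_def)
  qed
qed

subsection \<open>Passing from \<open>f\<close> to \<open>f (z\<^sup>2)\<close>\<close>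

text \<open>Squaring doubles the angle, so the circle of radius r^2 is traversed twice, and the
  integrand has period 2 pi.\<close>

lemma cmean_square:
  assumes c: "continuous_on (sphere 0 (r^2)) \<phi>" and r: "r > 0"
  shows "cmean (\<lambda>z. \<phi> (z^2)) r = cmean \<phi> (r^2)"
proof -
  define \<psi> where "\<psi> = (\<lambda>\<theta>. \<phi> (of_real (r^2) * cis \<theta>))"
  have cont: "continuous_on S \<psi>" for S
    unfolding \<psi>_def
    by (rule continuous_on_compose2[OF c]) (use r in \<open>auto intro!: continuous_intros simp: norm_mult norm_power\<close>)
  define I where "I = integral {0..2*pi} \<psi>"
  have per: "\<psi> (\<theta> + 2*pi) = \<psi> \<theta>" for \<theta> by (simp add: \<psi>_def cis_mult[symmetric])
  have 1: "(\<psi> has_integral I) {0..2*pi}"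
    unfolding I_def using integrable_continuous_real[OF cont] by blast
  then have "(\<psi> has_integral I) (cbox 0 (2*pi))" by simp
  from has_integral_affinity'[OF this, of 1 "-(2*pi)"]
  have "((\<lambda>x. \<psi> (x - 2*pi)) has_integral I) {2*pi..4*pi}" by (simp add: algebra_simps)
  moreover have "\<psi> (x - 2*pi) = \<psi> x" for x using per[of "x - 2*pi"] by simp
  ultimately have "(\<psi> has_integral I) {2*pi..4*pi}" by simp
  from has_integral_combine[OF _ _ 1 this] have "(\<psi> has_integral (2 * I)) (cbox 0 (4*pi))" by simp
  from has_integral_affinity'[OF this, of 2 0]
  have "((\<lambda>x. \<psi> (2 * x)) has_integral I) {0..2*pi}" by simp
  then have "integral {0..2*pi} (\<lambda>x. \<psi> (2 * x)) = I" by (rule integral_unique)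
  moreover have "\<psi> (2 * x) = \<phi> ((of_real r * cis x)^2)" for x
    by (simp add: \<psi>_def power_mult_distrib Complex.DeMoivre)
  ultimately show ?thesis unfolding cmean_def I_def \<psi>_def by simp
qed

lemma mero_nz_square:
  assumes "mero_nz f"
  shows "mero_nz (\<lambda>z. f (z^2))"
proof (subst mero_nz_iff_frequently)
  show "(\<lambda>z. f (z^2)) meromorphic_on UNIV"
    by (rule meromorphic_on_compose[OF mero_nz_meromorphic[OF assms, of UNIV]]) (auto intro!: analytic_intros)
  have "filterlim (\<lambda>z::complex. z^2) (at 0) (at 0)"
    by (rule filterlim_atI) (auto intro!: tendsto_eq_intros simp: eventually_at_filter)
  from eventually_compose_filterlim[OF mero_nz_eventually[OF assms] this]
  have "frequently (\<lambda>w. f (w^2) \<noteq> 0) (at 0)" by (simp add: eventually_frequently)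
  then show "\<exists>z. frequently (\<lambda>w. f (w^2) \<noteq> 0) (at z)" by blast
qed

lemma nonconst_square: "nonconst f \<Longrightarrow> nonconst (\<lambda>z. f (z^2))"
  unfolding nonconst_def using mero_nz_square by fastforce

lemma eventually_square_neq: "eventually (\<lambda>w::complex. w^2 \<noteq> z^2) (at z)"
proof -
  have "finite {w. w^2 = z^2}" by (simp add: power2_eq_iff)
  then have "eventually (\<lambda>w. w \<notin> {w. w^2 = z^2}) (at z)" by (rule finite_eventually_notin)
  then show ?thesis by simp
qed

text \<open>The order of a composite is multiplied by the order of w^2 - z^2 at z, which is 2 only
  at the branch point.\<close>

lemma zorder_square:
  assumes "mero_nz f"
  shows "zorder (\<lambda>z. f (z^2)) z = zorder f (z^2) * (if z = 0 then 2 else 1)"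
proof -
  have 1: "isolated_singularity_at f (z^2)" "not_essential f (z^2)"
    using mero_nz_meromorphic[OF assms, of "{z^2}"] by (auto simp: meromorphic_at_iff)
  note ev = eventually_square_neq[of z]
  have "zorder (f \<circ> (\<lambda>z. z^2)) z = zorder f (z^2) * zorder (\<lambda>w. w^2 - z^2) z"
    by (rule zorder_compose'[OF 1 _ mero_nz_eventually[OF assms] ev]) (auto intro!: analytic_intros)
  moreover have "zorder (\<lambda>w. w^2 - z^2) z = (if z = 0 then 2 else 1)"
  proof (cases "z = 0")
    case True
    have "zorder (\<lambda>w::complex. w^2) 0 = 2"
      by (rule zorder_eqI[of UNIV 0 "\<lambda>_. 1"]) auto
    then show ?thesis using True by simp
  next
    case False
    have "zorder (\<lambda>w. w^2 - z^2) z = 1"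
      by (rule zorder_eqI[of UNIV z "\<lambda>w. w + z"]) (use False in \<open>auto intro!: holomorphic_intros simp: power2_eq_square algebra_simps\<close>)
    then show ?thesis using False by simp
  qed
  ultimately show ?thesis by (simp add: o_def)
qed

text \<open>Regularity of the composite excludes a pole of f at z^2, and away from its poles a
  nicely meromorphic function is analytic.\<close>

lemma nicely_regular_square:
  assumes f: "f nicely_meromorphic_on UNIV" and reg: "regular_at (\<lambda>z. f (z^2) - a) z"
  shows "regular_at (\<lambda>x. f x - a) (z^2)"
proof -
  have an: "(\<lambda>z. f (z^2) - a) analytic_on {z}" and nz: "f (z^2) - a \<noteq> 0" using reg by (auto simp: regular_at_def)
  have "(\<lambda>z. (f (z^2) - a) + a) analytic_on {z}" by (intro analytic_intros an)
  then have an': "(\<lambda>z. f (z^2)) analytic_on {z}" by simp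
  have "\<not> is_pole f (z^2)"
  proof
    assume p: "is_pole f (z^2)"
    have "filterlim (\<lambda>w. w^2) (at (z^2)) (at z)"
      by (rule filterlim_atI) (use eventually_square_neq[of z] in \<open>auto intro!: tendsto_eq_intros\<close>)
    with p have "is_pole (\<lambda>w. f (w^2)) z" unfolding is_pole_def by (rule filterlim_compose)
    then show False using analytic_at_imp_no_pole[OF an'] by simp
  qed
  then have "f analytic_on {z^2}" using nicely_meromorphic_on_imp_analytic_at[OF f] by simp
  then show ?thesis using nz by (auto simp: regular_at_def intro!: analytic_intros)
qed

lemma good_radius_square:
  assumes f: "f nicely_meromorphic_on UNIV" and g: "good_radius (\<lambda>z. f (z^2) - a) r" and r: "r \<ge> 0"
  shows "good_radius (\<lambda>x. f x - a) (r^2)"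
  unfolding good_radius_def
proof (intro allI impI)
  fix x :: complex assume x: "norm x = r^2"
  have "norm (csqrt x) = r" using x r by (simp add: norm_csqrt)
  then have "regular_at (\<lambda>z. f (z^2) - a) (csqrt x)" using g by (simp add: good_radius_def)
  from nicely_regular_square[OF f this] show "regular_at (\<lambda>x. f x - a) x" by simp
qed

subsection \<open>A criterion for rationality\<close>

text \<open>A Liouville argument: the derivative is bounded by a multiple of 1 / R times the mean,
  so growth like sqrt R along some unbounded set of radii already makes it vanish.\<close>

lemma entire_constant_of_cmean:
  assumes L: "L holomorphic_on UNIV"
    and K: "\<And>x. \<exists>R>x. cmean (\<lambda>z. \<bar>Re (L z)\<bar>) R \<le> K * sqrt R"
  obtains c where "\<And>z. L z = c"
proof -
  have "deriv L z = 0" for z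
  proof (rule ccontr)
    assume "deriv L z \<noteq> 0"
    then have d: "norm (deriv L z) > 0" by simp
    \<comment> \<open>For R beyond x one has norm z < R / 2, and 8 |K| / sqrt R is smaller than norm
      (deriv L z).\<close>
    define x where "x = max (max 1 (2 * norm z)) ((8 * \<bar>K\<bar> / norm (deriv L z))^2)"
    obtain R where R: "R > x" "cmean (\<lambda>z. \<bar>Re (L z)\<bar>) R \<le> K * sqrt R" using K by blast
    have R1: "R > 1" "2 * norm z < R" "R > (8 * \<bar>K\<bar> / norm (deriv L z))^2" using R(1) by (auto simp: x_def)
    have "norm (deriv L z) \<le> 2 * R / (R - norm z)^2 * cmean (\<lambda>z. \<bar>Re (L z)\<bar>) R"
      by (rule norm_deriv_le_cmean_Re[of L "R + 1"]) (use R1 norm_ge_zero[of z] in \<open>auto intro: holomorphic_on_subset[OF L] simp del: norm_ge_zero\<close>)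
    also have "\<dots> \<le> 8 / R * (\<bar>K\<bar> * sqrt R)"
    proof (rule mult_mono)
      have "(R / 2)^2 \<le> (R - norm z)^2" using R1 by (intro power_mono) auto
      then have "2 * R / (R - norm z)^2 \<le> 2 * R / (R / 2)^2" using R1 norm_ge_zero[of z]
        by (intro divide_left_mono mult_pos_pos zero_less_power) (auto simp del: norm_ge_zero)
      also have "\<dots> = 8 / R" using R1 by (simp add: field_simps power2_eq_square)
      finally show "2 * R / (R - norm z)^2 \<le> 8 / R" .
      have "K * sqrt R \<le> \<bar>K\<bar> * sqrt R" using R1 by (intro mult_right_mono) auto
      then show "cmean (\<lambda>z. \<bar>Re (L z)\<bar>) R \<le> \<bar>K\<bar> * sqrt R" using R(2) by simp
      show "0 \<le> 8 / R" using R1 by auto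
      show "0 \<le> cmean (\<lambda>z. \<bar>Re (L z)\<bar>) R" using R1 by (intro cmean_nonneg) auto
    qed
    also have "\<dots> = 8 * \<bar>K\<bar> / sqrt R"
    proof -
      have "sqrt R * sqrt R = R" "sqrt R > 0" using R1 by simp_all
      then show ?thesis by (metis (no_types, opaque_lifting) divide_divide_eq_left mult.assoc nonzero_mult_div_cancel_right order_less_irrefl times_divide_eq_left)
    qed
    finally have "norm (deriv L z) * sqrt R \<le> 8 * \<bar>K\<bar>" using R1 by (simp add: field_simps)
    then have "sqrt R \<le> 8 * \<bar>K\<bar> / norm (deriv L z)" using d by (simp add: field_simps)
    then have "(sqrt R)^2 \<le> (8 * \<bar>K\<bar> / norm (deriv L z))^2" using R1 by (intro power_mono) auto
    then show False using R1 by simp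
  qed
  moreover have "(L has_field_derivative deriv L z) (at z)" for z
    using L by (intro holomorphic_derivI[of L UNIV]) auto
  ultimately have "(L has_field_derivative 0) (at z within UNIV)" for z by metis
  then obtain c where "\<And>z. z \<in> UNIV \<Longrightarrow> L z = c"
    using has_field_derivative_zero_constant[of UNIV L] by auto
  then show ?thesis using that by simp
qed

text \<open>At regular points the quotient is read off the factorization. Wherever q does not vanish
  f has no pole, so both sides are continuous there, and all nearby points are regular.\<close>

lemma rational_of_factorization:
  assumes f: "f nicely_meromorphic_on UNIV" and h: "mero_nz (\<lambda>x. f x - a)"
    and S: "S = {x. zorder (\<lambda>x. f x - a) x \<noteq> 0}" "finite S"
    and fact: "\<And>x. regular_at (\<lambda>x. f x - a) x \<Longrightarrow> f x - a = c * (\<Prod>b\<in>S. (x - b) powi zorder (\<lambda>x. f x - a) b)"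
  shows "rational_function f"
proof -
  define n where "n = (\<lambda>b. zorder (\<lambda>x. f x - a) b)"
  define q where "q = (\<Prod>b\<in>S. [:-b, 1:] ^ nat (- n b))"
  \<comment> \<open>The summand with a q undoes the subtraction of a from f.\<close>
  define p where "p = smult c (\<Prod>b\<in>S. [:-b, 1:] ^ nat (n b)) + smult a q"
  have q0: "q \<noteq> 0" using S(2) by (auto simp: q_def)
  have pq: "f x = poly p x / poly q x" if reg: "regular_at (\<lambda>x. f x - a) x" for x
  proof -
    have x: "x \<notin> S" using zorder_regular[OF reg] S by auto
    have qx: "poly q x = (\<Prod>b\<in>S. (x - b) ^ nat (- n b))" by (simp add: q_def poly_prod)
    have nz: "poly q x \<noteq> 0" using x S(2) by (auto simp: qx)
    have "(\<Prod>b\<in>S. (x - b) powi n b) = (\<Prod>b\<in>S. (x - b) ^ nat (n b) / (x - b) ^ nat (- n b))"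
      by (intro prod.cong refl) (auto simp: power_int_def power_inverse divide_inverse)
    also have "\<dots> = (\<Prod>b\<in>S. (x - b) ^ nat (n b)) / poly q x" by (simp add: prod_dividef qx)
    finally have "f x - a = c * (\<Prod>b\<in>S. (x - b) ^ nat (n b)) / poly q x"
      using fact[OF reg] by (simp add: n_def)
    then have "f x = (c * (\<Prod>b\<in>S. (x - b) ^ nat (n b)) + a * poly q x) / poly q x"
      using nz by (simp add: field_simps)
    then show ?thesis by (simp add: p_def poly_prod)
  qed
  have "f x = poly p x / poly q x" if x: "poly q x \<noteq> 0" for x
  proof -
    have "\<not> is_pole f x"
    proof
      assume "is_pole f x"
      then have "is_pole (\<lambda>x. f x + (- a)) x" unfolding is_pole_def
        by (intro tendsto_add_filterlim_at_infinity'[OF _ tendsto_const])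
      then have "is_pole (\<lambda>x. f x - a) x" by simp
      moreover have "isolated_singularity_at (\<lambda>x. f x - a) x"
        using mero_nz_meromorphic[OF h, of "{x}"] by (simp add: meromorphic_at_iff)
      ultimately have "n x < 0" unfolding n_def by (rule isolated_pole_imp_neg_zorder[rotated])
      then have "x \<in> S" "nat (- n x) > 0" using S by (auto simp: n_def)
      then have "poly q x = 0" using S(2) by (auto simp: q_def poly_prod)
      then show False using x by simp
    qed
    then have "f analytic_on {x}" using nicely_meromorphic_on_imp_analytic_at[OF f] by simp
    then have "f \<midarrow>x\<rightarrow> f x" using analytic_at_imp_isCont isCont_def by blast
    moreover have "eventually (regular_at (\<lambda>x. f x - a)) (at x)"
      using mero_nz_regular[OF h] unfolding eventually_cosparse_open_eq[OF open_UNIV] by blast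
    then have "eventually (\<lambda>x. poly p x / poly q x = f x) (at x)"
      by (rule eventually_mono) (rule pq[symmetric])
    then have "f \<midarrow>x\<rightarrow> poly p x / poly q x"
    proof (rule Lim_transform_eventually[rotated])
      show "(\<lambda>x. poly p x / poly q x) \<midarrow>x\<rightarrow> poly p x / poly q x"
        using x by (intro tendsto_intros)
    qed
    ultimately show ?thesis using LIM_unique by blast
  qed
  then show ?thesis unfolding rational_function_def using q0 by blast
qed


text \<open>A zero or pole of norm below sqrt r has weight at least ln r / 2 in an integrated count
  of size O(ln r). So the cardinality of any finite set of them is at most a bound depending only on
  C and K.\<close>

lemma finite_support_of_log_growth:
  assumes g: "nonconst g" and a: "a \<in> A"
    and growth: "\<And>x. \<exists>r>x. admissible g A r \<and> nchar g r \<le> C * ln r"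
  shows "finite {z. zorder (\<lambda>z. g z - a) z \<noteq> 0}"
proof -
  let ?h = "\<lambda>z. g z - a"
  let ?M = "\<lambda>z. \<bar>zord ?h z\<bar>"
  have h: "mero_nz ?h" by (rule nonconst_mero_nz[OF g])
  have locf: "locfin ?M" by (rule locfin_comb[OF locfin_zord[OF h] locfin_zord[OF h]]) auto
  obtain K where K: "K \<ge> 0"
    "\<And>r. r > 1 \<Longrightarrow> good_radius ?h r \<Longrightarrow> Ncount (zdiv ?h) r \<le> nchar g r + K"
    by (rule first_main[OF g, of a]) (rule that)
  define B where "B = nat \<lceil>4 * \<bar>C\<bar> + 4 * K\<rceil>"
  have "card T \<le> B" if T: "T \<subseteq> {z. zorder ?h z \<noteq> 0}" "finite T" for T
  proof -
    obtain \<rho> where \<rho>: "\<And>z. z \<in> T \<Longrightarrow> norm z \<le> \<rho>" using finite_imp_bounded[OF T(2)] by (auto simp: bounded_iff)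
    obtain r where r: "r > max 4 ((\<bar>\<rho>\<bar> + 1)^2)" "admissible g A r" "nchar g r \<le> C * ln r" using growth by blast
    have r4: "r > 4" "(\<bar>\<rho>\<bar> + 1)^2 < r" using r(1) by auto
    have "\<bar>\<rho>\<bar> + 1 < sqrt r" using r4(2) real_less_rsqrt by blast
    then have lt: "norm z < sqrt r" if "z \<in> T" for z using \<rho>[OF that] by linarith
    have lr: "ln r \<ge> 1/2" using r4 ln2_ge_two_thirds ln_mono[of 2 r] by linarith
    have "real (card T) = (\<Sum>z\<in>T. 1)" by simp
    also have "\<dots> \<le> (\<Sum>z\<in>T. ?M z)"
    proof (rule sum_mono)
      fix z assume "z \<in> T"
      then have "zorder ?h z \<noteq> 0" using T by auto
      then have "\<bar>zorder ?h z\<bar> \<ge> 1" by linarith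
      then show "1 \<le> ?M z" unfolding zord_def by linarith
    qed
    also have "\<dots> \<le> ncount ?M (sqrt r)"
      unfolding ncount_def using T lt locfin_finite[OF locf, of "sqrt r"]
      by (intro sum_mono2) (auto simp: zord_def)
    finally have 1: "real (card T) \<le> ncount ?M (sqrt r)" .
    have "ncount ?M (sqrt r) * (ln r - ln (sqrt r)) \<le> Ncount ?M r"
      using r4 by (intro ncount_le_Ncount[OF locf]) (auto simp: real_le_lsqrt power2_eq_square)
    also have "Ncount ?M r = Ncount (zdiv ?h) r + Ncount (pdiv g) r"
      unfolding abs_zord_eq pdiv_diff_const[OF g]
      by (rule Ncount_add) (use r4 g h in \<open>auto intro!: locfin_zdiv locfin_pdiv nonconst_mero_nz0\<close>)
    also have "\<dots> \<le> 2 * (C * ln r) + K"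
      using K(2)[of r] Ncount_pdiv_le_nchar[of r g] r a r4 by (auto simp: admissible_def)
    also have "\<dots> \<le> (2 * \<bar>C\<bar> + 2 * K) * ln r"
    proof -
      have "C * ln r \<le> \<bar>C\<bar> * ln r" using lr by (intro mult_right_mono) auto
      moreover have "K * 1 \<le> K * (2 * ln r)" using lr K(1) by (intro mult_left_mono) auto
      ultimately show ?thesis by (simp add: distrib_right)
    qed
    finally have "ncount ?M (sqrt r) * (ln r / 2) \<le> (4 * \<bar>C\<bar> + 4 * K) * (ln r / 2)"
      using r4 by (simp add: ln_sqrt algebra_simps)
    then have "ncount ?M (sqrt r) \<le> 4 * \<bar>C\<bar> + 4 * K" using lr by (subst (asm) mult_le_cancel_right) auto
    then show ?thesis using 1 unfolding B_def by linarith
  qed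
  then show ?thesis using finite_if_finite_subsets_card_bdd by blast
qed

text \<open>With finitely many zeros and poles the factorization of f - a is global. On circles of
  radius r^2 the mean of |Re L| is O(ln r), so the exponential factor is constant.\<close>

lemma rational_of_log_growth:
  assumes f: "f nicely_meromorphic_on UNIV" and nc: "nonconst f" and a: "a \<in> A"
    and growth: "\<And>x. \<exists>r>x. admissible (\<lambda>z. f (z^2)) A r \<and> nchar (\<lambda>z. f (z^2)) r \<le> C * ln r"
  shows "rational_function f"
proof -
  let ?g = "\<lambda>z. f (z^2)"
  let ?h = "\<lambda>x. f x - a"
  have g: "nonconst ?g" by (rule nonconst_square[OF nc])
  have h: "mero_nz ?h" by (rule nonconst_mero_nz[OF nc])
  define S where "S = {x. zorder ?h x \<noteq> 0}"
  have fin: "finite S"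
  proof (rule finite_subset)
    show "S \<subseteq> (\<lambda>z. z^2) ` {z. zorder (\<lambda>z. ?g z - a) z \<noteq> 0}"
    proof
      fix x assume "x \<in> S"
      then have "zorder (\<lambda>z. ?g z - a) (csqrt x) \<noteq> 0"
        using zorder_square[OF h, of "csqrt x"] by (simp add: S_def)
      then show "x \<in> (\<lambda>z. z^2) ` {z. zorder (\<lambda>z. ?g z - a) z \<noteq> 0}" by force
    qed
    show "finite ((\<lambda>z. z^2) ` {z. zorder (\<lambda>z. ?g z - a) z \<noteq> 0})"
      by (intro finite_imageI finite_support_of_log_growth[OF g a growth])
  qed
  have S': "S = {b \<in> UNIV. zorder ?h b \<noteq> 0}" by (simp add: S_def)
  obtain L where L: "L holomorphic_on UNIV"
    "\<And>z. regular_at ?h z \<Longrightarrow> ?h z = exp (L z) * (\<Prod>b\<in>S. (z - b) powi zorder ?h b)"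
  proof (rule mero_factorization[OF h convex_UNIV open_UNIV UNIV_not_empty S' fin, of "\<lambda>_. 1"])
    fix L assume 1: "L holomorphic_on UNIV" and
      2: "\<And>z. z \<in> UNIV \<Longrightarrow> regular_at ?h z \<Longrightarrow> ?h z = exp (L z) * (\<Prod>b\<in>S. ((z - b) / of_real 1) powi zorder ?h b)"
    show thesis by (rule that[OF 1]) (use 2 in simp)
  qed simp
  have Lln: "ln (norm (?h z)) = Re (L z) + (\<Sum>b\<in>S. zord ?h b * ln (norm (z - b)))" if reg: "regular_at ?h z" for z
  proof -
    have "z \<notin> S" using zorder_regular[OF reg] by (simp add: S_def)
    then have nz: "norm (z - b) > 0" if "b \<in> S" for b using that by auto
    have pp: "(\<Prod>b\<in>S. norm (z - b) powi zorder ?h b) > 0" by (intro prod_pos zero_less_power_int nz)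
    have "ln (norm (?h z)) = ln (exp (Re (L z)) * (\<Prod>b\<in>S. norm (z - b) powi zorder ?h b))"
      using L(2)[OF reg] by (simp add: norm_mult prod_norm[symmetric] norm_power_int)
    also have "\<dots> = Re (L z) + ln (\<Prod>b\<in>S. norm (z - b) powi zorder ?h b)"
      by (simp only: ln_mult_pos[OF exp_gt_zero pp] ln_exp)
    also have "ln (\<Prod>b\<in>S. norm (z - b) powi zorder ?h b) = (\<Sum>b\<in>S. ln (norm (z - b) powi zorder ?h b))"
    proof (rule ln_prod[OF fin])
      show "norm (z - b) powi zorder ?h b \<noteq> 0" if "b \<in> S" for b
        using zero_less_power_int[OF nz[OF that], of "zorder ?h b"] by linarith
    qed
    also have "\<dots> = (\<Sum>b\<in>S. zord ?h b * ln (norm (z - b)))"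
      by (intro sum.cong refl) (use nz in \<open>simp add: ln_power_int zord_def\<close>)
    finally show ?thesis .
  qed
  obtain K1 where K1: "K1 \<ge> 0"
    "\<And>r. r > 1 \<Longrightarrow> good_radius (\<lambda>z. ?g z - a) r \<Longrightarrow> cmean (\<lambda>z. \<bar>ln (norm (?g z - a))\<bar>) r \<le> 2 * nchar ?g r + K1"
    by (rule first_main[OF g, of a]) (rule that)
  obtain \<rho> where \<rho>: "\<And>b. b \<in> S \<Longrightarrow> norm b \<le> \<rho>" using finite_imp_bounded[OF fin] by (auto simp: bounded_iff)
  define n where "n = (\<Sum>b\<in>S. \<bar>zord ?h b\<bar>)"
  have n0: "n \<ge> 0" unfolding n_def by (intro sum_nonneg) auto
  define K where "K = 2 * \<bar>C\<bar> + 2 * K1 + 4 * n"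
  have "\<exists>R>x. cmean (\<lambda>z. \<bar>Re (L z)\<bar>) R \<le> (2 * K) * sqrt R" for x
  proof -
    obtain r where r: "r > max 2 (\<bar>x\<bar> + \<bar>\<rho>\<bar> + 1)" "admissible ?g A r" "nchar ?g r \<le> C * ln r" using growth by blast
    have r2: "r > 2" "r > \<bar>x\<bar> + \<bar>\<rho>\<bar> + 1" using r(1) by auto
    define R where "R = r^2"
    have Rr: "R \<ge> r" using r2 mult_right_mono[of 1 r r] by (simp add: R_def power2_eq_square)
    have lr: "ln r \<ge> 1/2" using r2 ln2_ge_two_thirds ln_mono[of 2 r] by linarith
    have lR: "ln R = 2 * ln r" using r2 by (simp add: R_def ln_realpow)
    have gr: "good_radius (\<lambda>z. ?g z - a) r" using r(2) a by (auto simp: admissible_def)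
    have gR: "good_radius ?h R" unfolding R_def by (rule good_radius_square[OF f gr]) (use r2 in auto)
    have R0: "R > 0" using Rr r2 by linarith
    have ci: "circ_int (\<lambda>z. \<bar>ln (norm (?h z))\<bar>) R" by (rule circ_int_abs_ln_norm(2)[OF gR]) (use R0 in auto)
    have "continuous_on (sphere 0 R) (\<lambda>z. \<bar>ln (norm (?h z))\<bar>)"
      using good_radius_nz[OF gR]
      by (intro continuous_on_rabs continuous_on_ln continuous_on_norm good_radius_continuous[OF gR]) simp
    from cmean_square[OF this[unfolded R_def]] r2
    have sq: "cmean (\<lambda>z. \<bar>ln (norm (?h z))\<bar>) R = cmean (\<lambda>z. \<bar>ln (norm (?g z - a))\<bar>) r"
      by (simp add: R_def)
    have "cmean (\<lambda>z. \<bar>Re (L z)\<bar>) R \<le> cmean (\<lambda>z. \<bar>ln (norm (?h z))\<bar> + n * ln (2 * R)) R"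
    proof (rule cmean_mono)
      have "continuous_on (sphere 0 R) L" by (rule continuous_on_subset[OF holomorphic_on_imp_continuous_on[OF L(1)]]) auto
      then show "circ_int (\<lambda>z. \<bar>Re (L z)\<bar>) R" using R0 by (intro circ_int_continuous continuous_intros) auto
      show "circ_int (\<lambda>z. \<bar>ln (norm (?h z))\<bar> + n * ln (2 * R)) R" by (intro circ_int_add circ_int_const ci)
      fix z :: complex assume z: "norm z = R"
      have reg: "regular_at ?h z" using gR z by (simp add: good_radius_def)
      have "\<bar>\<Sum>b\<in>S. zord ?h b * ln (norm (z - b))\<bar> \<le> (\<Sum>b\<in>S. \<bar>zord ?h b\<bar> * ln (2 * R))"
      proof (rule order_trans[OF sum_abs], rule sum_mono)
        fix b assume b: "b \<in> S"
        have "norm b \<le> R - 1" using \<rho>[OF b] r2 Rr by linarith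
        \<comment> \<open>A distance of at least 1 makes the logarithm nonnegative, so the upper
          bound ln (2R) also bounds its absolute value.\<close>
        then have "1 \<le> norm (z - b)" "norm (z - b) \<le> 2 * R"
          using norm_triangle_ineq4[of z b] norm_triangle_ineq2[of z b] z by linarith+
        then have "0 \<le> ln (norm (z - b)) \<and> ln (norm (z - b)) \<le> ln (2 * R)"
          using ln_ge_zero[of "norm (z - b)"] ln_mono[of "norm (z - b)" "2 * R"] by linarith
        then show "\<bar>zord ?h b * ln (norm (z - b))\<bar> \<le> \<bar>zord ?h b\<bar> * ln (2 * R)"
          by (simp add: abs_mult mult_left_mono)
      qed
      also have "\<dots> = n * ln (2 * R)" by (simp add: n_def sum_distrib_right)
      finally show "\<bar>Re (L z)\<bar> \<le> \<bar>ln (norm (?h z))\<bar> + n * ln (2 * R)" using Lln[OF reg] by linarith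
    qed (use R0 in auto)
    also have "\<dots> = cmean (\<lambda>z. \<bar>ln (norm (?h z))\<bar>) R + n * ln (2 * R)"
      using cmean_add[OF ci circ_int_const, of "n * ln (2 * R)"] by (simp only: cmean_const)
    also have "cmean (\<lambda>z. \<bar>ln (norm (?h z))\<bar>) R \<le> 2 * nchar ?g r + K1" unfolding sq using K1(2) gr r2 by simp
    also have "nchar ?g r \<le> \<bar>C\<bar> * ln r" using r(3) lr mult_right_mono[of C "\<bar>C\<bar>" "ln r"] by linarith
    also have "n * ln (2 * R) \<le> n * (4 * ln r)"
    proof (rule mult_left_mono[OF _ n0])
      have "ln 2 \<le> ln r" using r2 by (intro ln_mono) auto
      moreover have "ln (2 * R) = ln 2 + ln R" using R0 by (intro ln_mult_pos) auto
      ultimately show "ln (2 * R) \<le> 4 * ln r" using lR lr by linarith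
    qed
    also have "K1 \<le> 2 * K1 * ln r" using mult_left_mono[OF lr, of "2 * K1"] K1(1) by simp
    finally have "cmean (\<lambda>z. \<bar>Re (L z)\<bar>) R \<le> K * ln r" by (simp add: K_def algebra_simps)
    also have "\<dots> \<le> K * (2 * sqrt R)"
    proof (rule mult_left_mono)
      show "ln r \<le> 2 * sqrt R" using ln_le_two_sqrt[of R] lR lr Rr r2 by linarith
      show "K \<ge> 0" using n0 K1(1) by (simp add: K_def)
    qed
    finally show ?thesis using Rr r2 by (intro exI[of _ R]) auto
  qed
  then obtain c where c: "\<And>z. L z = c" using entire_constant_of_cmean[OF L(1)] by blast
  show ?thesis
    by (rule rational_of_factorization[OF f h S_def fin, of "exp c"]) (use L(2) c in auto)
qed

subsection \<open>Functions of finite order\<close>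

lemma is_pole_iff_zorder:
  assumes "mero_nz f"
  shows "is_pole f x \<longleftrightarrow> zorder f x < 0"
proof
  have "isolated_singularity_at f x" using mero_nz_meromorphic[OF assms, of "{x}"] by (simp add: meromorphic_at_iff)
  then show "is_pole f x \<Longrightarrow> zorder f x < 0" by (rule isolated_pole_imp_neg_zorder)
  show "zorder f x < 0 \<Longrightarrow> is_pole f x"
    by (rule zorder_neg_imp_is_pole[OF mero_nz_meromorphic[OF assms] mero_nz_eventually[OF assms]])
qed

lemma pole_count_eq:
  assumes "mero_nz f"
  shows "real (pole_count f t) = (\<Sum>x | norm x \<le> t \<and> pdiv f x \<noteq> 0. pdiv f x)"
proof -
  have 1: "a_point f Infty x \<longleftrightarrow> pdiv f x \<noteq> 0" for x
    unfolding a_point.simps is_pole_iff_zorder[OF assms] pdiv_def zord_def by linarith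
  have 2: "real (a_mult f Infty x) = pdiv f x" for x
    unfolding a_mult.simps pdiv_def zord_def by linarith
  show ?thesis unfolding pole_count_def 1 of_nat_sum 2 ..
qed

text \<open>On [R, 3R] the integrand is at least (n(R) - n(0)) / t, and the factor 3 is chosen
  because ln 3 \<ge> 1.\<close>

lemma pole_count_le_pole_counting:
  assumes f: "mero_nz f" and R: "R \<ge> 1"
  shows "real (pole_count f R) \<le> pole_counting f (3 * R)"
proof -
  define P where "P = (\<lambda>t. {x. norm x \<le> t \<and> pdiv f x \<noteq> 0})"
  have fin: "finite (P t)" for t using locfin_pdiv[OF f] unfolding P_def locfin_def by blast
  define n where "n = (\<lambda>t. real (pole_count f t))"
  have n: "n t = sum (pdiv f) (P t)" for t unfolding n_def P_def by (rule pole_count_eq[OF f])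
  have mono: "n s \<le> n t" if "s \<le> t" for s t
    unfolding n by (rule sum_mono2[OF fin]) (use that in \<open>auto simp: P_def pdiv_nonneg\<close>)
  have n0: "n t \<ge> 0" for t by (simp add: n_def)
  define \<phi> where "\<phi> = (\<lambda>t. (n t - n 0) / t)"
  define Q where "Q = P (3 * R) - P 0"
  have finQ: "finite Q" by (simp add: Q_def fin)
  \<comment> \<open>As a finite sum of functions 1 / t, each cut off below the norm of a nonzero
    pole, \<open>\<phi>\<close> is integrable down to 0.\<close>
  have \<phi>eq: "\<phi> t = (\<Sum>x\<in>Q. pdiv f x * (if t \<in> {norm x..} then 1 / t else 0))" if t: "t \<in> {0..3*R}" for t
  proof -
    have "n t - n 0 = sum (pdiv f) (P t - P 0)"
      unfolding n by (rule sum_diff[symmetric, OF fin]) (use t in \<open>auto simp: P_def\<close>)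
    also have "P t - P 0 = Q \<inter> {x. norm x \<le> t}" using t by (auto simp: Q_def P_def)
    also have "sum (pdiv f) \<dots> = (\<Sum>x\<in>Q. if norm x \<le> t then pdiv f x else 0)"
      using sum.inter_restrict[OF finQ, of "pdiv f" "{x. norm x \<le> t}"] by simp
    finally have "n t - n 0 = (\<Sum>x\<in>Q. if norm x \<le> t then pdiv f x else 0)" .
    then have "\<phi> t = (\<Sum>x\<in>Q. (if norm x \<le> t then pdiv f x else 0) / t)" unfolding \<phi>_def by (simp only: sum_divide_distrib)
    also have "\<dots> = (\<Sum>x\<in>Q. pdiv f x * (if t \<in> {norm x..} then 1 / t else 0))"
      by (intro sum.cong refl) auto
    finally show ?thesis .
  qed
  have int1: "((\<lambda>t. 1 / t) has_integral ln b - ln a) {a..b}" if "0 < a" "a \<le> b" for a b :: real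
  proof (rule fundamental_theorem_of_calculus[OF that(2)])
    fix x assume "x \<in> {a..b}"
    then have "(ln has_real_derivative 1 / x) (at x)" using that by (intro DERIV_ln_divide) auto
    then show "(ln has_vector_derivative 1 / x) (at x within {a..b})"
      unfolding has_real_derivative_iff_has_vector_derivative[symmetric] by (rule has_field_derivative_at_within)
  qed
  have "(\<lambda>t. \<Sum>x\<in>Q. pdiv f x * (if t \<in> {norm x..} then 1 / t else 0)) integrable_on {0..3*R}"
  proof (intro integrable_sum finQ integrable_on_mult_right)
    fix x assume x: "x \<in> Q"
    then have "norm x > 0" "norm x \<le> 3 * R" by (auto simp: Q_def P_def)
    then have "(\<lambda>t. 1 / t) integrable_on {norm x..3*R}" by (intro has_integral_integrable[OF int1])
    moreover have "{norm x..} \<inter> {0..3*R} = {norm x..3*R}" using order_trans[OF norm_ge_zero[of x]] by auto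
    ultimately have "(\<lambda>t. 1 / t) integrable_on ({norm x..} \<inter> {0..3*R})" by simp
    then show "(\<lambda>t. if t \<in> {norm x..} then 1 / t else 0) integrable_on {0..3*R}"
      by (subst integrable_restrict_Int)
  qed
  then have int\<phi>: "\<phi> integrable_on {0..3*R}"
    by (rule integrable_eq) (rule \<phi>eq[symmetric])
  then have int\<phi>': "\<phi> integrable_on {R..3*R}" by (rule integrable_on_subinterval) (use R in auto)
  have i2: "((\<lambda>t. (n R - n 0) * (1 / t)) has_integral (n R - n 0) * (ln (3 * R) - ln R)) {R..3*R}"
    by (intro has_integral_mult_right int1) (use R in auto)
  have "(n R - n 0) * (ln (3 * R) - ln R) = integral {R..3*R} (\<lambda>t. (n R - n 0) * (1 / t))"
    by (rule integral_unique[OF i2, symmetric])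
  also have "\<dots> \<le> integral {R..3*R} \<phi>"
  proof (rule integral_le)
    show "(\<lambda>t. (n R - n 0) * (1 / t)) integrable_on {R..3*R}"
      by (rule has_integral_integrable[OF i2])
    fix t assume t: "t \<in> {R..3*R}"
    then have "(n R - n 0) / t \<le> (n t - n 0) / t" using R mono[of R t] by (intro divide_right_mono) auto
    then show "(n R - n 0) * (1 / t) \<le> \<phi> t" by (simp add: \<phi>_def)
  qed (rule int\<phi>')
  also have "\<dots> \<le> integral {0..3*R} \<phi>"
  proof (rule integral_subset_le[OF _ int\<phi>' int\<phi>])
    show "\<forall>t\<in>{0..3*R}. 0 \<le> \<phi> t" using mono by (auto simp: \<phi>_def)
  qed (use R in auto)
  finally have 1: "(n R - n 0) * (ln (3 * R) - ln R) \<le> integral {0..3*R} \<phi>" .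
  have l3: "ln (3::real) \<ge> 1" using exp_le ln_mono[of "exp 1" 3] by simp
  have l: "ln (3 * R) = ln 3 + ln R" using R by (intro ln_mult_pos) auto
  have "ln R \<ge> 0" using R by simp
  then have "n 0 * 1 \<le> n 0 * ln (3 * R)" using l l3 n0 by (intro mult_left_mono) auto
  moreover have "(n R - n 0) * 1 \<le> (n R - n 0) * (ln (3 * R) - ln R)" using l l3 mono[of 0 R] R by (intro mult_left_mono) auto
  ultimately show ?thesis using 1 unfolding pole_counting_def \<phi>_def n_def by simp
qed

lemma proximity_eq: "proximity f r = cmean (\<lambda>z. ln_plus (norm (f z))) r"
  by (simp add: proximity_def cmean_def)

text \<open>A nonzero x has two roots, each with the pole order of f at x; x = 0 has one root with
  twice that order. The factor is 2 in both cases.\<close>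

lemma ncount_square_le:
  assumes "mero_nz f"
  shows "ncount (pdiv (\<lambda>z. f (z^2))) r \<le> 2 * real (pole_count f (r^2))"
proof -
  let ?g = "\<lambda>z. f (z^2)"
  define S where "S = {z. norm z < r \<and> pdiv ?g z \<noteq> 0}"
  have finS: "finite S" unfolding S_def by (intro locfin_finite locfin_pdiv mero_nz_square assms)
  have gz: "pdiv ?g z = (if z = 0 then 2 else 1) * pdiv f (z^2)" for z
    using zorder_square[OF assms, of z] by (auto simp: pdiv_def zord_def)
  have "ncount (pdiv ?g) r = (\<Sum>x\<in>(\<lambda>z. z^2) ` S. \<Sum>z | z \<in> S \<and> z^2 = x. pdiv ?g z)"
    unfolding ncount_def S_def[symmetric] by (rule sum.image_gen[OF finS])
  also have "\<dots> \<le> (\<Sum>x\<in>(\<lambda>z. z^2) ` S. 2 * pdiv f x)"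
  proof (rule sum_mono)
    fix x assume "x \<in> (\<lambda>z. z^2) ` S"
    show "(\<Sum>z | z \<in> S \<and> z^2 = x. pdiv ?g z) \<le> 2 * pdiv f x"
    proof (cases "x = 0")
      case True
      then have "(\<Sum>z | z \<in> S \<and> z^2 = x. pdiv ?g z) \<le> (\<Sum>z\<in>{0}. pdiv ?g z)"
        by (intro sum_mono2) (auto simp: pdiv_nonneg)
      then show ?thesis using True by (simp add: gz)
    next
      case False
      have "(\<Sum>z | z \<in> S \<and> z^2 = x. pdiv ?g z) = (\<Sum>z | z \<in> S \<and> z^2 = x. pdiv f x)"
        using False by (intro sum.cong refl) (auto simp: gz)
      also have "\<dots> \<le> (\<Sum>z\<in>{csqrt x, - csqrt x}. pdiv f x)"
      proof (intro sum_mono2)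
        show "{z \<in> S. z^2 = x} \<subseteq> {csqrt x, - csqrt x}"
        proof
          fix z assume "z \<in> {z \<in> S. z^2 = x}"
          then have "z^2 = (csqrt x)^2" by simp
          then have "z = csqrt x \<or> z = - csqrt x" by (rule power2_eq_iff[THEN iffD1])
          then show "z \<in> {csqrt x, - csqrt x}" by blast
        qed
      qed (auto simp: pdiv_nonneg)
      also have "\<dots> \<le> 2 * pdiv f x" using pdiv_nonneg[of f x] by (cases "csqrt x = - csqrt x") auto
      finally show ?thesis .
    qed
  qed
  also have "\<dots> = 2 * (\<Sum>x\<in>(\<lambda>z. z^2) ` S. pdiv f x)" by (simp add: sum_distrib_left)
  also have "(\<Sum>x\<in>(\<lambda>z. z^2) ` S. pdiv f x) \<le> real (pole_count f (r^2))"
    unfolding pole_count_eq[OF assms]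
  proof (rule sum_mono2)
    show "finite {x. norm x \<le> r^2 \<and> pdiv f x \<noteq> 0}" using locfin_pdiv[OF assms] by (simp add: locfin_def)
    show "(\<lambda>z. z^2) ` S \<subseteq> {x. norm x \<le> r^2 \<and> pdiv f x \<noteq> 0}"
      by (auto simp: S_def gz norm_power intro!: power_mono)
  qed (simp add: pdiv_nonneg)
  finally show ?thesis by simp
qed

text \<open>The counting part is estimated crudely, with ln r \<le> r, since only a bound polynomial
  in r is wanted.\<close>

lemma nchar_square_le:
  assumes f: "f nicely_meromorphic_on UNIV" and nz: "mero_nz f" and r: "r \<ge> 2"
    and g: "good_radius (\<lambda>z. f (z^2) - a) r"
  shows "nchar (\<lambda>z. f (z^2)) r \<le> nevanlinna_char f (r^2) + 2 * r * nevanlinna_char f (3 * r^2)"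
proof -
  let ?g = "\<lambda>z. f (z^2)"
  have r4: "r^2 \<ge> 4" using r power_mono[of 2 r 2] by simp
  have "continuous_on (sphere 0 (r^2)) f"
    by (rule good_radius_continuous_diff[OF good_radius_square[OF f g]]) (use r in auto)
  then have "continuous_on (sphere 0 (r^2)) (\<lambda>z. ln_plus (norm (f z)))" by (intro continuous_on_ln_plus continuous_intros)
  from cmean_square[OF this] r have 1: "cmean (\<lambda>z. ln_plus (norm (?g z))) r = proximity f (r^2)" by (simp add: proximity_eq)
  have prox: "proximity f R \<ge> 0" if "R \<ge> 0" for R unfolding proximity_eq using that by (intro cmean_nonneg ln_plus_nonneg)
  \<comment> \<open>The counting function at r^2 is nonnegative because it bounds a number of poles;
    r \<ge> 2 ensures r^2 / 3 \<ge> 1.\<close>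
  have "0 \<le> real (pole_count f (r^2 / 3))" by simp
  also have "\<dots> \<le> pole_counting f (3 * (r^2 / 3))" by (rule pole_count_le_pole_counting[OF nz]) (use r4 in auto)
  finally have 2: "proximity f (r^2) \<le> nevanlinna_char f (r^2)" by (simp add: nevanlinna_char_def)
  have lf: "locfin (pdiv ?g)" by (intro locfin_pdiv mero_nz_square nz)
  have "Ncount (pdiv ?g) r \<le> ncount (pdiv ?g) r * ln r"
    unfolding Ncount_def ncount_def sum_distrib_right
    using r by (intro sum_mono mult_left_mono lam_le_ln pdiv_nonneg) auto
  also have "\<dots> \<le> (2 * real (pole_count f (r^2))) * r"
    using r by (intro mult_mono ncount_square_le[OF nz] order_trans[OF ln_le_minus_one]) auto
  also have "\<dots> \<le> (2 * nevanlinna_char f (3 * r^2)) * r"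
  proof (intro mult_right_mono mult_left_mono)
    have "real (pole_count f (r^2)) \<le> pole_counting f (3 * r^2)" by (rule pole_count_le_pole_counting[OF nz]) (use r4 in auto)
    also have "\<dots> \<le> nevanlinna_char f (3 * r^2)" using prox[of "3 * r^2"] by (simp add: nevanlinna_char_def)
    finally show "real (pole_count f (r^2)) \<le> nevanlinna_char f (3 * r^2)" .
  qed (use r in auto)
  finally show ?thesis using 1 2 by (simp add: nchar_def mult_ac)
qed

lemma finite_order_bound:
  assumes "nevanlinna_order f < \<infinity>"
  obtains K :: nat and R0 :: real where "\<And>R. R > R0 \<Longrightarrow> nevanlinna_char f R \<le> R ^ K"
proof -
  have "nevanlinna_order f \<noteq> \<infinity>" using assms by auto
  then obtain B :: real where B: "nevanlinna_order f < ereal B" unfolding less_PInf_Ex_of_nat by blast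
  from Limsup_lessD[OF B[unfolded nevanlinna_order_def]]
  obtain R1 where R1: "\<And>R. R \<ge> R1 \<Longrightarrow> ereal (ln_plus (nevanlinna_char f R) / ln R) < ereal B"
    unfolding eventually_at_top_linorder by blast
  define K where "K = nat \<lceil>B\<rceil>"
  show ?thesis
  proof (rule that[of "max R1 2" K])
    fix R assume R: "R > max R1 2"
    then have "ln R > 0" by auto
    then have "ln_plus (nevanlinna_char f R) \<le> B * ln R" using R1[of R] R by (simp add: field_simps)
    also have "\<dots> \<le> real K * ln R" using \<open>ln R > 0\<close> by (intro mult_right_mono) (auto simp: K_def real_nat_ceiling_ge)
    finally have "exp (ln (max 1 (nevanlinna_char f R))) \<le> exp (real K * ln R)"
      unfolding ln_plus_def by (simp only: exp_le_cancel_iff)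
    then have "max 1 (nevanlinna_char f R) \<le> exp (real K * ln R)" by (subst (asm) exp_ln) auto
    also have "\<dots> = R ^ K" using R by (simp add: exp_of_nat_mult)
    finally show "nevanlinna_char f R \<le> R ^ K" by simp
  qed
qed

lemma nchar_square_bound:
  assumes f: "f nicely_meromorphic_on UNIV" and nz: "mero_nz f" and "nevanlinna_order f < \<infinity>"
  obtains K :: nat and r0 :: real where
    "\<And>r. r > r0 \<Longrightarrow> good_radius (\<lambda>z. f (z^2) - a) r \<Longrightarrow> nchar (\<lambda>z. f (z^2)) r \<le> r ^ K"
proof -
  obtain K R0 where K: "\<And>R. R > R0 \<Longrightarrow> nevanlinna_char f R \<le> R ^ K"
    using finite_order_bound[OF assms(3)] by blast
  show ?thesis
  \<comment> \<open>For r > 3 the inequality 3 r^2 \<le> r^3 produces the exponent 3 K, and 3 r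
    \<le> r^2 the additional 2.\<close>
  proof (rule that[of "max 3 R0" "3 * K + 2"])
    fix r :: real assume r: "r > max 3 R0" and g: "good_radius (\<lambda>z. f (z^2) - a) r"
    have r3: "r > 3" "r > R0" using r by auto
    have rr: "r \<le> r^2" using r3 mult_right_mono[of 1 r r] by (simp add: power2_eq_square)
    have "nchar (\<lambda>z. f (z^2)) r \<le> nevanlinna_char f (r^2) + 2 * r * nevanlinna_char f (3 * r^2)"
      by (rule nchar_square_le[OF f nz _ g]) (use r3 in auto)
    also have "\<dots> \<le> (r^2)^K + 2 * r * (3 * r^2)^K"
      using r3 rr by (intro add_mono mult_left_mono K) auto
    also have "\<dots> \<le> r * (r^3)^K + 2 * r * (r^3)^K"
    proof (intro add_mono mult_left_mono power_mono)
      have "(r^2)^K \<le> (r^3)^K" using r3 by (intro power_mono power_increasing) auto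
      also have "\<dots> \<le> r * (r^3)^K" using r3 by (simp add: mult_le_cancel_right1)
      finally show "(r^2)^K \<le> r * (r^3)^K" .
      show "3 * r^2 \<le> r^3" using r3 by (simp add: power3_eq_cube power2_eq_square mult_right_mono)
    qed (use r3 in auto)
    also have "\<dots> = 3 * r * (r^3)^K" by simp
    also have "\<dots> \<le> r * r * (r^3)^K" using r3 by (intro mult_right_mono) auto
    also have "(r^3)^K = r ^ (3 * K)" by (rule power_mult[symmetric])
    also have "r * r * r ^ (3 * K) = r ^ (3 * K + 2)" by (simp add: power_add power2_eq_square mult_ac)
    finally show "nchar (\<lambda>z. f (z^2)) r \<le> r ^ (3 * K + 2)" .
  qed
qed

subsection \<open>The kernel of the Wilson operator\<close>

text \<open>The difference vanishes off a sparse set. Near any x only finitely many points are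
  squares of exceptional ones, so \<open>wilson_quot f\<close> is 0 on a punctured neighbourhood;
  \<open>wilson_op\<close>, being a limit, is 0 at every x, also at x = 0 and where poles of f
  interfere.\<close>

lemma wilson_kernelI:
  assumes f: "f nicely_meromorphic_on UNIV" and D: "\<not> mero_nz (cdiff (\<lambda>z. f (z^2)))"
  shows "f \<in> wilson_kernel"
proof -
  let ?D = "cdiff (\<lambda>z. f (z^2))"
  have fm: "f meromorphic_on UNIV" using f by (simp add: nicely_meromorphic_on_def)
  have m: "(\<lambda>z. f ((z + c)^2)) meromorphic_on UNIV" for c
    by (rule meromorphic_on_compose[OF fm]) (auto intro!: analytic_intros)
  have Dm: "?D meromorphic_on UNIV"
    unfolding cdiff_def using meromorphic_on_diff[OF m[of "\<i>/2"] m[of "-(\<i>/2)"]] by simp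
  then have "eventually (\<lambda>z. ?D z = 0) (cosparse UNIV)"
    using meromorphic_imp_constant_or_avoid[OF Dm, of 0] D by (auto simp: mero_nz_def)
  then have sp: "{z. ?D z \<noteq> 0} sparse_in UNIV" by (simp add: eventually_cosparse)
  have "wilson_op f x = 0" for x
  proof -
    define T where "T = (\<lambda>z. z^2) ` (cball 0 (norm x + 1) \<inter> {z. ?D z \<noteq> 0})"
    have "finite T" unfolding T_def
      by (intro finite_imageI sparse_in_compact_finite sparse_in_subset[OF sp]) auto
    then have "eventually (\<lambda>w. w \<notin> T) (at x)"
      by (rule finite_eventually_notin)
    moreover have "eventually (\<lambda>w. w \<in> ball x 1) (at x)" by (intro eventually_at_in_open') auto
    ultimately have "eventually (\<lambda>w. 0 = wilson_quot f w) (at x)"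
    proof eventually_elim
      case (elim w)
      have "norm w \<le> norm x + 1" using elim(2) norm_triangle_sub[of w x] by (simp add: dist_norm norm_minus_commute)
      also have "\<dots> \<le> (norm x + 1)^2" by (simp add: power2_eq_square algebra_simps)
      finally have "norm (csqrt w) \<le> norm x + 1" unfolding norm_csqrt by (intro real_le_lsqrt) auto
      then have "?D (csqrt w) = 0" using elim(1) unfolding T_def by force
      then show ?case by (simp add: wilson_quot_def cdiff_def)
    qed
    then have "wilson_quot f \<midarrow>x\<rightarrow> 0" by (rule Lim_transform_eventually[OF tendsto_const])
    then show ?thesis unfolding wilson_op_def by (rule remove_sings_eqI)
  qed
  then show ?thesis using f by (simp add: wilson_kernel_def)
qed

subsection \<open>Wilson sequences in the plane of the square root\<close>

text \<open>The sign of \<open>\<sigma>\<close> treats both permitted half-planes at once; on the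
  cut the prescribed values select the upper half of the imaginary axis.\<close>

lemma wilson_branch_range:
  assumes "wilson_branch s"
  obtains \<sigma> :: real where "\<sigma> \<noteq> 0"
    "\<And>z. s (z^2) = z \<longleftrightarrow> \<sigma> * Re z > 0 \<or> Re z = 0 \<and> Im z \<ge> 0"
proof -
  have sq: "(s x)^2 = x" for x using assms by (simp add: wilson_branch_def)
  have im: "s (- of_real (t^2)) = \<i> * of_real t" if "t \<ge> 0" for t :: real
    using assms that by (simp add: wilson_branch_def)
  obtain \<sigma> :: real where \<sigma>: "\<sigma> \<noteq> 0" "\<And>x. x \<notin> \<real>\<^sub>\<le>\<^sub>0 \<Longrightarrow> \<sigma> * Re (s x) > 0"
  proof -
    from assms have "(\<forall>x. x \<notin> \<real>\<^sub>\<le>\<^sub>0 \<longrightarrow> Re (s x) > 0) \<or> (\<forall>x. x \<notin> \<real>\<^sub>\<le>\<^sub>0 \<longrightarrow> Re (s x) < 0)"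
      by (simp add: wilson_branch_def)
    then show thesis
    proof
      assume "\<forall>x. x \<notin> \<real>\<^sub>\<le>\<^sub>0 \<longrightarrow> Re (s x) > 0"
      then show thesis using that[of 1] by simp
    next
      assume "\<forall>x. x \<notin> \<real>\<^sub>\<le>\<^sub>0 \<longrightarrow> Re (s x) < 0"
      then show thesis using that[of "-1"] by simp
    qed
  qed
  have cases: "s (z^2) = z \<or> s (z^2) = - z" for z
    using sq[of "z^2"] by (rule power2_eq_iff[THEN iffD1])
  have off: "z^2 \<notin> \<real>\<^sub>\<le>\<^sub>0" if "Re z \<noteq> 0" for z
  proof
    assume "z^2 \<in> \<real>\<^sub>\<le>\<^sub>0"
    then have "Re z * Im z = 0" "(Re z)^2 - (Im z)^2 \<le> 0" by (auto simp: complex_nonpos_Reals_iff Re_power2 Im_power2)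
    then show False using that by simp
  qed
  show ?thesis
  proof (rule that[OF \<sigma>(1)])
    fix z
    show "s (z^2) = z \<longleftrightarrow> \<sigma> * Re z > 0 \<or> Re z = 0 \<and> Im z \<ge> 0"
    proof (cases "Re z = 0")
      case False
      then have "\<sigma> * Re (s (z^2)) > 0" by (intro \<sigma>(2) off)
      then show ?thesis using cases[of z] False by auto
    next
      case True
      then have z: "z = \<i> * of_real (Im z)" by (simp add: complex_eq_iff)
      then have "z^2 = (\<i> * of_real (Im z))^2" by simp
      also have "\<dots> = - of_real (\<bar>Im z\<bar>^2)" by (simp add: power_mult_distrib)
      finally have "s (z^2) = \<i> * of_real \<bar>Im z\<bar>" using im[of "\<bar>Im z\<bar>"] by simp
      then have "s (z^2) = z \<longleftrightarrow> \<bar>Im z\<bar> = Im z" using True by (auto simp: complex_eq_iff)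
      then show ?thesis using True by auto
    qed
  qed
qed

text \<open>Moving upwards keeps the real part and does not leave the upper imaginary axis, so the
  range of the branch is invariant.\<close>

lemma wilson_branch_add:
  fixes t :: real
  assumes s: "wilson_branch s" and z: "s (z^2) = z" and t: "t \<ge> 0"
  shows "s ((z + of_real t * \<i>)^2) = z + of_real t * \<i>"
proof (rule wilson_branch_range[OF s])
  fix \<sigma> :: real assume "\<And>z. s (z^2) = z \<longleftrightarrow> \<sigma> * Re z > 0 \<or> Re z = 0 \<and> Im z \<ge> 0"
  then show ?thesis using z t by auto
qed

lemma wplus_iterate:
  assumes s: "wilson_branch s"
  shows "(wplus s ^^ n) x = (s x + of_real (real n / 2) * \<i>)^2"
    and "s ((wplus s ^^ n) x) = s x + of_real (real n / 2) * \<i>"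
proof -
  have sq: "(s x)^2 = x" for x using s by (simp add: wilson_branch_def)
  have key: "s ((s x + of_real t * \<i>)^2) = s x + of_real t * \<i>" if "t \<ge> 0" for t x
    by (rule wilson_branch_add[OF s _ that]) (simp add: sq)
  show 1: "(wplus s ^^ n) x = (s x + of_real (real n / 2) * \<i>)^2"
  proof (induction n)
    case 0
    then show ?case by (simp add: sq)
  next
    case (Suc n)
    have "(wplus s ^^ Suc n) x = (s ((s x + of_real (real n / 2) * \<i>)^2) + \<i>/2)^2"
      by (simp add: Suc wplus_def)
    also have "s ((s x + of_real (real n / 2) * \<i>)^2) = s x + of_real (real n / 2) * \<i>" by (rule key) simp
    also have "s x + of_real (real n / 2) * \<i> + \<i>/2 = s x + of_real (real (Suc n) / 2) * \<i>"
      by (simp add: field_simps)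
    finally show ?case .
  qed
  show "s ((wplus s ^^ n) x) = s x + of_real (real n / 2) * \<i>"
    unfolding 1 by (rule key) simp
qed

fun sdiv :: "(complex \<Rightarrow> complex) \<Rightarrow> riemann_sphere \<Rightarrow> complex \<Rightarrow> real" where
  "sdiv f (Fin c) x = zdiv (\<lambda>w. f w - c) x"
| "sdiv f Infty x = pdiv f x"

lemma sdiv_nonneg: "sdiv f a x \<ge> 0"
  by (cases a) (simp_all add: zdiv_nonneg pdiv_nonneg)

lemma locfin_sdiv:
  assumes "nonconst f"
  shows "locfin (sdiv f a)"
proof (cases a)
  case (Fin c)
  then have "sdiv f a = zdiv (\<lambda>w. f w - c)" by auto
  then show ?thesis using locfin_zdiv[OF nonconst_mero_nz[OF assms]] by simp
next
  case Infty
  then have "sdiv f a = pdiv f" by auto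
  then show ?thesis using locfin_pdiv[OF nonconst_mero_nz0[OF assms]] by simp
qed

text \<open>At a pole the conventional value 0 could be mistaken for a zero; but there f - c has
  negative order, so \<open>sdiv\<close> vanishes. Elsewhere f is analytic, and the order of f - c
  is positive exactly where f equals c.\<close>

lemma a_point_iff_sdiv:
  assumes f: "f nicely_meromorphic_on UNIV" and nc: "nonconst f"
  shows "a_point f a x \<longleftrightarrow> sdiv f a x \<noteq> 0"
proof (cases a)
  case (Fin c)
  have pole: "is_pole f x \<longleftrightarrow> zorder (\<lambda>w. f w - c) x < 0"
  proof -
    have "is_pole f x \<longleftrightarrow> pdiv f x \<noteq> 0"
      unfolding is_pole_iff_zorder[OF nonconst_mero_nz0[OF nc]] pdiv_def zord_def by linarith
    also have "\<dots> \<longleftrightarrow> pdiv (\<lambda>w. f w - c) x \<noteq> 0" by (simp only: pdiv_diff_const[OF nc])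
    also have "\<dots> \<longleftrightarrow> zorder (\<lambda>w. f w - c) x < 0" unfolding pdiv_def zord_def by linarith
    finally show ?thesis .
  qed
  have "zorder (\<lambda>w. f w - c) x > 0 \<longleftrightarrow> f x = c" if "\<not> is_pole f x"
  proof -
    have "f analytic_on {x}" using nicely_meromorphic_on_imp_analytic_at[OF f _ that] by simp
    then have "(\<lambda>w. f w - c) analytic_on {x}" by (intro analytic_intros)
    from zorder_pos_iff'[OF this mero_nz_frequently[OF nonconst_mero_nz[OF nc]]] show ?thesis by simp
  qed
  then have "a_point f (Fin c) x \<longleftrightarrow> zorder (\<lambda>w. f w - c) x > 0" using pole by auto
  also have "\<dots> \<longleftrightarrow> zdiv (\<lambda>w. f w - c) x \<noteq> 0" unfolding zdiv_def zord_def by linarith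
  finally show ?thesis using Fin by simp
next
  case Infty
  have "is_pole f x \<longleftrightarrow> pdiv f x \<noteq> 0"
    unfolding is_pole_iff_zorder[OF nonconst_mero_nz0[OF nc]] pdiv_def zord_def by linarith
  then show ?thesis using Infty by simp
qed

lemma a_mult_eq_sdiv: "real (a_mult f a x) = sdiv f a x"
proof (cases a)
  case (Fin c)
  then show ?thesis unfolding Fin a_mult.simps sdiv.simps zdiv_def zord_def by linarith
next
  case Infty
  then show ?thesis unfolding Infty a_mult.simps sdiv.simps pdiv_def zord_def by linarith
qed

text \<open>Outside the finite set of exceptions an a-point is a member of some sequence, and its
  successor there, two steps of \<open>wplus\<close> away, is (s x + i)^2. All other points have
  multiplicity 0.\<close>

lemma wilson_exceptional_mono:
  assumes f: "f nicely_meromorphic_on UNIV" and nc: "nonconst f"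
    and s: "wilson_branch s" and ex: "wilson_exceptional s f a"
  obtains X where "finite X" "\<And>x. x \<notin> X \<Longrightarrow> sdiv f a x \<le> sdiv f a ((s x + \<i>)^2)"
proof -
  define X where "X = {x. a_point f a x \<and> \<not> (\<exists>x0 p. wilson_sequence s f a x0 \<and> x = (wplus s ^^ (2*p)) x0)}"
  show ?thesis
  proof (rule that[of X])
    show "finite X" using ex by (simp add: X_def wilson_exceptional_def)
    fix x assume x: "x \<notin> X"
    show "sdiv f a x \<le> sdiv f a ((s x + \<i>)^2)"
    proof (cases "a_point f a x")
      case False
      then have "sdiv f a x = 0" using a_point_iff_sdiv[OF f nc] by simp
      then show ?thesis by (simp add: sdiv_nonneg)
    next
      case True
      then obtain x0 p where p: "wilson_sequence s f a x0" "x = (wplus s ^^ (2*p)) x0" using x unfolding X_def by blast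
      obtain m where m: "\<And>p. a_mult f a ((wplus s ^^ (2*p)) x0) = m p" "\<And>p. m p \<le> m (Suc p)"
        using p(1) unfolding wilson_sequence_def by blast
      have "(wplus s ^^ (2 * Suc p)) x0 = (wplus s ^^ 2) x"
        unfolding p(2) by (simp add: numeral_2_eq_2)
      also have "\<dots> = (s x + \<i>)^2" using wplus_iterate(1)[OF s, of 2 x] by simp
      finally have "a_mult f a x \<le> a_mult f a ((s x + \<i>)^2)" using m(1)[of p] m(1)[of "Suc p"] m(2)[of p] p(2) by simp
      then show ?thesis using a_mult_eq_sdiv[of f a x] a_mult_eq_sdiv[of f a "(s x + \<i>)^2"] by linarith
    qed
  qed
qed

text \<open>The origin is excluded because multiplicities double there.\<close>

lemma sdiv_square:
  assumes "nonconst f" "z \<noteq> 0"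
  shows "sdiv (\<lambda>z. f (z^2)) a z = sdiv f a (z^2)"
proof (cases a)
  case (Fin c)
  then show ?thesis using zorder_square[OF nonconst_mero_nz[OF assms(1), of c], of z] assms(2)
    by (simp add: zdiv_def zord_def)
next
  case Infty
  then show ?thesis using zorder_square[OF nonconst_mero_nz0[OF assms(1)], of z] assms(2)
    by (simp add: pdiv_def zord_def)
qed

lemma finite_square_preimage:
  assumes "finite X"
  shows "finite {z::complex. (z + c)^2 \<in> X}"
proof (rule finite_subset)
  show "{z. (z + c)^2 \<in> X} \<subseteq> (\<lambda>x. csqrt x - c) ` X \<union> (\<lambda>x. - csqrt x - c) ` X"
  proof
    fix z assume z: "z \<in> {z. (z + c)^2 \<in> X}"
    have "(z + c)^2 = (csqrt ((z + c)^2))^2" by simp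
    then have "z + c = csqrt ((z + c)^2) \<or> z + c = - csqrt ((z + c)^2)" by (rule power2_eq_iff[THEN iffD1])
    then have "z = csqrt ((z + c)^2) - c \<or> z = - csqrt ((z + c)^2) - c" by (metis add_diff_cancel_right')
    then show "z \<in> (\<lambda>x. csqrt x - c) ` X \<union> (\<lambda>x. - csqrt x - c) ` X" using z by blast
  qed
qed (use assms in auto)

text \<open>
  In the plane of \<open>z\<close> a Wilson sequence moves upwards on the range of the branch, and by symmetry
  downwards on its negative. These two sets cover the plane, and away from a compact piece of the
  imaginary axis the points \<open>z + \<i>/2\<close> and \<open>z - \<i>/2\<close> lie on a common sequence.
\<close>

lemma displaced_sdiv_square:
  assumes f: "f nicely_meromorphic_on UNIV" and nc: "nonconst f"
    and s: "wilson_branch s" and ex: "wilson_exceptional s f a"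
  shows "displaced (sdiv (\<lambda>z. f (z^2)) a)"
proof -
  define M where "M = sdiv (\<lambda>z. f (z^2)) a"
  define H where "H = {z. s (z^2) = z}"
  obtain \<sigma> :: real where \<sigma>: "\<sigma> \<noteq> 0" "\<And>z. s (z^2) = z \<longleftrightarrow> \<sigma> * Re z > 0 \<or> Re z = 0 \<and> Im z \<ge> 0"
    by (rule wilson_branch_range[OF s]) (rule that)
  have H: "z \<in> H \<longleftrightarrow> \<sigma> * Re z > 0 \<or> Re z = 0 \<and> Im z \<ge> 0" for z by (simp add: H_def \<sigma>(2))
  have Hi: "z + \<i> \<in> H" if "z \<in> H" for z using that by (auto simp: H)
  have M: "M z = sdiv f a (z^2)" if "z \<noteq> 0" for z unfolding M_def by (rule sdiv_square[OF nc that])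
  have M0: "M z \<ge> 0" for z by (simp add: M_def sdiv_nonneg)
  have Mev: "M (- z) = M z" for z by (cases "z = 0") (simp_all add: M)
  have locM: "locfin M" unfolding M_def by (intro locfin_sdiv nonconst_square nc)
  obtain X where X: "finite X" "\<And>x. x \<notin> X \<Longrightarrow> sdiv f a x \<le> sdiv f a ((s x + \<i>)^2)"
    by (rule wilson_exceptional_mono[OF f nc s ex]) (rule that)
  \<comment> \<open>On \<open>H\<close> the branch returns z itself, so the successor of z^2 is the
    square of z + i.\<close>
  have up: "M z \<le> M (z + \<i>)" if "z \<in> H" "z \<noteq> 0" "z^2 \<notin> X" for z
  proof -
    have "z + \<i> \<noteq> 0" using that(1) by (auto simp: H complex_eq_iff)
    then show ?thesis using X(2)[OF that(3)] that by (simp add: M H_def)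
  qed
  \<comment> \<open>Excluded are the z for which z + i/2 or z - i/2 has its square in
    \<open>X\<close> or is 0, where multiplicities double, and those near 0 with positive
    multiplicity at z + i/2 or z - i/2. The latter handle the segment of the imaginary axis on which
    no sequence joins the two points.\<close>
  define E where "E = {z. (z + \<i>/2)^2 \<in> X} \<union> {z. (z + - (\<i>/2))^2 \<in> X} \<union> {\<i>/2, - (\<i>/2)}
    \<union> {z. norm z \<le> 1 \<and> M (z + \<i>/2) \<noteq> 0} \<union> {z. norm z \<le> 1 \<and> M (z + - (\<i>/2)) \<noteq> 0}"
  have "finite E"
    unfolding E_def using finite_square_preimage[OF X(1)] locfin_shift[OF locM] unfolding locfin_def by blast
  define w where "w = (\<lambda>z. if z - \<i>/2 \<in> H then z + \<i>/2 else z - \<i>/2)"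
  have inj: "inj w"
  proof (rule injI)
    \<comment> \<open>A collision would need an upward choice at z1 and a downward choice at z2
      ending at the same point. But \<open>H\<close> is closed under adding i, so the choice at z2
      would be upward as well.\<close>
    have no: False if "z1 - \<i>/2 \<in> H" "z2 - \<i>/2 \<notin> H" "z1 + \<i>/2 = z2 - \<i>/2" for z1 z2
      using Hi[OF that(1)] that by (simp add: algebra_simps)
    fix z1 z2 assume "w z1 = w z2"
    then show "z1 = z2" using no[of z1 z2] no[of z2 z1] unfolding w_def by (auto split: if_splits)
  qed
  have "norm (w z - z) \<le> 1/2" for z by (simp add: w_def)
  moreover have "max (M (z + \<i>/2)) (M (z - \<i>/2)) \<le> M (w z)" if z: "z \<notin> E" for z
  proof -
    have "z \<noteq> \<i>/2" "z \<noteq> - (\<i>/2)" using z unfolding E_def by blast+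
    then have nz: "z - \<i>/2 \<noteq> 0" "z + \<i>/2 \<noteq> 0" by (simp_all only: right_minus_eq add_eq_0_iff2 not_False_eq_True)
    have nX: "(z + \<i>/2)^2 \<notin> X" "(z - \<i>/2)^2 \<notin> X" using z by (auto simp: E_def)
    consider "z - \<i>/2 \<in> H" | "z - \<i>/2 \<notin> H" "- (z + \<i>/2) \<in> H" | "z - \<i>/2 \<notin> H" "- (z + \<i>/2) \<notin> H" by blast
    then show ?thesis
    proof cases
      case 1
      have "M (z - \<i>/2) \<le> M (z - \<i>/2 + \<i>)" by (rule up[OF 1 nz(1) nX(2)])
      also have "z - \<i>/2 + \<i> = z + \<i>/2" by (simp add: algebra_simps)
      finally show ?thesis using 1 by (simp add: w_def)
    next
      case 2
      \<comment> \<open>Since M is even, the sequence rising from -(z + i/2) is the mirror image of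
        one descending from z + i/2 to z - i/2.\<close>
      have "M (- (z + \<i>/2)) \<le> M (- (z + \<i>/2) + \<i>)"
      proof (rule up[OF 2(2)])
        show "- (z + \<i>/2) \<noteq> 0" using nz(2) by (simp only: neg_equal_0_iff_equal not_False_eq_True)
        show "(- (z + \<i>/2))^2 \<notin> X" using nX(1) by (simp only: power2_minus not_False_eq_True)
      qed
      also have "- (z + \<i>/2) + \<i> = - (z - \<i>/2)" by (simp add: algebra_simps)
      finally have "M (z + \<i>/2) \<le> M (z - \<i>/2)" by (simp only: Mev)
      then show ?thesis using 2 by (simp add: w_def)
    next
      case 3
      \<comment> \<open>Neither direction applies only on the imaginary axis with |Im z| \<le> 1/2,
        and there, outside \<open>E\<close>, both multiplicities are 0.\<close>
      have a: "\<not> \<sigma> * Re z > 0" "\<not> \<sigma> * Re z < 0" using 3 by (auto simp: H)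
      then have "Re z = 0" using \<sigma>(1) by (metis linorder_neqE_linordered_idom mult_eq_0_iff)
      moreover from this 3 have "\<bar>Im z\<bar> \<le> 1/2" by (auto simp: H)
      ultimately have "norm z \<le> 1" using cmod_le[of z] by simp
      then have "M (z + \<i>/2) = 0" "M (z - \<i>/2) = 0" using z by (auto simp: E_def)
      then show ?thesis using M0[of "w z"] by simp
    qed
  qed
  ultimately show ?thesis unfolding displaced_def M_def[symmetric] using \<open>finite E\<close> inj by blast
qed

lemma nonconst_or_constant:
  assumes "f nicely_meromorphic_on UNIV"
  shows "nonconst f \<or> (\<exists>c. \<forall>x. f x = c)"
proof (cases "\<exists>c. \<forall>x. f x = c")
  case False
  have "mero_nz (\<lambda>z. f z - a)" for a
  proof -
    have "eventually (\<lambda>x. f x \<noteq> a) (cosparse UNIV)"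
      using nicely_meromorphic_imp_constant_or_avoid[OF assms open_UNIV connected_UNIV, of a] False by auto
    moreover have "(\<lambda>z. f z - a) meromorphic_on UNIV"
      using assms by (auto simp: nicely_meromorphic_on_def intro!: meromorphic_intros)
    ultimately show ?thesis by (simp add: mero_nz_def)
  qed
  then show ?thesis by (simp add: nonconst_def)
qed auto

lemma wilson_dichotomy:
  assumes f: "f nicely_meromorphic_on UNIV" and ord: "nevanlinna_order f < \<infinity>" and A: "finite A"
    and dA: "\<And>a. a \<in> A \<Longrightarrow> displaced (zdiv (\<lambda>z. f (z^2) - a))"
    and cases: "card A \<ge> 3 \<or> card A = 2 \<and> displaced (pdiv (\<lambda>z. f (z^2)))"
    and nc: "nonconst f"
  shows "f \<in> wilson_kernel \<or> rational_function f"
proof (cases "mero_nz (cdiff (\<lambda>z. f (z^2)))")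
  case False
  then show ?thesis using wilson_kernelI[OF f] by simp
next
  case True
  have "A \<noteq> {}" using cases by auto
  then obtain a where a: "a \<in> A" by auto
  obtain K r0 where K: "\<And>r. r > r0 \<Longrightarrow> good_radius (\<lambda>z. f (z^2) - a) r \<Longrightarrow> nchar (\<lambda>z. f (z^2)) r \<le> r ^ K"
    by (rule nchar_square_bound[OF f nonconst_mero_nz0[OF nc] ord, of a]) (rule that)
  have "\<exists>C. \<forall>x. \<exists>r>x. admissible (\<lambda>z. f (z^2)) A r \<and> nchar (\<lambda>z. f (z^2)) r \<le> C * ln r"
  proof (rule logarithmic_growth[OF nonconst_square[OF nc] True A dA cases])
    fix r assume "r > r0" "admissible (\<lambda>z. f (z^2)) A r"
    then show "nchar (\<lambda>z. f (z^2)) r \<le> r ^ K" using a by (intro K) (auto simp: admissible_def)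
  qed
  then obtain C where "\<And>x. \<exists>r>x. admissible (\<lambda>z. f (z^2)) A r \<and> nchar (\<lambda>z. f (z^2)) r \<le> C * ln r" by blast
  from rational_of_log_growth[OF f nc a this] show ?thesis by simp
qed

theorem theorem3p4:
  fixes s f :: "complex \<Rightarrow> complex" and a b c :: riemann_sphere
  assumes "wilson_branch s"
    and "f nicely_meromorphic_on UNIV"
    and "nevanlinna_order f < \<infinity>"
    and "a \<noteq> b" and "b \<noteq> c" and "a \<noteq> c"
    and "wilson_exceptional s f a"
    and "wilson_exceptional s f b"
    and "wilson_exceptional s f c"
  shows "f \<in> wilson_kernel \<or> rational_function f"
proof (cases "nonconst f")
  case False
  then obtain k where "\<And>x. f x = k" using nonconst_or_constant[OF assms(2)] by auto
  then have "rational_function f"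
    unfolding rational_function_def by (intro exI[of _ "[:k:]"] exI[of _ 1]) simp
  then show ?thesis by simp
next
  case True
  define S where "S = {a, b, c}"
  have S: "card S = 3" using assms(4-6) by (simp add: S_def)
  have disp: "displaced (sdiv (\<lambda>z. f (z^2)) v)" if "v \<in> S" for v
    using displaced_sdiv_square[OF assms(2) True assms(1)] assms(7-9) that by (auto simp: S_def)
  \<comment> \<open>Finite values enter through zeros and infinity through poles: if infinity is
    among the three, two finite values and displaced poles remain.\<close>
  define A where "A = {x. Fin x \<in> S}"
  have "Fin ` A = S - {Infty}"
  proof
    show "S - {Infty} \<subseteq> Fin ` A"
    proof
      fix v assume "v \<in> S - {Infty}"
      then show "v \<in> Fin ` A" by (cases v) (auto simp: A_def)
    qed
  qed (auto simp: A_def)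
  moreover have inj: "inj_on Fin A" by (simp add: inj_on_def)
  ultimately have A: "finite A" "card A = card (S - {Infty})"
    using finite_imageD[of Fin A] card_image[OF inj] by (simp_all add: S_def)
  have "card A \<ge> 3 \<or> card A = 2 \<and> displaced (pdiv (\<lambda>z. f (z^2)))"
  proof (cases "Infty \<in> S")
    case True
    have "sdiv (\<lambda>z. f (z^2)) Infty = pdiv (\<lambda>z. f (z^2))" by auto
    then show ?thesis using disp[OF True] S A True by (simp add: S_def)
  next
    case False
    then show ?thesis using S A by simp
  qed
  moreover have "displaced (zdiv (\<lambda>z. f (z^2) - x))" if "x \<in> A" for x
  proof -
    have "sdiv (\<lambda>z. f (z^2)) (Fin x) = zdiv (\<lambda>z. f (z^2) - x)" by auto
    then show ?thesis using disp[of "Fin x"] that by (simp add: A_def)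
  qed
  ultimately show ?thesis using wilson_dichotomy[OF assms(2,3) A(1)] True by blast
qed

end
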